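(* Let $\xi$ be a fixed Higgs tensor on the real torus $\mathbb{T}^n$. The real moment map equation $$\left(\left(\mathbb{1}-\xi\,D^2u\,\bar\xi\,D^2u\right)^{1/2}(D^2u)^{-1}\right)^{ab}{}_{,ab}=0$$ for $u\in\mathcal A(\xi)$ is the Euler–Lagrange equation, with respect to variations of the symplectic potential $u$, of the periodic HK-energy $\widehat{\mathcal F}(u,\xi)$. That is, $u\in\mathcal A(\xi)$ satisfies the equation if and only if $\frac{d}{dt}\big|_{t=0}\widehat{\mathcal F}(u+t\varphi,\xi)=0$ for all smooth $\mathbb{Z}^n$-periodic functions $\varphi$.
   Context: $\mathbb{T}^n=\mathbb{R}^n/\mathbb{Z}^n$ with coordinates $y$ and Lebesgue measure $d\mu$. Indices after a comma are partial derivatives, and repeated indices are summed. A symplectic potential is a function $u(y)=\frac12|y|^2+\phi(y)$ with $\phi$ smooth and $\mathbb{Z}^n$-periodic and $D^2u$ positive definite everywhere. A Higgs tensor is a smooth $\mathbb{Z}^n$-periodic function $\xi=(\xi^{ab}(y))$ with values in complex symmetric $n\times n$ matrices; $\bar\xi$ is its complex conjugate. $\mathcal A(\xi)$ is the set of symplectic potentials $u$ with $r(\xi\,D^2u\,\bar\xi\,D^2u)<1$ everywhere, where $r$ is the spectral radius. For $u\in\mathcal A(\xi)$ the matrix $\xi\,D^2u\,\bar\xi\,D^2u$ is diagonalizable with eigenvalues in $[0,1)$, and the square root above is the unique one with positive eigenvalues. For $x\in[0,1]$ let $f(x)=1-(1-x)^{1/2}+\log(1+(1-x)^{1/2})$ and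 set $\rho(\xi\,D^2u\,\bar\xi\,D^2u)=\mathrm{Tr}\,f(\xi\,D^2u\,\bar\xi\,D^2u)$ (the sum of $f$ over the eigenvalues). The periodic HK-energy is $$\widehat{\mathcal F}(u,\xi)=-\frac12\int_{\mathbb T^n}\log\det(D^2u)\,d\mu+\frac12\int_{\mathbb T^n}\rho(\xi\,D^2u\,\bar\xi\,D^2u)\,d\mu.$$ *)

theory Defs
  imports "HOL-Analysis.Analysis"
begin

text \<open>
  Functions on the torus \<open>\<real>\<^sup>n/\<int>\<^sup>n\<close> are \<open>\<int>\<^sup>n\<close>-periodic functions on \<open>\<real>\<^sup>n\<close>, represented by
  \<^typ>\<open>real^'n\<close>; integration over the torus is integration over the unit cube.
\<close>

definition partial_derivative ::
    "'n \<Rightarrow> (real^'n \<Rightarrow> 'b::real_normed_vector) \<Rightarrow> real^'n \<Rightarrow> 'b" where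
  "partial_derivative a f y = vector_derivative (\<lambda>t. f (y + t *\<^sub>R axis a 1)) (at 0)"

text \<open>
  Smooth means \<open>C\<^sup>\<infinity>\<close>. Requiring every iterated partial derivative (including the function itself)
  to be totally differentiable is the same as requiring all of them to exist and be continuous.
\<close>

definition smooth :: "(real^'n \<Rightarrow> 'b::real_normed_vector) \<Rightarrow> bool" where
  "smooth f \<longleftrightarrow> (\<forall>as y. foldr partial_derivative as f differentiable (at y))"

definition periodic :: "(real^'n \<Rightarrow> 'b) \<Rightarrow> bool" where
  "periodic f \<longleftrightarrow> (\<forall>y (k::int^'n). f (y + (\<chi> a. of_int (k $ a))) = f y)"

definition hessian :: "(real^'n \<Rightarrow> real) \<Rightarrow> real^'n \<Rightarrow> real^'n^'n" where
  "hessian u y = (\<chi> a b. partial_derivative b (partial_derivative a u) y)"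

definition symplectic_potential :: "(real^'n \<Rightarrow> real) \<Rightarrow> bool" where
  "symplectic_potential u \<longleftrightarrow>
     (\<exists>\<phi>. smooth \<phi> \<and> periodic \<phi> \<and> u = (\<lambda>y. (norm y)\<^sup>2 / 2 + \<phi> y)) \<and>
     (\<forall>y v. v \<noteq> 0 \<longrightarrow> 0 < v \<bullet> (hessian u y *v v))"

definition higgs_tensor :: "(real^'n \<Rightarrow> complex^'n^'n) \<Rightarrow> bool" where
  "higgs_tensor \<xi> \<longleftrightarrow> smooth \<xi> \<and> periodic \<xi> \<and> (\<forall>y. transpose (\<xi> y) = \<xi> y)"

definition complex_hessian :: "(real^'n \<Rightarrow> real) \<Rightarrow> real^'n \<Rightarrow> complex^'n^'n" where
  "complex_hessian u y = map_matrix complex_of_real (hessian u y)"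

definition higgs_endomorphism ::
    "(real^'n \<Rightarrow> complex^'n^'n) \<Rightarrow> (real^'n \<Rightarrow> real) \<Rightarrow> real^'n \<Rightarrow> complex^'n^'n" where
  "higgs_endomorphism \<xi> u y =
     \<xi> y ** complex_hessian u y ** map_matrix cnj (\<xi> y) ** complex_hessian u y"

definition eigenvalues :: "complex^'n^'n \<Rightarrow> complex set" where
  "eigenvalues A = {z. \<exists>v. v \<noteq> 0 \<and> A *v v = z *s v}"

definition spectral_radius :: "complex^'n^'n \<Rightarrow> real" where
  "spectral_radius A = Max (norm ` eigenvalues A)"

definition admissible_potentials ::
    "(real^'n \<Rightarrow> complex^'n^'n) \<Rightarrow> (real^'n \<Rightarrow> real) set" where
  "admissible_potentials \<xi> =
     {u. symplectic_potential u \<and> (\<forall>y. spectral_radius (higgs_endomorphism \<xi> u y) < 1)}"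

text \<open>The unique square root with positive eigenvalues.\<close>

definition matrix_sqrt :: "complex^'n^'n \<Rightarrow> complex^'n^'n" where
  "matrix_sqrt A =
     (THE S. S ** S = A \<and> (\<forall>z\<in>eigenvalues S. \<exists>s>0. z = complex_of_real s))"

definition diagonal_matrix :: "real^'n \<Rightarrow> complex^'n^'n" where
  "diagonal_matrix d = (\<chi> i j. if i = j then complex_of_real (d $ i) else 0)"

text \<open>
  Functional calculus for diagonalizable matrices with real eigenvalues. The value does not depend
  on the diagonalization chosen, as the lemma below shows.
\<close>

definition matrix_function :: "(real \<Rightarrow> real) \<Rightarrow> complex^'n^'n \<Rightarrow> complex^'n^'n" where
  "matrix_function g A =
     (THE B. \<exists>(P :: complex^'n^'n) d. invertible P \<and>
        A = P ** diagonal_matrix d ** matrix_inv P \<and>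
        B = P ** diagonal_matrix (\<chi> i. g (d $ i)) ** matrix_inv P)"

lemma matrix_inv_left_right:
  fixes P :: "complex^'n^'n"
  assumes "invertible P"
  shows "matrix_inv P ** P = mat 1" "P ** matrix_inv P = mat 1"
proof -
  have "\<exists>Q. P ** Q = mat 1 \<and> Q ** P = mat 1"
    using assms unfolding invertible_def .
  then have "P ** matrix_inv P = mat 1 \<and> matrix_inv P ** P = mat 1"
    unfolding matrix_inv_def by (rule someI_ex)
  then show "matrix_inv P ** P = mat 1" "P ** matrix_inv P = mat 1"
    by auto
qed

lemma matrix_function_diagonalized:
  fixes A P :: "complex^'n^'n" and d :: "real^'n" and g :: "real \<Rightarrow> real"
  assumes P: "invertible P" and A: "A = P ** diagonal_matrix d ** matrix_inv P"
  shows "matrix_function g A = P ** diagonal_matrix (\<chi> i. g (d $ i)) ** matrix_inv P"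
proof -
  have "Q ** diagonal_matrix (\<chi> i. g (e $ i)) ** matrix_inv Q =
        P ** diagonal_matrix (\<chi> i. g (d $ i)) ** matrix_inv P"
    if Q: "invertible Q" and AQ: "A = Q ** diagonal_matrix e ** matrix_inv Q"
    for Q :: "complex^'n^'n" and e
  proof -
    define R where "R = matrix_inv Q ** P"
    have diag_right: "(M ** diagonal_matrix c) $ i $ j = M $ i $ j * complex_of_real (c $ j)"
      for M :: "complex^'n^'n" and c i j
      by (simp add: matrix_matrix_mult_def diagonal_matrix_def if_distrib[of "\<lambda>x. _ * x"] cong: if_cong)
    have diag_left: "(diagonal_matrix c ** M) $ i $ j = complex_of_real (c $ i) * M $ i $ j"
      for M :: "complex^'n^'n" and c i j
      by (simp add: matrix_matrix_mult_def diagonal_matrix_def if_distrib[of "\<lambda>x. x * _"] cong: if_cong)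
    have "matrix_inv Q ** A ** P = R ** diagonal_matrix d"
      unfolding A R_def by (metis P matrix_inv_left_right(1) matrix_mul_assoc matrix_mul_rid)
    moreover have "matrix_inv Q ** A ** P = diagonal_matrix e ** R"
      unfolding AQ R_def by (metis Q matrix_inv_left_right(1) matrix_mul_assoc matrix_mul_lid)
    ultimately have comm: "R ** diagonal_matrix d = diagonal_matrix e ** R"
      by simp
    have "R $ i $ j * complex_of_real (g (d $ j)) = complex_of_real (g (e $ i)) * R $ i $ j" for i j
    proof -
      have "R $ i $ j * complex_of_real (d $ j) = complex_of_real (e $ i) * R $ i $ j"
        using comm by (metis diag_left diag_right)
      then show ?thesis
        by (cases "R $ i $ j = 0") auto
    qed
    then have "R ** diagonal_matrix (\<chi> i. g (d $ i)) = diagonal_matrix (\<chi> i. g (e $ i)) ** R"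
      by (simp add: vec_eq_iff diag_left diag_right)
    then have "Q ** (R ** diagonal_matrix (\<chi> i. g (d $ i))) ** matrix_inv P =
        Q ** (diagonal_matrix (\<chi> i. g (e $ i)) ** R) ** matrix_inv P"
      by simp
    moreover have "Q ** R = P"
      unfolding R_def by (metis Q matrix_inv_left_right(2) matrix_mul_assoc matrix_mul_lid)
    moreover have "R ** matrix_inv P = matrix_inv Q"
      unfolding R_def by (metis P matrix_inv_left_right(2) matrix_mul_assoc matrix_mul_rid)
    ultimately show ?thesis
      by (metis matrix_mul_assoc)
  qed
  then show ?thesis
    unfolding matrix_function_def using P A by (intro the_equality) blast+
qed

definition hk_function :: "real \<Rightarrow> real" where
  "hk_function x = 1 - sqrt (1 - x) + ln (1 + sqrt (1 - x))"

text \<open>For admissible potentials the trace below is real; \<^const>\<open>Re\<close> only adjusts the type.\<close>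

definition hk_density :: "complex^'n^'n \<Rightarrow> real" where
  "hk_density A = Re (trace (matrix_function hk_function A))"

definition periodic_HK_energy ::
    "(real^'n \<Rightarrow> real) \<Rightarrow> (real^'n \<Rightarrow> complex^'n^'n) \<Rightarrow> real" where
  "periodic_HK_energy u \<xi> =
     - (1/2) * (LINT y:cbox 0 1|lborel. ln (det (hessian u y)))
     + (1/2) * (LINT y:cbox 0 1|lborel. hk_density (higgs_endomorphism \<xi> u y))"

definition moment_map_tensor ::
    "(real^'n \<Rightarrow> complex^'n^'n) \<Rightarrow> (real^'n \<Rightarrow> real) \<Rightarrow> real^'n \<Rightarrow> complex^'n^'n" where
  "moment_map_tensor \<xi> u y =
     matrix_sqrt (mat 1 - higgs_endomorphism \<xi> u y) ** matrix_inv (complex_hessian u y)"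

definition real_moment_map_equation ::
    "(real^'n \<Rightarrow> complex^'n^'n) \<Rightarrow> (real^'n \<Rightarrow> real) \<Rightarrow> bool" where
  "real_moment_map_equation \<xi> u \<longleftrightarrow>
     (\<forall>y. (\<Sum>a\<in>UNIV. \<Sum>b\<in>UNIV.
        partial_derivative b (partial_derivative a (\<lambda>z. moment_map_tensor \<xi> u z $ a $ b)) y) = 0)"

end

theory Submission
  imports Defs
begin

text \<open>
  With \<open>H = D\<^sup>2u\<close>, its positive square root \<open>R\<close> and the symmetric matrix \<open>B = R \<xi> R\<close>, the endomorphism
  \<open>\<xi> H \<xi>\<^sup>* H\<close> is conjugate by \<open>R\<close> to the Hermitian matrix \<open>B B\<^sup>*\<close>. The spectral radius condition says that
  \<open>1 - B B\<^sup>*\<close> is positive definite; let \<open>T\<close> be its positive square root. Then the tensor of the moment map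
  equation is \<open>G = R\<^sup>-\<^sup>1 T R\<^sup>-\<^sup>1\<close> and twice the energy density is \<open>n - log det H - Tr T + log det (1 + T)\<close>.

  Positive square roots solve a quadratic equation whose linearisation is a Sylvester equation
  \<open>T X + X T = Z\<close>. It is uniquely and stably solvable for positive definite \<open>T\<close>, which gives continuity and
  smoothness of \<open>R\<close> and \<open>T\<close>, and the first variation \<open>- Re Tr (G D\<^sup>2\<phi>) / 2\<close> of the density.
  Integrating by parts twice on the torus turns the variation of the energy into the \<open>L\<^sup>2\<close> pairing of
  \<open>\<phi>\<close> with the double divergence of \<open>Re G\<close>, which is itself an admissible test function. The double
  divergence of \<open>Im G\<close> vanishes because \<open>G\<close> is Hermitian.
\<close>

section \<open>Positive definite Hermitian matrices\<close>

text \<open>The function in the energy is made for its variation to close up. With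
  \<open>s = sqrt (1 - x)\<close> the derivative of \<open>hk_function\<close> at \<open>x\<close>
  is \<open>1 / (2 * (1 + s))\<close>, and \<open>x = (1 - s) * (1 + s)\<close>, so
  \<open>2 * x\<close> times this derivative is \<open>1 - s\<close>. The endomorphism is quadratic
  in the Hessian. In dimension one the Higgs term therefore contributes \<open>(1 - s) / 2\<close>
  and \<open>- ln det H\<close> contributes \<open>- 1 / 2\<close> times the logarithmic variation
  of \<open>H\<close>; what remains is \<open>- s / 2\<close>, matching \<open>- G / 2\<close>.

  In higher dimension the factors do not commute, and eigenvalues and eigenvectors need not be
  differentiable where eigenvalues meet. Spectral decompositions are therefore used only at a fixed
  point, for existence and for identifying traces and determinants; every derivative comes from the
  equations of the square roots and from \<open>det\<close>. The spectral radius condition is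
  replaced by positivity because positivity is visibly open, so that it persists for small
  \<open>t\<close>, uniformly over the compact unit cube.\<close>

lemma bounded_bilinear_matrix_mult:
  "bounded_bilinear ((**) :: complex^'n^'m \<Rightarrow> complex^'p^'n \<Rightarrow> complex^'p^'m)"
proof -
  have "bilinear ((**) :: complex^'n^'m \<Rightarrow> complex^'p^'n \<Rightarrow> complex^'p^'m)"
    unfolding bilinear_def
    by (auto intro!: linearI simp: vec_eq_iff matrix_matrix_mult_def sum.distrib algebra_simps
        scaleR_sum_right)
  then show ?thesis
    by (simp add: bilinear_conv_bounded_bilinear)
qed

interpretation matmul: bounded_bilinear "(**) :: complex^'n^'m \<Rightarrow> complex^'p^'n \<Rightarrow> complex^'p^'m"
  by (rule bounded_bilinear_matrix_mult)

lemmas matmul_simps = matmul.add_left matmul.add_right matmul.diff_left matmul.diff_right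
  matmul.minus_left matmul.minus_right

definition adjoint_matrix :: "complex^'n^'m \<Rightarrow> complex^'m^'n" where
  "adjoint_matrix A = (\<chi> i j. cnj (A $ j $ i))"

definition hermitian :: "complex^'n^'n \<Rightarrow> bool" where
  "hermitian A \<longleftrightarrow> adjoint_matrix A = A"

text \<open>The inner product on \<open>complex^'n\<close> is real: it is the real part of the
  Hermitian form. Positivity is kept apart from \<open>hermitian\<close> because alone it is an open
  condition in the space of all matrices.\<close>

definition positive_matrix :: "complex^'n^'n \<Rightarrow> bool" where
  "positive_matrix A \<longleftrightarrow> (\<forall>v. v \<noteq> 0 \<longrightarrow> 0 < v \<bullet> (A *v v))"

definition posdef :: "complex^'n^'n \<Rightarrow> bool" where
  "posdef A \<longleftrightarrow> hermitian A \<and> positive_matrix A"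

lemma adjoint_matrix_mult: "adjoint_matrix (A ** B) = adjoint_matrix B ** adjoint_matrix A"
  by (simp add: adjoint_matrix_def matrix_matrix_mult_def vec_eq_iff mult.commute)

lemma adjoint_matrix_adjoint_matrix [simp]: "adjoint_matrix (adjoint_matrix A) = A"
  by (simp add: adjoint_matrix_def vec_eq_iff)

lemma adjoint_matrix_add: "adjoint_matrix (A + B) = adjoint_matrix A + adjoint_matrix B"
  by (simp add: adjoint_matrix_def vec_eq_iff)

lemma adjoint_matrix_diff: "adjoint_matrix (A - B) = adjoint_matrix A - adjoint_matrix B"
  by (simp add: adjoint_matrix_def vec_eq_iff)

lemma adjoint_matrix_mat1 [simp]: "adjoint_matrix (mat 1 :: complex^'n^'n) = mat 1"
  by (simp add: adjoint_matrix_def vec_eq_iff mat_def)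

lemma adjoint_diagonal_matrix [simp]: "adjoint_matrix (diagonal_matrix d) = diagonal_matrix d"
  by (simp add: adjoint_matrix_def vec_eq_iff diagonal_matrix_def)

lemma adjoint_matrix_cnj: "adjoint_matrix (map_matrix cnj A) = map_matrix cnj (adjoint_matrix A)"
  by (simp add: adjoint_matrix_def vec_eq_iff)

lemma adjoint_matrix_eq_transpose: "adjoint_matrix A = map_matrix cnj (transpose A)"
  by (simp add: adjoint_matrix_def vec_eq_iff transpose_def)

lemma cnj_matrix_mult: "map_matrix cnj (A ** B) = map_matrix cnj A ** map_matrix cnj B"
  by (simp add: matrix_matrix_mult_def vec_eq_iff)

lemma cnj_matrix_diff: "map_matrix cnj (A - B) = map_matrix cnj A - map_matrix cnj B"
  by (simp add: vec_eq_iff)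

lemma cnj_matrix_add: "map_matrix cnj (A + B) = map_matrix cnj A + map_matrix cnj B"
  by (simp add: vec_eq_iff)

lemma cnj_matrix_mat1 [simp]: "map_matrix cnj (mat 1 :: complex^'n^'n) = mat 1"
  by (simp add: vec_eq_iff mat_def)

lemma cnj_matrix_cnj_matrix [simp]: "map_matrix cnj (map_matrix cnj A) = A"
  by (simp add: vec_eq_iff)

lemma inner_eq_Re: "(v :: complex^'n) \<bullet> w = Re (\<Sum>k\<in>UNIV. cnj (v $ k) * w $ k)"
  by (simp add: inner_vec_def inner_complex_def)

lemma inner_adjoint_matrix: "(A *v v) \<bullet> w = v \<bullet> (adjoint_matrix A *v w)"
proof -
  have "(\<Sum>k\<in>UNIV. cnj ((A *v v) $ k) * w $ k) = (\<Sum>k\<in>UNIV. \<Sum>j\<in>UNIV. cnj (A $ k $ j) * cnj (v $ j) * w $ k)"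
    by (simp add: matrix_vector_mult_def sum_distrib_right)
  also have "\<dots> = (\<Sum>j\<in>UNIV. \<Sum>k\<in>UNIV. cnj (A $ k $ j) * cnj (v $ j) * w $ k)"
    by (rule sum.swap)
  also have "\<dots> = (\<Sum>j\<in>UNIV. cnj (v $ j) * (adjoint_matrix A *v w) $ j)"
    by (simp add: matrix_vector_mult_def adjoint_matrix_def sum_distrib_left mult.assoc mult.left_commute)
  finally show ?thesis
    by (simp add: inner_eq_Re)
qed

lemma matrix_vector_scaleR: "A *v (c *\<^sub>R v) = c *\<^sub>R (A *v (v :: complex^'n))"
  by (simp add: vec_eq_iff matrix_vector_mult_def scaleR_sum_right)

lemma hermitian_inner: "hermitian A \<Longrightarrow> (A *v v) \<bullet> w = v \<bullet> (A *v w)"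
  by (simp add: inner_adjoint_matrix hermitian_def)

lemma hermitian_conjugate:
  "hermitian A \<Longrightarrow> hermitian (adjoint_matrix B ** A ** B)"
  by (simp add: hermitian_def adjoint_matrix_mult matrix_mul_assoc)

lemma inner_conjugate: "v \<bullet> ((adjoint_matrix B ** A ** B) *v v) = (B *v v) \<bullet> (A *v (B *v v))"
  by (simp add: inner_adjoint_matrix matrix_vector_mul_assoc matrix_mul_assoc)

lemma positive_conjugate:
  assumes "positive_matrix A" "C ** B = mat 1"
  shows "positive_matrix (adjoint_matrix B ** A ** B)"
proof -
  have "B *v v \<noteq> 0" if "v \<noteq> 0" for v
  proof
    assume "B *v v = 0"
    then have "C *v (B *v v) = 0" by simp
    then have "v = 0" using assms(2) by (simp add: matrix_vector_mul_assoc)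
    with that show False by simp
  qed
  then show ?thesis
    using assms(1) unfolding positive_matrix_def inner_conjugate by auto
qed

lemma posdef_conjugate:
  assumes "posdef A" "C ** B = mat 1"
  shows "posdef (adjoint_matrix B ** A ** B)"
  using assms positive_conjugate hermitian_conjugate by (auto simp: posdef_def)

text \<open>The form attains a positive minimum on the compact unit sphere and is homogeneous of
  degree two. The constant drives all later estimates for Sylvester equations.\<close>

lemma positive_coercive:
  fixes A :: "complex^'n^'n"
  assumes "positive_matrix A"
  obtains c where "0 < c" "\<And>v. c * (norm v)\<^sup>2 \<le> v \<bullet> (A *v v)"
proof -
  let ?q = "\<lambda>v. v \<bullet> (A *v v)"
  have cont: "continuous_on (sphere 0 1) ?q"
    by (intro continuous_intros linear_continuous_on linear_conv_bounded_linear[THEN iffD1]) auto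
  have ne: "sphere (0 :: complex^'n) 1 \<noteq> {}" by simp
  obtain v0 where v0: "v0 \<in> sphere 0 1" and min: "\<And>v. v \<in> sphere 0 1 \<Longrightarrow> ?q v0 \<le> ?q v"
    using continuous_attains_inf[OF compact_sphere ne cont] by blast
  have "v0 \<noteq> 0" using v0 by auto
  then have "0 < ?q v0" using assms by (simp add: positive_matrix_def)
  moreover have "?q v0 * (norm v)\<^sup>2 \<le> ?q v" for v
  proof (cases "v = 0")
    case False
    let ?w = "inverse (norm v) *\<^sub>R v"
    have "?q v0 \<le> ?q ?w" using False by (intro min) simp
    also have "?q ?w = ?q v / (norm v)\<^sup>2"
      by (simp add: matrix_vector_scaleR power2_eq_square divide_simps)
    finally show ?thesis using False by (simp add: field_simps)
  qed simp
  ultimately show ?thesis by (rule that)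
qed

lemma open_positive: "open {A :: complex^'n^'n. positive_matrix A}"
proof (rule openI)
  fix A :: "complex^'n^'n" assume "A \<in> {A. positive_matrix A}"
  then have "positive_matrix A" by simp
  then obtain c where c: "0 < c" "\<And>v. c * (norm v)\<^sup>2 \<le> v \<bullet> (A *v v)"
    using positive_coercive by blast
  have "bilinear ((*v) :: complex^'n^'n \<Rightarrow> complex^'n \<Rightarrow> complex^'n)"
    unfolding bilinear_def
    by (auto intro!: linearI simp: algebra_simps vec_eq_iff matrix_vector_mult_def sum.distrib scaleR_sum_right)
  then have "bounded_bilinear ((*v) :: complex^'n^'n \<Rightarrow> complex^'n \<Rightarrow> complex^'n)"
    by (simp add: bilinear_conv_bounded_bilinear)
  then obtain K where K: "0 < K" "\<And>(B :: complex^'n^'n) v. norm (B *v v) \<le> norm B * norm v * K"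
    using bounded_bilinear.pos_bounded by blast
  \<comment> \<open>A perturbation smaller than \<open>c / K\<close> changes the form by less than
    the margin \<open>c * (norm v)^2\<close>.\<close>
  have "positive_matrix B" if "B \<in> ball A (c / K)" for B
    unfolding positive_matrix_def
  proof (intro allI impI)
    fix v :: "complex^'n" assume v: "v \<noteq> 0"
    have "norm ((A - B) *v v) \<le> norm (A - B) * norm v * K" by (rule K)
    moreover have "norm (A - B) * K < c"
      using that K(1) by (simp add: dist_norm field_simps)
    then have "norm (A - B) * K * (norm v)\<^sup>2 < c * (norm v)\<^sup>2" using v by simp
    moreover have "v \<bullet> ((A - B) *v v) \<le> norm v * norm ((A - B) *v v)"
      by (rule norm_cauchy_schwarz)
    moreover have "norm v * norm ((A - B) *v v) \<le> norm v * (norm (A - B) * norm v * K)"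
      by (intro mult_left_mono K) auto
    ultimately have "v \<bullet> ((A - B) *v v) < c * (norm v)\<^sup>2"
      by (simp add: power2_eq_square mult_ac)
    then show "0 < v \<bullet> (B *v v)" using c(2)[of v] by (simp add: algebra_simps)
  qed
  then show "\<exists>\<epsilon>>0. ball A \<epsilon> \<subseteq> {A. positive_matrix A}"
    using c K by (intro exI[of _ "c / K"]) auto
qed

section \<open>A priori bounds for Sylvester equations\<close>

lemma inner_matrix_columns: "(X :: complex^'n^'n) \<bullet> Y = (\<Sum>j\<in>UNIV. column j X \<bullet> column j Y)"
  unfolding inner_vec_def column_def by (simp, rule sum.swap)

lemma column_matrix_mult: "column j (A ** X) = A *v column j X"
  by (simp add: column_def matrix_matrix_mult_def matrix_vector_mult_def vec_eq_iff)

text \<open>Left multiplication acts on each column separately, and the inner product of matrices is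
  the sum over columns, so the constant for vectors survives.\<close>

lemma coercive_left:
  fixes A X :: "complex^'n^'n"
  assumes "\<And>v. c * (norm v)\<^sup>2 \<le> v \<bullet> (A *v v)"
  shows "c * (norm X)\<^sup>2 \<le> X \<bullet> (A ** X)"
proof -
  have "c * (norm X)\<^sup>2 = (\<Sum>j\<in>UNIV. c * (norm (column j X))\<^sup>2)"
    by (simp add: power2_norm_eq_inner inner_matrix_columns sum_distrib_left)
  also have "\<dots> \<le> (\<Sum>j\<in>UNIV. column j X \<bullet> (A *v column j X))"
    by (intro sum_mono assms)
  finally show ?thesis by (simp add: inner_matrix_columns column_matrix_mult)
qed

lemma inner_adjoint_adjoint: "adjoint_matrix X \<bullet> adjoint_matrix Y = (X :: complex^'n^'n) \<bullet> Y"
  unfolding inner_vec_def adjoint_matrix_def inner_complex_def by (simp, rule sum.swap)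

text \<open>Taking adjoints preserves the inner product of matrices and turns right multiplication
  by a Hermitian matrix into left multiplication.\<close>

lemma coercive_right:
  fixes A X :: "complex^'n^'n"
  assumes "hermitian A" "\<And>v. c * (norm v)\<^sup>2 \<le> v \<bullet> (A *v v)"
  shows "c * (norm X)\<^sup>2 \<le> X \<bullet> (X ** A)"
proof -
  have "c * (norm (adjoint_matrix X))\<^sup>2 \<le> adjoint_matrix X \<bullet> (A ** adjoint_matrix X)"
    by (rule coercive_left) (rule assms)
  also have "A ** adjoint_matrix X = adjoint_matrix (X ** A)"
    using assms(1) by (simp add: adjoint_matrix_mult hermitian_def)
  finally show ?thesis by (simp only: power2_norm_eq_inner inner_adjoint_adjoint)
qed

text \<open>Energy estimate: pair the equation with \<open>X\<close>. The \<open>S\<close> term is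
  nonnegative, the \<open>T\<close> term is at least \<open>c * (norm X)^2\<close>, and
  Cauchy-Schwarz bounds the right side. Two different coefficients occur for the difference of two
  square roots and for the intertwining of a root with its conjugate.\<close>

lemma sylvester_bound:
  fixes S T X Z :: "complex^'n^'n"
  assumes S: "positive_matrix S" and T: "hermitian T" "\<And>v. c * (norm v)\<^sup>2 \<le> v \<bullet> (T *v v)"
    and eq: "S ** X + X ** T = Z"
  shows "c * norm X \<le> norm Z"
proof (cases "X = 0")
  case False
  have "0 \<le> v \<bullet> (S *v v)" for v
    using S by (cases "v = 0") (auto simp: positive_matrix_def intro: less_imp_le)
  then have "0 * (norm X)\<^sup>2 \<le> X \<bullet> (S ** X)" by (intro coercive_left) simp
  moreover have "c * (norm X)\<^sup>2 \<le> X \<bullet> (X ** T)" using T by (rule coercive_right)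
  ultimately have "c * (norm X)\<^sup>2 \<le> X \<bullet> Z" by (simp add: eq[symmetric] inner_add_right)
  also have "\<dots> \<le> norm X * norm Z" by (rule norm_cauchy_schwarz)
  finally have "norm X * (c * norm X) \<le> norm X * norm Z" by (simp add: power2_eq_square mult_ac)
  with False show ?thesis by simp
qed simp

lemma sylvester_unique:
  fixes S T X :: "complex^'n^'n"
  assumes "positive_matrix S" "posdef T" "S ** X + X ** T = 0"
  shows "X = 0"
proof -
  obtain c where "0 < c" "\<And>v. c * (norm v)\<^sup>2 \<le> v \<bullet> (T *v v)"
    using positive_coercive assms(2) by (auto simp: posdef_def)
  then have "c * norm X \<le> norm (0 :: complex^'n^'n)"
    using assms by (intro sylvester_bound[of S T]) (auto simp: posdef_def)
  with \<open>0 < c\<close> show ?thesis by (simp add: mult_le_0_iff)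
qed

section \<open>The spectral theorem for Hermitian matrices\<close>

lemma rayleigh_eigenvector:
  fixes A :: "complex^'n^'n"
  assumes A: "hermitian A" and W: "subspace W" "\<And>w. w \<in> W \<Longrightarrow> A *v w \<in> W"
    and ne: "w0 \<in> W" "w0 \<noteq> 0"
  obtains v d where "v \<in> W" "norm v = 1" "A *v v = d *\<^sub>R v"
proof -
  let ?q = "\<lambda>v. v \<bullet> (A *v v)"
  have cont: "continuous_on (W \<inter> sphere 0 1) ?q"
    by (intro continuous_intros linear_continuous_on linear_conv_bounded_linear[THEN iffD1]) auto
  have "inverse (norm w0) *\<^sub>R w0 \<in> W \<inter> sphere 0 1"
    using W ne by (auto simp: subspace_scale)
  then have ne: "W \<inter> sphere 0 1 \<noteq> {}" by blast
  have "compact (W \<inter> sphere 0 1)"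
    using W by (simp add: closed_Int_compact closed_subspace)
  from continuous_attains_sup[OF this ne cont]
  obtain v where v: "v \<in> W" "norm v = 1" and max: "\<And>w. w \<in> W \<inter> sphere 0 1 \<Longrightarrow> ?q w \<le> ?q v"
    by auto
  define d where "d = ?q v"
  have le: "?q w \<le> d * (w \<bullet> w)" if "w \<in> W" for w
  proof (cases "w = 0")
    case False
    let ?w = "inverse (norm w) *\<^sub>R w"
    have "?q ?w \<le> d" unfolding d_def using False that W by (intro max) (auto simp: subspace_scale)
    moreover have "?q ?w = ?q w / (norm w)\<^sup>2"
      by (simp add: matrix_vector_scaleR power2_eq_square divide_simps)
    ultimately have "?q w / (norm w)\<^sup>2 \<le> d" by simp
    then show ?thesis using False by (simp add: pos_divide_le_eq power2_norm_eq_inner)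
  qed simp
  define r where "r = A *v v - d *\<^sub>R v"
  have r: "r \<in> W" unfolding r_def using W v by (auto simp: subspace_diff subspace_scale)
  \<comment> \<open>The residual of a maximiser of the Rayleigh quotient vanishes: otherwise moving
    from \<open>v\<close> in the direction \<open>r\<close> would raise the quotient to first order,
    while \<open>ineq\<close> bounds the linear gain by a quadratic term.\<close>
  have "r \<bullet> r = 0"
  proof (rule ccontr)
    assume "r \<bullet> r \<noteq> 0"
    then have pos: "0 < r \<bullet> r" by (metis inner_ge_zero less_eq_real_def)
    define k where "k = d * (r \<bullet> r) - ?q r"
    have ineq: "2 * t * (r \<bullet> r) \<le> t\<^sup>2 * k" for t
    proof -
      have "v + t *\<^sub>R r \<in> W" using W v r by (auto simp: subspace_add subspace_scale)
      from le[OF this] have "?q (v + t *\<^sub>R r) \<le> d * ((v + t *\<^sub>R r) \<bullet> (v + t *\<^sub>R r))" .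
      also have "d * ((v + t *\<^sub>R r) \<bullet> (v + t *\<^sub>R r)) = d * (1 + 2 * t * (r \<bullet> v) + t\<^sup>2 * (r \<bullet> r))"
        using v by (simp add: norm_eq_1 algebra_simps inner_add_left inner_add_right power2_eq_square inner_commute)
      also have "?q (v + t *\<^sub>R r) = d + 2 * t * (r \<bullet> (A *v v)) + t\<^sup>2 * ?q r"
        using hermitian_inner[OF A, of v r]
        by (simp add: d_def algebra_simps inner_add_left inner_add_right matrix_vector_scaleR power2_eq_square inner_commute)
      also have "r \<bullet> (A *v v) = r \<bullet> r + d * (r \<bullet> v)"
        unfolding r_def by (simp add: algebra_simps)
      finally show ?thesis unfolding k_def by (simp add: algebra_simps)
    qed
    \<comment> \<open>Any \<open>t > 0\<close> with
      \<open>t * \<bar>k\<bar> < 2 * (r \<bullet> r)\<close> contradicts \<open>ineq\<close>; the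
      added 1 keeps the quotient defined when \<open>k = 0\<close>.\<close>
    define t where "t = (r \<bullet> r) / (\<bar>k\<bar> + 1)"
    have "t > 0" using pos by (simp add: t_def)
    then have "2 * (r \<bullet> r) \<le> t * k" using ineq[of t] by (simp add: power2_eq_square mult_ac)
    also have "\<dots> \<le> t * (\<bar>k\<bar> + 1)" using \<open>t > 0\<close> by (intro mult_left_mono) auto
    also have "\<dots> = r \<bullet> r" by (simp add: t_def)
    finally show False using pos by simp
  qed
  then have "A *v v = d *\<^sub>R v" by (simp add: r_def)
  with v show ?thesis by (rule that)
qed

text \<open>Induction over sets of indices adds one unit eigenvector at a time. It is found in the
  orthogonal complement of the earlier ones, which \<open>A\<close> maps to itself.\<close>

theorem hermitian_spectral:
  fixes A :: "complex^'n^'n"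
  assumes A: "hermitian A"
  obtains U :: "complex^'n^'n" and d where "adjoint_matrix U ** U = mat 1" "U ** adjoint_matrix U = mat 1"
    "A = U ** diagonal_matrix d ** adjoint_matrix U"
proof -
  \<comment> \<open>\<open>\<bullet>\<close> only sees the real part; unitarity of \<open>U\<close>
    needs orthogonality for the full complex form \<open>c\<close>.\<close>
  define c where "c v w = (\<Sum>k\<in>UNIV. cnj (v $ k) * w $ k)" for v w :: "complex^'n"
  have c_add: "c v (w + w') = c v w + c v w'" for v w w'
    by (simp add: c_def algebra_simps sum.distrib)
  have c_scale: "c v (r *\<^sub>R w) = r *\<^sub>R c v w" for v w r
    by (simp add: c_def scaleR_sum_right)
  have c_scale_left: "c (r *\<^sub>R v) w = r *\<^sub>R c v w" for v w r
    by (simp add: c_def scaleR_sum_right)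
  have c_cnj: "cnj (c v w) = c w v" for v w
    by (simp add: c_def mult.commute)
  have c_self: "c v v = complex_of_real ((norm v)\<^sup>2)" for v
  proof -
    have "c v v = (\<Sum>k\<in>UNIV. complex_of_real (v $ k \<bullet> v $ k))"
      unfolding c_def by (intro sum.cong refl)
        (simp add: complex_eq_iff inner_complex_def)
    then show ?thesis by (simp add: power2_norm_eq_inner inner_vec_def)
  qed
  have c_adj: "c (A *v v) w = c v (A *v w)" for v w
  proof -
    have h: "cnj (A $ k $ j) = A $ j $ k" for j k
      using A by (simp add: hermitian_def adjoint_matrix_def vec_eq_iff)
    have "c (A *v v) w = (\<Sum>k\<in>UNIV. \<Sum>j\<in>UNIV. A $ j $ k * cnj (v $ j) * w $ k)"
      by (simp add: c_def matrix_vector_mult_def sum_distrib_right h)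
    also have "\<dots> = (\<Sum>j\<in>UNIV. \<Sum>k\<in>UNIV. A $ j $ k * cnj (v $ j) * w $ k)"
      by (rule sum.swap)
    also have "\<dots> = c v (A *v w)"
      by (simp add: c_def matrix_vector_mult_def sum_distrib_left mult.assoc mult.left_commute)
    finally show ?thesis .
  qed
  have "\<exists>v d. (\<forall>i\<in>I. A *v v i = d i *\<^sub>R v i) \<and> (\<forall>i\<in>I. \<forall>j\<in>I. c (v i) (v j) = (if i = j then 1 else 0))"
    if "finite I" for I :: "'n set"
    using that
  proof (induction I rule: finite_induct)
    case (insert m I)
    then obtain v d where ev: "\<And>i. i \<in> I \<Longrightarrow> A *v v i = d i *\<^sub>R v i"
      and on: "\<And>i j. i \<in> I \<Longrightarrow> j \<in> I \<Longrightarrow> c (v i) (v j) = (if i = j then 1 else 0)"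
      by blast
    define W where "W = {w. \<forall>i\<in>I. c (v i) w = 0}"
    \<comment> \<open>The rows are the conjugates of the vectors found so far, and zero elsewhere.
      Since \<open>m\<close> is a new index, row \<open>m\<close> vanishes, so \<open>M\<close> is
      singular, and a kernel vector is a nonzero element of \<open>W\<close>.\<close>
    define M :: "complex^'n^'n" where "M = (\<chi> i. if i \<in> I then (\<chi> k. cnj (v i $ k)) else 0)"
    have "row m M = 0" using insert by (simp add: M_def row_def vec_eq_iff)
    then have "det M = 0" by (rule det_zero_row)
    then have "\<not> invertible M" by (simp add: invertible_det_nz)
    then obtain w0 where w0: "w0 \<noteq> 0" "M *v w0 = 0"
      using invertible_left_inverse[of M] matrix_left_invertible_ker[of M] by blast
    have "w0 \<in> W"
    proof -
      have "c (v i) w0 = 0" if "i \<in> I" for i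
      proof -
        have "(M *v w0) $ i = 0" using w0 by simp
        then show ?thesis using that by (simp add: M_def matrix_vector_mult_def c_def)
      qed
      then show ?thesis by (simp add: W_def)
    qed
    moreover have "subspace W"
      by (auto simp: subspace_def W_def c_add c_scale) (simp add: c_def)
    moreover have "A *v w \<in> W" if "w \<in> W" for w
      using that by (auto simp: W_def c_adj[symmetric] ev c_scale_left)
    ultimately obtain x e where x: "x \<in> W" "norm x = 1" "A *v x = e *\<^sub>R x"
      using rayleigh_eigenvector[OF A] w0(1) by metis
    have cx: "c (v i) x = 0" if "i \<in> I" for i using x that by (simp add: W_def)
    then have cx': "c x (v i) = 0" if "i \<in> I" for i using that by (metis c_cnj complex_cnj_zero)
    show ?case
      using insert.hyps ev on x c_self[of x] cx cx'
      by (intro exI[of _ "v(m := x)"] exI[of _ "d(m := e)"]) auto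
  qed auto
  from this[OF finite[of UNIV]] have "\<exists>(v :: 'n \<Rightarrow> complex^'n) d. (\<forall>i. A *v v i = d i *\<^sub>R v i) \<and> (\<forall>i j. c (v i) (v j) = (if i = j then 1 else 0))"
    by (simp only: ball_UNIV)
  then obtain v :: "'n \<Rightarrow> complex^'n" and d where ev: "\<forall>i. A *v v i = d i *\<^sub>R v i"
    and on: "\<forall>i j. c (v i) (v j) = (if i = j then 1 else 0)" by blast
  define U :: "complex^'n^'n" where "U = (\<chi> k j. v j $ k)"
  have 1: "adjoint_matrix U ** U = mat 1"
    using on by (simp add: vec_eq_iff adjoint_matrix_def U_def matrix_matrix_mult_def mat_def c_def)
  then have 2: "U ** adjoint_matrix U = mat 1"
    by (simp add: matrix_left_right_inverse)
  have "A ** U = U ** diagonal_matrix (\<chi> i. d i)"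
  proof -
    have "(A ** U) $ k $ j = (A *v v j) $ k" for k j
      by (simp add: matrix_matrix_mult_def matrix_vector_mult_def U_def)
    then show ?thesis
      by (simp add: vec_eq_iff ev U_def matrix_matrix_mult_def diagonal_matrix_def
          if_distrib[of "\<lambda>x. _ * x"] cong: if_cong) (simp add: scaleR_conv_of_real)
  qed
  then have "A = U ** diagonal_matrix (\<chi> i. d i) ** adjoint_matrix U"
    by (metis 2 matrix_mul_assoc matrix_mul_rid)
  with 1 2 show ?thesis by (rule that)
qed

section \<open>Positive square roots by diagonalization\<close>

lemma diagonal_matrix_mult: "diagonal_matrix d ** diagonal_matrix e = diagonal_matrix (\<chi> i. d $ i * e $ i)"
  by (simp add: vec_eq_iff matrix_matrix_mult_def diagonal_matrix_def
          if_distrib[of "\<lambda>x. _ * x"] cong: if_cong)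

lemma diagonal_matrix_vector: "(diagonal_matrix d *v v) $ i = complex_of_real (d $ i) * v $ i"
  by (simp add: matrix_vector_mult_def diagonal_matrix_def
          if_distrib[of "\<lambda>x. x * _"] cong: if_cong)

lemma inner_diagonal_matrix: "v \<bullet> (diagonal_matrix d *v v) = (\<Sum>i\<in>UNIV. d $ i * (norm (v $ i))\<^sup>2)"
proof -
  have "v $ i \<bullet> (complex_of_real (d $ i) * v $ i) = d $ i * (norm (v $ i))\<^sup>2" for i
    unfolding scaleR_conv_of_real[symmetric] by (simp add: power2_norm_eq_inner)
  then show ?thesis by (simp add: inner_vec_def diagonal_matrix_vector)
qed

lemma posdef_diagonal_matrix:
  fixes d :: "real^'n"
  shows "posdef (diagonal_matrix d) \<longleftrightarrow> (\<forall>i. 0 < d $ i)"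
proof
  assume *: "posdef (diagonal_matrix d)"
  show "\<forall>i. 0 < d $ i"
  proof
    fix i
    have "axis i 1 \<noteq> (0 :: complex^'n)" by simp
    then have "0 < (axis i 1 :: complex^'n) \<bullet> (diagonal_matrix d *v axis i 1)"
      using * unfolding posdef_def positive_matrix_def by blast
    also have "\<dots> = (\<Sum>j\<in>UNIV. if j = i then d $ i else 0)"
      unfolding inner_diagonal_matrix by (intro sum.cong refl) (simp add: axis_def)
    finally show "0 < d $ i" by simp
  qed
next
  assume d: "\<forall>i. 0 < d $ i"
  have "0 < (\<Sum>i\<in>UNIV. d $ i * (norm (v $ i))\<^sup>2)" if v: "v \<noteq> 0" for v :: "complex^'n"
  proof -
    obtain i where "v $ i \<noteq> 0" using v by (auto simp: vec_eq_iff)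
    then show ?thesis
      using d by (intro sum_pos2[of UNIV i]) (auto simp: less_imp_le)
  qed
  then show "posdef (diagonal_matrix d)"
    by (simp add: posdef_def hermitian_def positive_matrix_def inner_diagonal_matrix)
qed

lemma posdef_sqrt_exists:
  fixes A :: "complex^'n^'n"
  assumes "posdef A"
  obtains T where "posdef T" "T ** T = A"
proof -
  obtain U :: "complex^'n^'n" and d where U: "adjoint_matrix U ** U = mat 1" "U ** adjoint_matrix U = mat 1"
    and A: "A = U ** diagonal_matrix d ** adjoint_matrix U"
    using assms hermitian_spectral by (metis posdef_def)
  have "posdef (adjoint_matrix U ** A ** U)"
    using assms U by (intro posdef_conjugate)
  also have "adjoint_matrix U ** A ** U = (adjoint_matrix U ** U) ** diagonal_matrix d ** (adjoint_matrix U ** U)"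
    by (simp add: A matrix_mul_assoc)
  finally have d: "\<forall>i. 0 < d $ i" by (simp add: U posdef_diagonal_matrix)
  define T where "T = U ** diagonal_matrix (\<chi> i. sqrt (d $ i)) ** adjoint_matrix U"
  have "posdef (adjoint_matrix (adjoint_matrix U) ** diagonal_matrix (\<chi> i. sqrt (d $ i)) ** adjoint_matrix U)"
    using U d by (intro posdef_conjugate) (auto simp: posdef_diagonal_matrix)
  then have "posdef T" by (simp add: T_def)
  moreover have "T ** T = U ** diagonal_matrix (\<chi> i. sqrt (d $ i)) ** (adjoint_matrix U ** U) ** diagonal_matrix (\<chi> i. sqrt (d $ i)) ** adjoint_matrix U"
    by (simp add: T_def matrix_mul_assoc)
  then have "T ** T = U ** (diagonal_matrix (\<chi> i. sqrt (d $ i)) ** diagonal_matrix (\<chi> i. sqrt (d $ i))) ** adjoint_matrix U"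
    by (simp add: U matrix_mul_assoc)
  then have "T ** T = A"
    using d by (simp add: diagonal_matrix_mult A less_imp_le)
  ultimately show ?thesis by (rule that)
qed

text \<open>The noncommutative difference of squares. The gap between two square roots solves a
  Sylvester equation, which is the source of uniqueness and continuity of the root.\<close>

lemma sylvester_sqrt_diff:
  fixes S T :: "complex^'n^'n"
  shows "S ** (S - T) + (S - T) ** T = S ** S - T ** T"
  by (simp add: matmul_simps)

lemma posdef_sqrt_unique:
  fixes S T :: "complex^'n^'n"
  assumes "posdef S" "posdef T" "S ** S = T ** T"
  shows "S = T"
proof -
  have "S ** (S - T) + (S - T) ** T = 0"
    unfolding sylvester_sqrt_diff using assms(3) by simp
  moreover have "positive_matrix S" using assms(1) by (simp add: posdef_def)
  ultimately have "S - T = 0" using assms(2) by (metis sylvester_unique)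
  then show ?thesis by simp
qed

definition posdef_sqrt :: "complex^'n^'n \<Rightarrow> complex^'n^'n" where
  "posdef_sqrt A = (SOME T. posdef T \<and> T ** T = A)"

lemma posdef_sqrt:
  assumes "posdef A"
  shows "posdef (posdef_sqrt A)" "posdef_sqrt A ** posdef_sqrt A = A"
proof -
  have "\<exists>T. posdef T \<and> T ** T = A" using posdef_sqrt_exists[OF assms] by metis
  then have "posdef (posdef_sqrt A) \<and> posdef_sqrt A ** posdef_sqrt A = A"
    unfolding posdef_sqrt_def by (rule someI_ex)
  then show "posdef (posdef_sqrt A)" "posdef_sqrt A ** posdef_sqrt A = A" by auto
qed

section \<open>Sylvester equations and square roots\<close>

text \<open>A Lipschitz estimate at \<open>T\<close> that is uniform in \<open>S\<close>: the
  constant is the coercivity of \<open>T\<close> alone. Continuity of the square root follows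
  without perturbing a spectral decomposition.\<close>

lemma posdef_sqrt_bound:
  fixes T :: "complex^'n^'n"
  assumes "posdef T"
  obtains c where "0 < c" "\<And>S. posdef S \<Longrightarrow> c * norm (S - T) \<le> norm (S ** S - T ** T)"
proof -
  obtain c where c: "0 < c" "\<And>v. c * (norm v)\<^sup>2 \<le> v \<bullet> (T *v v)"
    using positive_coercive assms by (auto simp: posdef_def)
  then have "c * norm (S - T) \<le> norm (S ** S - T ** T)" if "posdef S" for S
    using assms that by (intro sylvester_bound[of S T]) (auto simp: posdef_def sylvester_sqrt_diff)
  with c(1) show ?thesis by (rule that)
qed

lemma tendsto_posdef_sqrt:
  fixes T :: "'a \<Rightarrow> complex^'n^'n"
  assumes T: "\<forall>\<^sub>F p in F. posdef (T p)" and T0: "posdef T0"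
    and lim: "((\<lambda>p. T p ** T p) \<longlongrightarrow> T0 ** T0) F"
  shows "(T \<longlongrightarrow> T0) F"
proof -
  obtain c where c: "0 < c" "\<And>S. posdef S \<Longrightarrow> c * norm (S - T0) \<le> norm (S ** S - T0 ** T0)"
    using posdef_sqrt_bound[OF T0] by blast
  have "((\<lambda>p. norm (T p ** T p - T0 ** T0) / c) \<longlongrightarrow> 0) F"
    using lim by (intro tendsto_divide_zero tendsto_norm_zero) (simp add: LIM_zero_iff)
  moreover have "\<forall>\<^sub>F p in F. norm (T p - T0) \<le> norm (T p ** T p - T0 ** T0) / c"
    using T by eventually_elim (use c in \<open>simp add: field_simps\<close>)
  ultimately have "((\<lambda>p. T p - T0) \<longlongrightarrow> 0) F"
    by (rule Lim_null_comparison[rotated])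
  then show ?thesis by (simp add: LIM_zero_iff)
qed

lemma continuous_on_posdef_sqrt:
  assumes "continuous_on X A" "\<And>x. x \<in> X \<Longrightarrow> posdef (A x)"
  shows "continuous_on X (\<lambda>x. posdef_sqrt (A x) :: complex^'n^'n)"
  unfolding continuous_on_def
proof
  fix x assume x: "x \<in> X"
  show "((\<lambda>x. posdef_sqrt (A x)) \<longlongrightarrow> posdef_sqrt (A x)) (at x within X)"
  proof (rule tendsto_posdef_sqrt)
  show "\<forall>\<^sub>F p in at x within X. posdef (posdef_sqrt (A p))"
    unfolding eventually_at_filter by (rule always_eventually) (simp add: assms posdef_sqrt)
  show "posdef (posdef_sqrt (A x))" using assms x by (simp add: posdef_sqrt)
  have "(A \<longlongrightarrow> A x) (at x within X)" using assms(1) x by (simp add: continuous_on_def)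
  moreover have "\<forall>\<^sub>F p in at x within X. A p = posdef_sqrt (A p) ** posdef_sqrt (A p)"
    unfolding eventually_at_filter by (rule always_eventually) (simp add: assms posdef_sqrt)
  ultimately show "((\<lambda>p. posdef_sqrt (A p) ** posdef_sqrt (A p)) \<longlongrightarrow> posdef_sqrt (A x) ** posdef_sqrt (A x)) (at x within X)"
    using assms x by (simp add: posdef_sqrt tendsto_cong)
  qed
qed

text \<open>Uniqueness gives injectivity, and finite dimension supplies surjectivity and boundedness
  of the inverse.\<close>

lemma sylvester_inverse:
  fixes T :: "complex^'n^'n"
  assumes "posdef T"
  obtains L where "bounded_linear L" "\<And>X. L (T ** X + X ** T) = X" "\<And>Z. T ** L Z + L Z ** T = Z"
proof -
  let ?f = "\<lambda>X. T ** X + X ** T"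
  have lin: "linear ?f"
    by (intro linear_conv_bounded_linear[THEN iffD2] bounded_linear_add
        matmul.bounded_linear_left matmul.bounded_linear_right)
  have inj: "inj ?f"
    unfolding linear_injective_0[OF lin] using assms sylvester_unique posdef_def by metis
  then have surj: "surj ?f" using lin by (simp add: eucl.linear_inj_imp_surj)
  obtain L where L: "linear L" "L \<circ> ?f = id"
    using linear_injective_left_inverse[OF lin inj] by blast
  then have 1: "L (?f X) = X" for X by (auto simp: fun_eq_iff)
  have 2: "?f (L Z) = Z" for Z
  proof -
    obtain X where "Z = ?f X" using surjD[OF surj, of Z] by blast
    then show ?thesis by (simp add: 1)
  qed
  have "bounded_linear L" using L(1) by (simp add: linear_conv_bounded_linear)
  from that[OF this 1 2] show ?thesis .
qed

text \<open>The difference \<open>?D p\<close> solves an equation with coefficients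
  \<open>T p\<close> and the fixed \<open>T0\<close>, so the bound applies with a constant that does
  not depend on \<open>p\<close>.\<close>

lemma tendsto_sylvester:
  fixes T Y Z :: "'a \<Rightarrow> complex^'n^'n"
  assumes T: "(T \<longlongrightarrow> T0) F" and Z: "(Z \<longlongrightarrow> Z0) F"
    and Y: "\<forall>\<^sub>F p in F. posdef (T p) \<and> T p ** Y p + Y p ** T p = Z p"
    and Y0: "posdef T0" "T0 ** Y0 + Y0 ** T0 = Z0"
  shows "(Y \<longlongrightarrow> Y0) F"
proof -
  obtain c where c: "0 < c" "\<And>v. c * (norm v)\<^sup>2 \<le> v \<bullet> (T0 *v v)"
    using positive_coercive Y0(1) by (auto simp: posdef_def)
  obtain K where K: "0 < K" "\<And>(A :: complex^'n^'n) (B :: complex^'n^'n). norm (A ** B) \<le> norm A * norm B * K"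
    using matmul.pos_bounded by blast
  let ?D = "\<lambda>p. Y p - Y0" and ?T = "\<lambda>p. T p - T0"
  let ?R = "\<lambda>p. Z p - Z0 - ?T p ** Y0 - Y0 ** ?T p"
  have T0: "(?T \<longlongrightarrow> 0) F" using T by (simp add: LIM_zero_iff)
  have "(?R \<longlongrightarrow> Z0 - Z0 - 0 ** Y0 - Y0 ** 0) F"
    by (intro tendsto_diff matmul.tendsto tendsto_const T0 Z)
  then have R0: "(?R \<longlongrightarrow> 0) F" by simp
  \<comment> \<open>At this threshold the error term \<open>?D p ** ?T p\<close> costs at most
    \<open>c / 2\<close> times the norm of \<open>?D p\<close>, which the left side absorbs; the
    remaining half yields the factor \<open>2 / c\<close>.\<close>
  have small: "\<forall>\<^sub>F p in F. norm (?T p) < c / (2 * K)"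
    using order_tendstoD(2)[OF tendsto_norm_zero[OF T0], of "c / (2 * K)"] c K by simp
  have bound: "\<forall>\<^sub>F p in F. norm (?D p) \<le> (2 / c) * norm (?R p)"
    using small Y
  proof eventually_elim
    case (elim p)
    then have Zp: "Z p = T p ** Y p + Y p ** T p" by simp
    have "T p ** ?D p + ?D p ** T0 = ?R p - ?D p ** ?T p"
      unfolding Zp Y0(2)[symmetric] by (simp add: matmul_simps)
    then have "c * norm (?D p) \<le> norm (?R p - ?D p ** ?T p)"
      using elim Y0 c by (intro sylvester_bound[of "T p" "T0"]) (auto simp: posdef_def)
    also have "\<dots> \<le> norm (?R p) + norm (?D p) * norm (?T p) * K"
      using norm_triangle_ineq4 K(2)[of "?D p" "?T p"] by (smt (verit))
    also have "norm (?T p) * K \<le> c / 2" using elim K by (simp add: field_simps)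
    then have "norm (?D p) * norm (?T p) * K \<le> norm (?D p) * (c / 2)"
      by (metis mult.assoc mult_left_mono norm_ge_zero)
    finally show ?case using c(1) by (simp add: field_simps)
  qed
  have "(?D \<longlongrightarrow> 0) F"
    by (rule Lim_null_comparison[OF bound]) (intro tendsto_mult_right_zero tendsto_norm_zero R0)
  then show ?thesis by (simp add: LIM_zero_iff)
qed

text \<open>\<open>f\<close> is differentiable and vanishes at \<open>x\<close>, hence is at most of
  first order there; a further factor tending to zero makes \<open>h\<close> of higher order. This
  disposes of the quadratic remainders in the two proofs of differentiability below.\<close>

lemma has_derivative_zero_product:
  fixes f :: "'a::real_normed_vector \<Rightarrow> 'b::real_normed_vector" and h :: "'a \<Rightarrow> 'c::real_normed_vector"
  assumes f: "(f has_derivative f') (at x)" "f x = 0" and e: "(e \<longlongrightarrow> 0) (at x)"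
    and le: "\<forall>\<^sub>F p in at x. norm (h p) \<le> e p * norm (f p)" and h: "h x = 0"
  shows "(h has_derivative (\<lambda>_. 0)) (at x)"
  unfolding has_derivative_iff_norm
proof (intro conjI)
  obtain B where B: "0 < B" "\<And>v. norm (f' v) \<le> norm v * B"
    using bounded_linear.pos_bounded[OF has_derivative_bounded_linear[OF f(1)]] by blast
  have lim: "((\<lambda>p. norm (f p - f' (p - x)) / norm (p - x)) \<longlongrightarrow> 0) (at x)"
    using f by (auto simp: has_derivative_iff_norm)
  have "\<forall>\<^sub>F p in at x. norm (f p - f' (p - x)) / norm (p - x) < 1"
    using lim by (rule order_tendstoD) simp
  then have bd: "\<forall>\<^sub>F p in at x. norm (f p) \<le> (B + 1) * norm (p - x)"
    using eventually_neq_at_within[of x x UNIV]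
  proof eventually_elim
    case (elim p)
    then have "norm (f p - f' (p - x)) \<le> norm (p - x)" by (simp add: field_simps)
    then show ?case using norm_triangle_sub[of "f p" "f' (p - x)"] B(2)[of "p - x"]
      by (simp add: algebra_simps)
  qed
  have "\<forall>\<^sub>F p in at x. norm (norm (h p - h x - 0) / norm (p - x)) \<le> norm (e p) * (B + 1)"
    using bd le eventually_neq_at_within[of x x UNIV]
  proof eventually_elim
    case (elim p)
    have "norm (h p) \<le> norm (e p) * norm (f p)"
      using elim by (smt (verit) mult_right_mono norm_ge_zero real_norm_def)
    also have "\<dots> \<le> norm (e p) * ((B + 1) * norm (p - x))"
      using elim by (intro mult_left_mono) auto
    finally show ?case using elim by (simp add: h field_simps)
  qed
  moreover have "((\<lambda>p. norm (e p) * (B + 1)) \<longlongrightarrow> 0) (at x)"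
    using e by (intro tendsto_mult_left_zero tendsto_norm_zero)
  ultimately show "((\<lambda>p. norm (h p - h x - 0) / norm (p - x)) \<longlongrightarrow> 0) (at x)"
    by (rule Lim_null_comparison)
qed simp

text \<open>The increment satisfies
  \<open>T x ** ?X p + ?X p ** T x = M p - M x - ?X p ** ?X p\<close>. Applying the inverse
  \<open>L\<close> of the Sylvester operator at \<open>x\<close> expresses \<open>T p\<close>
  through \<open>M p\<close> and a remainder of higher order.\<close>

lemma has_derivative_sqrt:
  fixes T M :: "'a::real_normed_vector \<Rightarrow> complex^'n^'n"
  assumes M: "(M has_derivative M') (at x)"
    and T: "\<forall>\<^sub>F p in nhds x. posdef (T p) \<and> T p ** T p = M p"
  obtains T' where "(T has_derivative T') (at x)" "\<And>h. T x ** T' h + T' h ** T x = M' h"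
proof -
  have Tx: "posdef (T x)" "T x ** T x = M x"
    using eventually_nhds_x_imp_x[OF T] by auto
  obtain L where L: "bounded_linear L" "\<And>X. L (T x ** X + X ** T x) = X"
      "\<And>Z. T x ** L Z + L Z ** T x = Z"
    using sylvester_inverse[OF Tx(1)] by blast
  obtain c where c: "0 < c" "\<And>S. posdef S \<Longrightarrow> c * norm (S - T x) \<le> norm (S ** S - T x ** T x)"
    using posdef_sqrt_bound[OF Tx(1)] by blast
  obtain K where K: "0 < K" "\<And>(A :: complex^'n^'n) (B :: complex^'n^'n). norm (A ** B) \<le> norm A * norm B * K"
    using matmul.pos_bounded by blast
  have T_at: "\<forall>\<^sub>F p in at x. posdef (T p) \<and> T p ** T p = M p"
    using T by (auto simp: eventually_at_filter elim: eventually_mono)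
  let ?X = "\<lambda>p. T p - T x"
  have "(T \<longlongrightarrow> T x) (at x)"
  proof (rule tendsto_posdef_sqrt)
    show "\<forall>\<^sub>F p in at x. posdef (T p)" using T_at by eventually_elim auto
    have "(M \<longlongrightarrow> M x) (at x)" using has_derivative_continuous[OF M] by (simp add: isCont_def)
    moreover have "\<forall>\<^sub>F p in at x. M p = T p ** T p" using T_at by eventually_elim auto
    ultimately show "((\<lambda>p. T p ** T p) \<longlongrightarrow> T x ** T x) (at x)"
      by (simp add: Tx tendsto_cong)
  qed (rule Tx)
  then have X0: "(?X \<longlongrightarrow> 0) (at x)" by (simp add: LIM_zero_iff)
  \<comment> \<open>One factor tends to zero by continuity, the other is bounded by a multiple of
    \<open>M p - M x\<close> through the Lipschitz estimate.\<close>
  have XX: "((\<lambda>p. ?X p ** ?X p) has_derivative (\<lambda>_. 0)) (at x)"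
  proof (rule has_derivative_zero_product)
    show "((\<lambda>p. M p - M x) has_derivative M') (at x)"
      using M by (auto intro!: derivative_eq_intros)
    show "((\<lambda>p. norm (?X p) * (K / c)) \<longlongrightarrow> 0) (at x)"
      using X0 by (intro tendsto_mult_left_zero tendsto_norm_zero)
    show "\<forall>\<^sub>F p in at x. norm (?X p ** ?X p) \<le> norm (?X p) * (K / c) * norm (M p - M x)"
      using T_at
    proof eventually_elim
      case (elim p)
      have le: "norm (?X p) \<le> norm (M p - M x) / c"
        using c(2)[of "T p"] elim Tx c(1) by (simp add: field_simps)
      have "norm (?X p ** ?X p) \<le> norm (?X p) * norm (?X p) * K" by (rule K(2))
      also have "\<dots> \<le> norm (?X p) * (norm (M p - M x) / c) * K"
        using le K(1) by (intro mult_left_mono mult_right_mono) auto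
      finally show ?case by (simp add: mult_ac)
    qed
  qed auto
  have "((\<lambda>p. L (M p - M x - ?X p ** ?X p)) has_derivative (\<lambda>h. L (M' h - 0 - 0))) (at x)"
    using M XX by (intro bounded_linear.has_derivative[OF L(1)] has_derivative_diff has_derivative_const)
  then have *: "((\<lambda>p. T x + L (M p - M x - ?X p ** ?X p)) has_derivative (\<lambda>h. L (M' h))) (at x)"
    using has_derivative_add[OF has_derivative_const] by fastforce
  have eq: "\<forall>\<^sub>F p in nhds x. T x + L (M p - M x - ?X p ** ?X p) = T p"
    using T
  proof eventually_elim
    case (elim p)
    then have M: "M p = T p ** T p" by simp
    have "M p - M x - ?X p ** ?X p = T x ** ?X p + ?X p ** T x"
      unfolding M Tx(2)[symmetric] by (simp add: matmul_simps)
    then show ?case by (simp add: L)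
  qed
  have "(T has_derivative (\<lambda>h. L (M' h))) (at x)"
    by (rule has_derivative_transform_eventually[OF *])
      (use eq eventually_nhds_x_imp_x[OF eq] in \<open>auto simp: eventually_at_filter elim: eventually_mono\<close>)
  then show ?thesis by (rule that) (rule L)
qed

text \<open>Subtracting the equations at \<open>p\<close> and at \<open>x\<close> leaves remainders
  that are products of \<open>?T p\<close>, of first order, with \<open>?D p\<close>, which tends to
  zero because solutions depend continuously on the data. Inverting the Sylvester operator at
  \<open>x\<close> then gives the derivative.\<close>

lemma has_derivative_sylvester:
  fixes T Y Z :: "'a::real_normed_vector \<Rightarrow> complex^'n^'n"
  assumes T: "(T has_derivative T') (at x)" and Z: "(Z has_derivative Z') (at x)"
    and Y: "\<forall>\<^sub>F p in nhds x. posdef (T p) \<and> T p ** Y p + Y p ** T p = Z p"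
  obtains Y' where "(Y has_derivative Y') (at x)"
    "\<And>h. T x ** Y' h + Y' h ** T x = Z' h - T' h ** Y x - Y x ** T' h"
proof -
  have Yx: "posdef (T x)" "T x ** Y x + Y x ** T x = Z x"
    using eventually_nhds_x_imp_x[OF Y] by auto
  obtain L where L: "bounded_linear L" "\<And>X. L (T x ** X + X ** T x) = X"
      "\<And>Z. T x ** L Z + L Z ** T x = Z"
    using sylvester_inverse[OF Yx(1)] by blast
  obtain K where K: "0 < K" "\<And>(A :: complex^'n^'n) (B :: complex^'n^'n). norm (A ** B) \<le> norm A * norm B * K"
    using matmul.pos_bounded by blast
  have Y_at: "\<forall>\<^sub>F p in at x. posdef (T p) \<and> T p ** Y p + Y p ** T p = Z p"
    using Y by (auto simp: eventually_at_filter elim: eventually_mono)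
  let ?D = "\<lambda>p. Y p - Y x" and ?T = "\<lambda>p. T p - T x" and ?Z = "\<lambda>p. Z p - Z x"
  let ?R = "\<lambda>p. ?Z p - ?T p ** Y x - Y x ** ?T p"
  have dT: "(?T has_derivative T') (at x)" and dZ: "(?Z has_derivative Z') (at x)"
    using T Z by (auto intro!: derivative_eq_intros)
  have dR: "(?R has_derivative (\<lambda>h. Z' h - T' h ** Y x - Y x ** T' h)) (at x)"
    by (intro has_derivative_diff dZ bounded_linear.has_derivative[OF matmul.bounded_linear_left, OF dT]
        bounded_linear.has_derivative[OF matmul.bounded_linear_right, OF dT])
  have "(Y \<longlongrightarrow> Y x) (at x)"
    using tendsto_sylvester[OF _ _ Y_at Yx] has_derivative_continuous[OF T] has_derivative_continuous[OF Z]
    by (auto simp: isCont_def)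
  then have D0: "(?D \<longlongrightarrow> 0) (at x)" by (simp add: LIM_zero_iff)
  then have DK: "((\<lambda>p. norm (?D p) * K) \<longlongrightarrow> 0) (at x)"
    by (intro tendsto_mult_left_zero tendsto_norm_zero)
  have DT: "((\<lambda>p. ?D p ** ?T p) has_derivative (\<lambda>_. 0)) (at x)"
    using K(2)[of "?D p" "?T p" for p]
    by (intro has_derivative_zero_product[OF dT _ DK] always_eventually) (auto simp: mult_ac)
  have TD: "((\<lambda>p. ?T p ** ?D p) has_derivative (\<lambda>_. 0)) (at x)"
    using K(2)[of "?T p" "?D p" for p]
    by (intro has_derivative_zero_product[OF dT _ DK] always_eventually) (auto simp: mult_ac)
  let ?W = "\<lambda>p. ?R p - ?T p ** ?D p - ?D p ** ?T p"
  have "((\<lambda>p. L (?W p)) has_derivative (\<lambda>h. L (Z' h - T' h ** Y x - Y x ** T' h - 0 - 0))) (at x)"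
    by (intro bounded_linear.has_derivative[OF L(1)] has_derivative_diff[OF has_derivative_diff[OF dR TD] DT])
  then have *: "((\<lambda>p. Y x + L (?W p)) has_derivative (\<lambda>h. L (Z' h - T' h ** Y x - Y x ** T' h))) (at x)"
    using has_derivative_add[OF has_derivative_const] by fastforce
  have eq: "\<forall>\<^sub>F p in nhds x. Y x + L (?W p) = Y p"
    using Y
  proof eventually_elim
    case (elim p)
    then have Zp: "Z p = T p ** Y p + Y p ** T p" by simp
    have "?W p = T x ** ?D p + ?D p ** T x"
      unfolding Zp Yx(2)[symmetric] by (simp add: matmul_simps)
    then show ?case by (simp add: L)
  qed
  have "(Y has_derivative (\<lambda>h. L (Z' h - T' h ** Y x - Y x ** T' h))) (at x)"
    by (rule has_derivative_transform_eventually[OF *])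
      (use eq eventually_nhds_x_imp_x[OF eq] in \<open>auto simp: eventually_at_filter elim: eventually_mono\<close>)
  then show ?thesis by (rule that) (rule L)
qed

lemma has_derivative_matmul:
  fixes f g :: "'a::real_normed_vector \<Rightarrow> complex^'n^'n"
  assumes "(f has_derivative f') (at x)" "(g has_derivative g') (at x)"
  shows "((\<lambda>p. f p ** g p) has_derivative (\<lambda>h. f x ** g' h + f' h ** g x)) (at x)"
  by (rule bounded_bilinear.FDERIV[OF bounded_bilinear_matrix_mult assms])

section \<open>Smooth functions\<close>

lemma has_vector_derivative_along_axis:
  fixes f :: "real^'n \<Rightarrow> 'b::real_normed_vector"
  assumes "(f has_derivative f') (at (y + t *\<^sub>R axis a 1))"
  shows "((\<lambda>t. f (y + t *\<^sub>R axis a 1)) has_vector_derivative f' (axis a 1)) (at t)"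
proof -
  interpret bounded_linear f' by (rule has_derivative_bounded_linear[OF assms])
  have "((\<lambda>t. y + t *\<^sub>R axis a 1) has_derivative (\<lambda>h. h *\<^sub>R axis a 1)) (at t)"
    by (auto intro!: derivative_eq_intros)
  from has_derivative_compose[OF this assms] show ?thesis
    by (simp add: has_vector_derivative_def scaleR)
qed

lemma partial_derivative_eq:
  assumes "(f has_derivative f') (at y)"
  shows "partial_derivative a f y = f' (axis a 1)"
  using has_vector_derivative_along_axis[of f f' y 0 a] assms
  unfolding partial_derivative_def by (simp add: vector_derivative_at)

lemma has_vector_derivative_partial:
  fixes f :: "real^'n \<Rightarrow> 'b::real_normed_vector"
  assumes "\<And>y. f differentiable at y"
  shows "((\<lambda>t. f (y + t *\<^sub>R axis a 1)) has_vector_derivative partial_derivative a f (y + t *\<^sub>R axis a 1)) (at t)"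
proof -
  obtain f' where f': "(f has_derivative f') (at (y + t *\<^sub>R axis a 1))"
    using assms unfolding differentiable_def by blast
  from has_vector_derivative_along_axis[OF f'] show ?thesis
    by (simp add: partial_derivative_eq[OF f'])
qed

lemma smooth_differentiable: "smooth f \<Longrightarrow> f differentiable at y"
  unfolding smooth_def by (metis foldr.simps(1) id_apply)

lemma smooth_partial_derivative: "smooth f \<Longrightarrow> smooth (partial_derivative a f)"
  unfolding smooth_def
proof (intro allI)
  fix as y assume *: "\<forall>as y. foldr partial_derivative as f differentiable at y"
  have "foldr partial_derivative as (partial_derivative a f) = foldr partial_derivative (as @ [a]) f"
    by simp
  then show "foldr partial_derivative as (partial_derivative a f) differentiable at y"
    using * by metis
qed

lemma smooth_continuous_on: "smooth f \<Longrightarrow> continuous_on X f"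
  by (simp add: smooth_differentiable differentiable_imp_continuous_within continuous_at_imp_continuous_on)

text \<open>Given a suitable class \<open>F\<close>, no formula for higher derivatives of products,
  roots or inverses has to be written down.\<close>

lemma smooth_coinduct:
  assumes "F f" "\<And>f y. F f \<Longrightarrow> f differentiable at y" "\<And>f a. F f \<Longrightarrow> F (partial_derivative a f)"
  shows "smooth f"
proof -
  have "F (foldr partial_derivative as f)" for as
    using assms(1,3) by (induction as) auto
  then show ?thesis using assms(2) by (auto simp: smooth_def)
qed

lemma partial_derivative_add:
  assumes "f differentiable at y" "g differentiable at y"
  shows "partial_derivative a (\<lambda>y. f y + g y) y = partial_derivative a f y + partial_derivative a g y"
proof -
  obtain f' g' where f: "(f has_derivative f') (at y)" and g: "(g has_derivative g') (at y)"
    using assms by (auto simp: differentiable_def)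
  show ?thesis
    unfolding partial_derivative_eq[OF f] partial_derivative_eq[OF g]
    by (rule partial_derivative_eq[OF has_derivative_add[OF f g]])
qed

lemma partial_derivative_bounded_linear:
  assumes "bounded_linear L" "f differentiable at y"
  shows "partial_derivative a (\<lambda>y. L (f y)) y = L (partial_derivative a f y)"
proof -
  obtain f' where f: "(f has_derivative f') (at y)"
    using assms by (auto simp: differentiable_def)
  show ?thesis
    unfolding partial_derivative_eq[OF f]
    by (rule partial_derivative_eq[OF bounded_linear.has_derivative[OF assms(1) f]])
qed

lemma smooth_add:
  assumes "smooth f" "smooth g"
  shows "smooth (\<lambda>y. f y + g y)"
proof (rule smooth_coinduct[where F = "\<lambda>h. \<exists>f g. smooth f \<and> smooth g \<and> h = (\<lambda>y. f y + g y)"])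
  show "h differentiable at y" if "\<exists>f g. smooth f \<and> smooth g \<and> h = (\<lambda>y. f y + g y)" for h :: "real^'a \<Rightarrow> 'b" and y
    using that by (auto simp: smooth_differentiable)
  show "\<exists>f g. smooth f \<and> smooth g \<and> partial_derivative a h = (\<lambda>y. f y + g y)"
    if h: "\<exists>f g. smooth f \<and> smooth g \<and> h = (\<lambda>y. f y + g y)" for h :: "real^'a \<Rightarrow> 'b" and a
  proof -
    from h obtain f g where "smooth f" "smooth g" and [simp]: "h = (\<lambda>y. f y + g y)" by blast
    then show ?thesis
      by (intro exI[of _ "partial_derivative a f"] exI[of _ "partial_derivative a g"])
        (auto simp: smooth_partial_derivative partial_derivative_add smooth_differentiable fun_eq_iff)
  qed
qed (use assms in blast)

lemma smooth_bounded_linear: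
  fixes L :: "'b::real_normed_vector \<Rightarrow> 'c::real_normed_vector" and f :: "real^'a \<Rightarrow> 'b"
  assumes L: "bounded_linear L" and "smooth f"
  shows "smooth (\<lambda>y. L (f y))"
proof (rule smooth_coinduct[where F = "\<lambda>h. \<exists>f. smooth f \<and> h = (\<lambda>y. L (f y))"])
  show "h differentiable at y" if "\<exists>f. smooth f \<and> h = (\<lambda>y. L (f y))" for h :: "real^'a \<Rightarrow> 'c" and y
    using that bounded_linear.has_derivative[OF L] smooth_differentiable
    unfolding differentiable_def by metis
  show "\<exists>f. smooth f \<and> partial_derivative a h = (\<lambda>y. L (f y))"
    if h: "\<exists>f. smooth f \<and> h = (\<lambda>y. L (f y))" for h :: "real^'a \<Rightarrow> 'c" and a
  proof -
    from h obtain f where "smooth f" and [simp]: "h = (\<lambda>y. L (f y))" by blast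
    then show ?thesis
      by (intro exI[of _ "partial_derivative a f"])
        (auto simp: smooth_partial_derivative partial_derivative_bounded_linear[OF L] smooth_differentiable fun_eq_iff)
  qed
qed (use assms in blast)

lemma partial_derivative_const [simp]: "partial_derivative a (\<lambda>_. c) = (\<lambda>_. 0)"
  by (rule ext, subst partial_derivative_eq[OF has_derivative_const]) simp

lemma smooth_const: "smooth (\<lambda>_. c)"
proof (rule smooth_coinduct[where F = "\<lambda>h. \<exists>c. h = (\<lambda>_. c)"])
  show "\<exists>c. partial_derivative a h = (\<lambda>_. c)" if "\<exists>c. h = (\<lambda>_. c)" for h :: "real^'a \<Rightarrow> 'b" and a
    using that by (elim exE) auto
qed auto

lemma smooth_sum: "(\<And>i. i \<in> I \<Longrightarrow> smooth (f i)) \<Longrightarrow> smooth (\<lambda>y. \<Sum>i\<in>I. f i y)"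
  by (induction I rule: infinite_finite_induct) (auto simp: smooth_const smooth_add)

lemma partial_derivative_component: "partial_derivative b (\<lambda>y. y $ a) y = (if a = b then 1 else 0)"
  by (subst partial_derivative_eq[OF bounded_linear_imp_has_derivative[OF bounded_linear_vec_nth]])
    (auto simp: axis_def)

lemma partial_derivative_half_norm_sq:
  "partial_derivative a (\<lambda>y. (norm y)\<^sup>2 / 2) = (\<lambda>y :: real^'n. y $ a)"
proof
  fix y :: "real^'n"
  have "((\<lambda>y :: real^'n. y \<bullet> y) has_derivative (\<lambda>h. y \<bullet> h + h \<bullet> y)) (at y)"
    by (auto intro!: derivative_eq_intros)
  then have "((\<lambda>y :: real^'n. (y \<bullet> y) / 2) has_derivative (\<lambda>h. (y \<bullet> h + h \<bullet> y) / 2)) (at y)"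
    by (rule bounded_linear.has_derivative[OF bounded_linear_divide])
  then have "((\<lambda>y :: real^'n. (norm y)\<^sup>2 / 2) has_derivative (\<lambda>h. y \<bullet> h)) (at y)"
    by (simp add: power2_norm_eq_inner inner_commute)
  then show "partial_derivative a (\<lambda>y. (norm y)\<^sup>2 / 2) y = y $ a"
    by (simp add: partial_derivative_eq inner_axis)
qed

lemma smooth_component: "smooth (\<lambda>y. y $ a)"
  by (rule smooth_coinduct[where F = "\<lambda>h. h = (\<lambda>y. y $ a) \<or> smooth h"])
    (auto simp: smooth_partial_derivative smooth_differentiable partial_derivative_component[abs_def]
      smooth_const bounded_linear_imp_differentiable bounded_linear_vec_nth)

lemma smooth_half_norm_sq: "smooth (\<lambda>y :: real^'n. (norm y)\<^sup>2 / 2)"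
proof (rule smooth_coinduct[where F = "\<lambda>h. h = (\<lambda>y. (norm y)\<^sup>2 / 2) \<or> smooth h"])
  have "(\<lambda>y :: real^'n. (y \<bullet> y) / 2) differentiable at y" for y
    by (auto simp: differentiable_def intro!: exI derivative_eq_intros)
  then show "f differentiable at y" if "f = (\<lambda>y. (norm y)\<^sup>2 / 2) \<or> smooth f" for f :: "real^'n \<Rightarrow> real" and y
    using that by (auto simp: power2_norm_eq_inner smooth_differentiable)
qed (auto simp: smooth_partial_derivative partial_derivative_half_norm_sq smooth_component)

text \<open>Every partial derivative of a member is again a member, which is why members are smooth.\<close>

inductive sylvester_closure :: "(real^'n \<Rightarrow> complex^'m^'m) \<Rightarrow> bool" where
  base: "smooth f \<Longrightarrow> sylvester_closure f"
| plus: "sylvester_closure f \<Longrightarrow> sylvester_closure g \<Longrightarrow> sylvester_closure (\<lambda>y. f y + g y)"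
| diff: "sylvester_closure f \<Longrightarrow> sylvester_closure g \<Longrightarrow> sylvester_closure (\<lambda>y. f y - g y)"
| mult: "sylvester_closure f \<Longrightarrow> sylvester_closure g \<Longrightarrow> sylvester_closure (\<lambda>y. f y ** g y)"
| sylvester: "sylvester_closure T \<Longrightarrow> sylvester_closure Z \<Longrightarrow> (\<And>y. posdef (T y)) \<Longrightarrow>
    (\<And>y. T y ** X y + X y ** T y = Z y) \<Longrightarrow> sylvester_closure X"
| sqrt: "sylvester_closure M \<Longrightarrow> (\<And>y. posdef (T y)) \<Longrightarrow> (\<And>y. T y ** T y = M y) \<Longrightarrow> sylvester_closure T"

text \<open>Differentiating \<open>T ** X + X ** T = Z\<close> or \<open>T ** T = M\<close> leaves a
  Sylvester equation with the same coefficient \<open>T\<close> and a right side built from members.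
  Both conclusions go through one induction because the differentiated equation presupposes
  differentiable ingredients.\<close>

lemma sylvester_closure_partial_derivative:
  assumes "sylvester_closure f"
  shows "(\<forall>y. f differentiable at y) \<and> (\<forall>a. sylvester_closure (partial_derivative a f))"
  using assms
proof induction
  case (base f)
  then show ?case
    by (auto simp: smooth_differentiable smooth_partial_derivative sylvester_closure.base)
next
  case (plus f g)
  have "partial_derivative a (\<lambda>y. f y + g y) = (\<lambda>y. partial_derivative a f y + partial_derivative a g y)" for a
    using plus.IH by (auto simp: partial_derivative_add)
  then show ?case using plus.IH by (auto intro: sylvester_closure.plus)
next
  case (diff f g)
  have "partial_derivative a (\<lambda>y. f y - g y) y = partial_derivative a f y - partial_derivative a g y" for a y
  proof -
    obtain f' g' where f: "(f has_derivative f') (at y)" and g: "(g has_derivative g') (at y)"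
      using diff.IH unfolding differentiable_def by blast
    show ?thesis
      unfolding partial_derivative_eq[OF f] partial_derivative_eq[OF g]
      by (rule partial_derivative_eq[OF has_derivative_diff[OF f g]])
  qed
  then have "partial_derivative a (\<lambda>y. f y - g y) = (\<lambda>y. partial_derivative a f y - partial_derivative a g y)" for a
    by auto
  then show ?case using diff.IH by (auto intro: sylvester_closure.diff)
next
  case (mult f g)
  have *: "(\<lambda>y. f y ** g y) differentiable at y \<and> partial_derivative a (\<lambda>y. f y ** g y) y =
      f y ** partial_derivative a g y + partial_derivative a f y ** g y" for a y
  proof -
    obtain f' g' where f: "(f has_derivative f') (at y)" and g: "(g has_derivative g') (at y)"
      using mult.IH unfolding differentiable_def by blast
    from has_derivative_matmul[OF f g] show ?thesis
      unfolding partial_derivative_eq[OF f] partial_derivative_eq[OF g]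
      by (auto simp: partial_derivative_eq differentiable_def)
  qed
  then have "partial_derivative a (\<lambda>y. f y ** g y) =
      (\<lambda>y. f y ** partial_derivative a g y + partial_derivative a f y ** g y)" for a
    by auto
  with * show ?case using mult by (auto intro!: sylvester_closure.plus sylvester_closure.mult)
next
  case (sylvester T Z X)
  have *: "X differentiable at y \<and> T y ** partial_derivative a X y + partial_derivative a X y ** T y =
      partial_derivative a Z y - partial_derivative a T y ** X y - X y ** partial_derivative a T y" for a y
  proof -
    obtain T' Z' where T: "(T has_derivative T') (at y)" and Z: "(Z has_derivative Z') (at y)"
      using sylvester.IH unfolding differentiable_def by blast
    obtain X' where "(X has_derivative X') (at y)"
      "\<And>h. T y ** X' h + X' h ** T y = Z' h - T' h ** X y - X y ** T' h"
      using has_derivative_sylvester[OF T Z, of X] sylvester.hyps by auto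
    then show ?thesis
      unfolding partial_derivative_eq[OF T] partial_derivative_eq[OF Z]
      by (auto simp: partial_derivative_eq differentiable_def)
  qed
  \<comment> \<open>\<open>X\<close> itself occurs on the right side of the differentiated equation,
    so its membership is needed first.\<close>
  have X: "sylvester_closure X" using sylvester.hyps by (rule sylvester_closure.sylvester)
  have "sylvester_closure (partial_derivative a X)" for a
    by (rule sylvester_closure.sylvester[of T "\<lambda>y. partial_derivative a Z y - partial_derivative a T y ** X y - X y ** partial_derivative a T y"])
      (use * X sylvester in \<open>auto intro!: sylvester_closure.diff sylvester_closure.mult\<close>)
  with * show ?case by auto
next
  case (sqrt M T)
  have *: "T differentiable at y \<and> T y ** partial_derivative a T y + partial_derivative a T y ** T y =
      partial_derivative a M y" for a y
  proof -
    obtain M' where M: "(M has_derivative M') (at y)"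
      using sqrt.IH unfolding differentiable_def by blast
    obtain T' where "(T has_derivative T') (at y)" "\<And>h. T y ** T' h + T' h ** T y = M' h"
      using has_derivative_sqrt[OF M, of T] sqrt.hyps by auto
    then show ?thesis
      unfolding partial_derivative_eq[OF M] by (auto simp: partial_derivative_eq differentiable_def)
  qed
  have T: "sylvester_closure T" using sqrt.hyps by (rule sylvester_closure.sqrt)
  have "sylvester_closure (partial_derivative a T)" for a
    by (rule sylvester_closure.sylvester[of T "partial_derivative a M"]) (use * T sqrt in auto)
  with * show ?case by auto
qed

lemma sylvester_closure_smooth: "sylvester_closure f \<Longrightarrow> smooth f"
  using smooth_coinduct[of sylvester_closure f] sylvester_closure_partial_derivative by metis

lemma smooth_matrix_mult:
  fixes f g :: "real^'n \<Rightarrow> complex^'m^'m"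
  shows "smooth f \<Longrightarrow> smooth g \<Longrightarrow> smooth (\<lambda>y. f y ** g y)"
  by (rule sylvester_closure_smooth, rule sylvester_closure.mult; rule sylvester_closure.base)

lemma smooth_matrix_diff:
  fixes f g :: "real^'n \<Rightarrow> complex^'m^'m"
  shows "smooth f \<Longrightarrow> smooth g \<Longrightarrow> smooth (\<lambda>y. f y - g y)"
  by (rule sylvester_closure_smooth, rule sylvester_closure.diff; rule sylvester_closure.base)

lemma smooth_posdef_sqrt:
  fixes M :: "real^'n \<Rightarrow> complex^'m^'m"
  assumes "smooth M" "\<And>y. posdef (M y)"
  shows "smooth (\<lambda>y. posdef_sqrt (M y))"
  by (rule sylvester_closure_smooth, rule sylvester_closure.sqrt[OF sylvester_closure.base[OF assms(1)]])
    (auto simp: posdef_sqrt assms)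

text \<open>An inverse is a Sylvester solution with right side twice the identity.\<close>

lemma smooth_posdef_inverse:
  fixes T :: "real^'n \<Rightarrow> complex^'m^'m"
  assumes "smooth T" "\<And>y. posdef (T y)" "\<And>y. T y ** X y = mat 1" "\<And>y. X y ** T y = mat 1"
  shows "smooth X"
  by (rule sylvester_closure_smooth, rule sylvester_closure.sylvester[of T "\<lambda>_. mat 1 + mat 1"])
    (auto simp: assms intro!: sylvester_closure.base smooth_const)

text \<open>Schwarz's theorem. The second difference over a square of side \<open>h\<close> is
  symmetric in the two directions. Two mean value steps make it \<open>h * h\<close> times either
  mixed derivative at a nearby point, and both derivatives are continuous at
  \<open>y\<close>.\<close>

lemma mixed_partial_derivatives_commute:
  fixes f :: "real^'n \<Rightarrow> real"
  assumes f: "smooth f"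
  shows "partial_derivative a (partial_derivative b f) y = partial_derivative b (partial_derivative a f) y"
proof -
  \<comment> \<open>The directions \<open>a\<close> and \<open>b\<close> are bound afresh, so that
    the claim can also be used with their roles exchanged.\<close>
  have main: "\<exists>s\<in>{0<..<h}. \<exists>t\<in>{0<..<h}.
      f (y + h *\<^sub>R axis a 1 + h *\<^sub>R axis b 1) - f (y + h *\<^sub>R axis a 1) - f (y + h *\<^sub>R axis b 1) + f y =
      h * h * partial_derivative b (partial_derivative a f) (y + s *\<^sub>R axis a 1 + t *\<^sub>R axis b 1)"
    if h: "h > 0" for h a b
  proof -
    let ?g = "\<lambda>s. f (y + h *\<^sub>R axis b 1 + s *\<^sub>R axis a 1) - f (y + s *\<^sub>R axis a 1)"
    let ?g' = "\<lambda>s. partial_derivative a f (y + h *\<^sub>R axis b 1 + s *\<^sub>R axis a 1) - partial_derivative a f (y + s *\<^sub>R axis a 1)"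
    have "(?g has_real_derivative ?g' s) (at s)" for s
      unfolding has_real_derivative_iff_has_vector_derivative
      by (rule has_vector_derivative_diff; rule has_vector_derivative_partial[OF smooth_differentiable[OF f]])
    from MVT2[OF h this] obtain s where s: "0 < s" "s < h" "?g h - ?g 0 = h * ?g' s" by auto
    let ?k = "\<lambda>t. partial_derivative a f (y + s *\<^sub>R axis a 1 + t *\<^sub>R axis b 1)"
    have "(?k has_real_derivative partial_derivative b (partial_derivative a f) (y + s *\<^sub>R axis a 1 + t *\<^sub>R axis b 1)) (at t)" for t
      unfolding has_real_derivative_iff_has_vector_derivative
      by (rule has_vector_derivative_partial[OF smooth_differentiable[OF smooth_partial_derivative[OF f]]])
    from MVT2[OF h this] obtain t where t: "0 < t" "t < h"
      "?k h - ?k 0 = h * partial_derivative b (partial_derivative a f) (y + s *\<^sub>R axis a 1 + t *\<^sub>R axis b 1)" by auto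
    have "?g h - ?g 0 = h * (?k h - ?k 0)" using s(3) by (simp add: add_ac)
    then show ?thesis using s t by (intro bexI[of _ s] bexI[of _ t]) (auto simp: add_ac)
  qed
  let ?F = "partial_derivative b (partial_derivative a f)" and ?G = "partial_derivative a (partial_derivative b f)"
  have cont: "isCont ?F y" "isCont ?G y"
    by (auto intro!: differentiable_imp_continuous_within smooth_differentiable smooth_partial_derivative f)
  have "dist (?F y) (?G y) < e" if e: "e > 0" for e
  proof -
    obtain d1 where d1: "d1 > 0" "\<And>z. dist z y < d1 \<Longrightarrow> dist (?F z) (?F y) < e / 2"
      using cont(1) e unfolding continuous_at_eps_delta by (meson half_gt_zero)
    obtain d2 where d2: "d2 > 0" "\<And>z. dist z y < d2 \<Longrightarrow> dist (?G z) (?G y) < e / 2"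
      using cont(2) e unfolding continuous_at_eps_delta by (meson half_gt_zero)
    \<comment> \<open>The intermediate point is displaced by less than \<open>h\<close> along each
      of two axes, hence the half.\<close>
    define h where "h = min d1 d2 / 2"
    have h: "h > 0" using d1 d2 by (simp add: h_def)
    have near: "dist (y + s *\<^sub>R axis c 1 + t *\<^sub>R axis d 1) y < min d1 d2" if "s \<in> {0<..<h}" "t \<in> {0<..<h}" for s t c d
    proof -
      have "dist (y + s *\<^sub>R axis c 1 + t *\<^sub>R axis d 1) y \<le> norm (s *\<^sub>R axis c (1::real) :: real^'n) + norm (t *\<^sub>R axis d (1::real) :: real^'n)"
        by (simp add: dist_norm add.assoc) (metis norm_axis_1 norm_scaleR norm_triangle_ineq mult.right_neutral)
      also have "\<dots> < h + h" using that by simp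
      finally show ?thesis by (simp add: h_def)
    qed
    obtain s t where st: "s \<in> {0<..<h}" "t \<in> {0<..<h}"
      "f (y + h *\<^sub>R axis a 1 + h *\<^sub>R axis b 1) - f (y + h *\<^sub>R axis a 1) - f (y + h *\<^sub>R axis b 1) + f y =
       h * h * ?F (y + s *\<^sub>R axis a 1 + t *\<^sub>R axis b 1)"
      using main[OF h] by metis
    obtain s' t' where st': "s' \<in> {0<..<h}" "t' \<in> {0<..<h}"
      "f (y + h *\<^sub>R axis b 1 + h *\<^sub>R axis a 1) - f (y + h *\<^sub>R axis b 1) - f (y + h *\<^sub>R axis a 1) + f y =
       h * h * ?G (y + s' *\<^sub>R axis b 1 + t' *\<^sub>R axis a 1)"
      using main[OF h] by metis
    have "h * h * ?F (y + s *\<^sub>R axis a 1 + t *\<^sub>R axis b 1) = h * h * ?G (y + s' *\<^sub>R axis b 1 + t' *\<^sub>R axis a 1)"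
      unfolding st(3)[symmetric] st'(3)[symmetric] by (simp add: add.assoc add.commute[of "h *\<^sub>R axis a 1"])
    then have "?F (y + s *\<^sub>R axis a 1 + t *\<^sub>R axis b 1) = ?G (y + s' *\<^sub>R axis b 1 + t' *\<^sub>R axis a 1)"
      using h by simp
    moreover have "dist (?F (y + s *\<^sub>R axis a 1 + t *\<^sub>R axis b 1)) (?F y) < e / 2"
      using near[OF st(1,2)] by (intro d1) auto
    moreover have "dist (?G (y + s' *\<^sub>R axis b 1 + t' *\<^sub>R axis a 1)) (?G y) < e / 2"
      using near[OF st'(1,2)] by (intro d2) auto
    ultimately show ?thesis unfolding dist_real_def by linarith
  qed
  then show ?thesis by (metis dist_pos_lt less_irrefl)
qed

section \<open>Variation of the Higgs term\<close>

lemma trace_adjoint_matrix: "trace (adjoint_matrix A) = cnj (trace A)"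
  by (simp add: trace_def adjoint_matrix_def)

lemma trace_minus: "trace (- A :: complex^'n^'n) = - trace A"
  by (simp add: trace_def sum_negf)

lemma trace_cnj_matrix: "trace (map_matrix cnj A) = cnj (trace A)"
  by (simp add: trace_def)

lemma bounded_linear_trace: "bounded_linear (trace :: complex^'n^'n \<Rightarrow> complex)"
  unfolding trace_def[abs_def]
  by (intro bounded_linear_sum bounded_linear_compose[OF bounded_linear_vec_nth bounded_linear_vec_nth])

lemma bounded_linear_cnj_matrix: "bounded_linear (map_matrix cnj :: complex^'n^'n \<Rightarrow> complex^'n^'n)"
  by (intro linear_conv_bounded_linear[THEN iffD1] linearI) (auto simp: vec_eq_iff)

text \<open>A permutation other than the identity moves at least two indices. After one factor of
  its product is differentiated, an off-diagonal entry of the identity matrix, a zero, is still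
  present, so only the identity permutation contributes.\<close>

lemma det_has_derivative_mat1:
  "(det has_derivative trace) (at (mat 1 :: complex^'n^'n))"
proof -
  let ?P = "{p. p permutes (UNIV :: 'n set)}"
  let ?D = "\<lambda>p (h :: complex^'n^'n). \<Sum>i\<in>UNIV. h $ i $ p i * (\<Prod>j\<in>UNIV - {i}. (mat 1 :: complex^'n^'n) $ j $ p j)"
  have entry: "((\<lambda>A :: complex^'n^'n. A $ i $ j) has_derivative (\<lambda>h. h $ i $ j)) F" for i j F
    by (intro bounded_linear_imp_has_derivative bounded_linear_compose[OF bounded_linear_vec_nth bounded_linear_vec_nth])
  have "(det has_derivative (\<lambda>h. \<Sum>p\<in>?P. of_int (sign p) * ?D p h)) (at (mat 1 :: complex^'n^'n))"
    unfolding det_def[abs_def]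
    by (intro has_derivative_sum has_derivative_mult_right has_derivative_prod entry)
  also have "(\<lambda>h. \<Sum>p\<in>?P. of_int (sign p) * ?D p h) = trace"
  proof
    fix h :: "complex^'n^'n"
    have "?D p h = 0" if p: "p permutes UNIV" "p \<noteq> id" for p
    proof (rule sum.neutral, rule ballI)
      fix i
      have "\<exists>j. j \<noteq> i \<and> p j \<noteq> j"
      proof (rule ccontr)
        assume "\<not> ?thesis"
        then have fix_ne: "\<And>j. j \<noteq> i \<Longrightarrow> p j = j" by blast
        have "p i = i"
        proof (rule ccontr)
          assume "p i \<noteq> i"
          then have "p (p i) = p i" using fix_ne by blast
          then have "p i = i" using permutes_inj[OF p(1)] by (simp add: inj_eq)
          with \<open>p i \<noteq> i\<close> show False by simp
        qed
        with fix_ne have "p = id" by (metis eq_id_iff)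
        with p(2) show False by simp
      qed
      then obtain j where "j \<noteq> i" "p j \<noteq> j" by blast
      then have "(\<Prod>j\<in>UNIV - {i}. (mat 1 :: complex^'n^'n) $ j $ p j) = 0"
        by (intro prod_zero bexI[of _ j]) (auto simp: mat_def)
      then show "h $ i $ p i * (\<Prod>j\<in>UNIV - {i}. (mat 1 :: complex^'n^'n) $ j $ p j) = 0" by simp
    qed
    then have "(\<Sum>p\<in>?P. of_int (sign p) * ?D p h) = (\<Sum>p\<in>{id}. of_int (sign p) * ?D p h)"
      by (intro sum.mono_neutral_right) (auto simp: permutes_id finite_permutations)
    also have "\<dots> = trace h" by (simp add: sign_id mat_def trace_def)
    finally show "(\<Sum>p\<in>?P. of_int (sign p) * ?D p h) = trace h" .
  qed
  finally show ?thesis .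
qed

lemma posdef_det:
  fixes A :: "complex^'n^'n"
  assumes "posdef A"
  shows "det A = complex_of_real (Re (det A))" "0 < Re (det A)"
proof -
  obtain U :: "complex^'n^'n" and d where U: "adjoint_matrix U ** U = mat 1" "U ** adjoint_matrix U = mat 1"
    and A: "A = U ** diagonal_matrix d ** adjoint_matrix U"
    using assms hermitian_spectral by (metis posdef_def)
  have "posdef (adjoint_matrix U ** A ** U)"
    using assms U by (intro posdef_conjugate)
  also have "adjoint_matrix U ** A ** U = (adjoint_matrix U ** U) ** diagonal_matrix d ** (adjoint_matrix U ** U)"
    by (simp add: A matrix_mul_assoc)
  finally have d: "\<And>i. 0 < d $ i" by (simp add: U posdef_diagonal_matrix)
  have "det A = det (diagonal_matrix d) * det (U ** adjoint_matrix U)"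
    by (simp add: A det_mul mult_ac)
  also have "\<dots> = complex_of_real (\<Prod>i\<in>UNIV. d $ i)"
    unfolding U by (subst det_diagonal) (auto simp: diagonal_matrix_def)
  finally have *: "det A = complex_of_real (\<Prod>i\<in>UNIV. d $ i)" .
  then show "det A = complex_of_real (Re (det A))" by simp
  show "0 < Re (det A)" using d unfolding * Re_complex_of_real by (simp add: prod_pos)
qed

lemma posdef_inverse:
  fixes A :: "complex^'n^'n"
  assumes "posdef A"
  shows "A ** matrix_inv A = mat 1" "matrix_inv A ** A = mat 1"
proof -
  have "det A \<noteq> 0" using posdef_det[OF assms] by auto
  then have "invertible A" by (simp add: invertible_det_nz)
  then show "A ** matrix_inv A = mat 1" "matrix_inv A ** A = mat 1"
    by (auto simp: matrix_inv_left_right)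
qed

lemma matrix_inv_eqI:
  fixes A B :: "complex^'n^'n"
  assumes "A ** B = mat 1"
  shows "matrix_inv A = B"
proof -
  have BA: "B ** A = mat 1" using assms by (simp add: matrix_left_right_inverse)
  then have "invertible A" using assms by (auto simp: invertible_def)
  then have "matrix_inv A ** A = mat 1" by (rule matrix_inv_left_right)
  then have "matrix_inv A ** (A ** B) = B" by (simp add: matrix_mul_assoc)
  then show ?thesis by (simp add: assms)
qed

text \<open>Jacobi's formula. Factoring out the constant matrix \<open>A t\<close> reduces it to the
  derivative of \<open>det\<close> at the identity.\<close>

lemma ln_det_has_derivative:
  fixes A :: "real \<Rightarrow> complex^'n^'n"
  assumes A: "(A has_vector_derivative A') (at t)" and pd: "posdef (A t)"
  shows "((\<lambda>s. ln (Re (det (A s)))) has_real_derivative Re (trace (matrix_inv (A t) ** A'))) (at t)"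
proof -
  define Ai where "Ai = matrix_inv (A t)"
  define r where "r = Re (det (A t))"
  have r: "r > 0" "det (A t) = complex_of_real r" using posdef_det[OF pd] by (auto simp: r_def)
  have Ai: "A t ** Ai = mat 1" "Ai ** A t = mat 1" using posdef_inverse[OF pd] by (auto simp: Ai_def)
  have "((\<lambda>s. Ai ** A s) has_derivative (\<lambda>h. Ai ** (h *\<^sub>R A'))) (at t)"
    using A unfolding has_vector_derivative_def
    by (rule bounded_linear.has_derivative[OF matmul.bounded_linear_right])
  then have "((\<lambda>s. det (Ai ** A s)) has_derivative (\<lambda>h. trace (Ai ** (h *\<^sub>R A')))) (at t)"
    by (rule has_derivative_compose[where g = det]) (simp add: Ai det_has_derivative_mat1)
  then have "((\<lambda>s. Re (det (Ai ** A s))) has_derivative (\<lambda>h. Re (trace (Ai ** (h *\<^sub>R A'))))) (at t)"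
    by (rule bounded_linear.has_derivative[OF bounded_linear_Re])
  also have "(\<lambda>h. Re (trace (Ai ** (h *\<^sub>R A')))) = (*) (Re (trace (Ai ** A')))"
    by (simp add: matmul.scaleR_right linear_simps(5)[OF bounded_linear_trace] fun_eq_iff)
  finally have D: "((\<lambda>s. Re (det (Ai ** A s))) has_real_derivative Re (trace (Ai ** A'))) (at t)"
    by (simp add: has_field_derivative_def)
  have eq: "Re (det (A s)) = r * Re (det (Ai ** A s))" for s
  proof -
    have "det (A t) * det (Ai ** A s) = det ((A t ** Ai) ** A s)"
      by (simp add: det_mul mult.assoc)
    then have "det (A s) = complex_of_real r * det (Ai ** A s)" by (simp add: Ai r)
    then show ?thesis by simp
  qed
  have "((\<lambda>s. ln (r * Re (det (Ai ** A s)))) has_real_derivative Re (trace (Ai ** A'))) (at t)"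
  proof -
    have "((\<lambda>s. r * Re (det (Ai ** A s))) has_real_derivative r * Re (trace (Ai ** A'))) (at t)"
      by (rule DERIV_cmult[OF D])
    from DERIV_chain2[OF DERIV_ln_divide this] show ?thesis using r by (simp add: Ai)
  qed
  then show ?thesis unfolding eq[symmetric] unfolding Ai_def .
qed

lemma inner_cnj_matrix: "v \<bullet> (map_matrix cnj A *v v) = (\<chi> i. cnj (v $ i)) \<bullet> (A *v (\<chi> i. cnj (v $ i)))"
proof -
  have "(map_matrix cnj A *v v) $ i = cnj ((A *v (\<chi> i. cnj (v $ i))) $ i)" for i
    by (simp add: matrix_vector_mult_def)
  then show ?thesis by (simp add: inner_vec_def inner_complex_def)
qed

lemma posdef_cnj:
  assumes "posdef A"
  shows "posdef (map_matrix cnj A)"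
proof -
  have "positive_matrix (map_matrix cnj A)"
    unfolding positive_matrix_def inner_cnj_matrix
  proof (intro allI impI)
    fix v :: "complex^'a" assume "v \<noteq> 0"
    then have "(\<chi> i. cnj (v $ i)) \<noteq> 0" by (simp add: vec_eq_iff)
    then show "0 < (\<chi> i. cnj (v $ i)) \<bullet> (A *v (\<chi> i. cnj (v $ i)))"
      using assms by (simp add: posdef_def positive_matrix_def)
  qed
  moreover have "hermitian (map_matrix cnj A)"
    using assms by (simp add: posdef_def hermitian_def adjoint_matrix_cnj)
  ultimately show ?thesis by (simp add: posdef_def)
qed

lemma posdef_plus_mat1:
  assumes "posdef T"
  shows "posdef (mat 1 + T)"
  using assms
  by (auto simp: posdef_def hermitian_def positive_matrix_def adjoint_matrix_add
      matrix_vector_mult_add_rdistrib inner_add_right intro: add_pos_pos)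

text \<open>Carries symmetries of the right side over to the solution: the adjoint and the conjugate
  of \<open>R'\<close> satisfy the equation of \<open>R'\<close> itself, so \<open>R'\<close> is
  Hermitian and real.\<close>

lemma sylvester_cancel:
  fixes T X Y :: "complex^'n^'n"
  assumes "posdef T" "T ** X + X ** T = T ** Y + Y ** T"
  shows "X = Y"
proof -
  have "T ** (X - Y) + (X - Y) ** T = 0"
    using assms(2) by (simp add: matmul_simps algebra_simps)
  then have "X - Y = 0" using sylvester_unique assms(1) posdef_def by metis
  then show ?thesis by simp
qed

text \<open>Both summands of the first variation of the Higgs term agree up to complex conjugation because
  the conjugate of \<open>B\<close> intertwines \<open>T\<close> with its conjugate.\<close>

lemma higgs_variation_identity:
  fixes R Ri R' T T' B X \<Phi> :: "complex^'n^'n"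
  assumes R: "posdef R" "map_matrix cnj R = R" "R ** Ri = mat 1" "Ri ** R = mat 1"
    and T: "posdef T" and X: "transpose X = X"
    and B: "B = R ** X ** R" and BB: "T ** T = mat 1 - B ** map_matrix cnj B"
    and \<Phi>: "hermitian \<Phi>" "map_matrix cnj \<Phi> = \<Phi>"
    and R': "R ** R' + R' ** R = \<Phi>"
    and B': "B' = R' ** X ** R + R ** X ** R'"
    and T': "T ** T' + T' ** T = - (B' ** map_matrix cnj B + B ** map_matrix cnj B')"
  shows "- Re (trace (Ri ** R')) + (- Re (trace T') + Re (trace (matrix_inv (mat 1 + T) ** T'))) / 2
    = - Re (trace (Ri ** T ** Ri ** \<Phi>)) / 2"
proof -
  define Q where "Q = matrix_inv (mat 1 + T)"
  let ?c = "map_matrix cnj :: complex^'n^'n \<Rightarrow> complex^'n^'n"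
  note ra = matrix_mul_assoc[symmetric]
  have herm_R: "adjoint_matrix R = R" and herm_T: "adjoint_matrix T = T"
    using R T by (auto simp: posdef_def hermitian_def)
  have adj_X: "adjoint_matrix X = ?c X" by (simp add: adjoint_matrix_eq_transpose X)
  have Q: "(mat 1 + T) ** Q = mat 1" "Q ** (mat 1 + T) = mat 1"
    using posdef_inverse[OF posdef_plus_mat1[OF T]] by (auto simp: Q_def)
  have TQ: "T ** Q = mat 1 - Q" and QT: "Q ** T = mat 1 - Q"
    using Q by (auto simp: matmul_simps eq_diff_eq add.commute)
  have adj_Q: "adjoint_matrix Q = Q"
  proof -
    have "(mat 1 + T) ** adjoint_matrix Q = adjoint_matrix (Q ** (mat 1 + T))"
      by (simp add: adjoint_matrix_mult adjoint_matrix_add herm_T)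
    then have "Q ** ((mat 1 + T) ** adjoint_matrix Q) = Q" by (simp add: Q)
    then show ?thesis by (simp only: matrix_mul_assoc Q matrix_mul_lid)
  qed
  have adj_R': "adjoint_matrix R' = R'"
  proof (rule sylvester_cancel[OF R(1)])
    have "R ** adjoint_matrix R' + adjoint_matrix R' ** R = adjoint_matrix (R ** R' + R' ** R)"
      by (simp add: adjoint_matrix_mult adjoint_matrix_add herm_R add.commute)
    then show "R ** adjoint_matrix R' + adjoint_matrix R' ** R = R ** R' + R' ** R"
      using \<Phi> R' by (simp add: hermitian_def)
  qed
  have cR': "?c R' = R'"
  proof (rule sylvester_cancel[OF R(1)])
    have "R ** ?c R' + ?c R' ** R = ?c (R ** R' + R' ** R)"
      by (simp add: cnj_matrix_mult cnj_matrix_add R)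
    then show "R ** ?c R' + ?c R' ** R = R ** R' + R' ** R"
      using \<Phi> R' by simp
  qed
  have cRi: "?c Ri = Ri"
  proof -
    have "?c (R ** Ri) = R ** ?c Ri" by (simp only: cnj_matrix_mult R(2))
    then have "R ** ?c Ri = mat 1" by (simp add: R)
    then have "Ri ** (R ** ?c Ri) = Ri" by simp
    then show ?thesis by (simp add: matrix_mul_assoc R)
  qed
  have adj_B: "adjoint_matrix B = ?c B"
    by (simp add: B adjoint_matrix_mult cnj_matrix_mult adj_X herm_R R ra)
  have adj_B': "adjoint_matrix B' = ?c B'"
    by (simp add: B' adjoint_matrix_mult cnj_matrix_mult adjoint_matrix_add cnj_matrix_add
        adj_X herm_R adj_R' cR' R ra add.commute)
  have BB': "B ** ?c B = mat 1 - T ** T" using BB by simp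
  have cBB: "?c B ** B = mat 1 - ?c T ** ?c T"
    using arg_cong[OF BB', of ?c] by (simp add: cnj_matrix_mult cnj_matrix_diff)
  \<comment> \<open>Bracketing the product of \<open>?c B\<close>, \<open>B\<close> and
    \<open>?c B\<close> in both ways intertwines the squares of \<open>T\<close> and
    \<open>?c T\<close>. The failure of the roots to intertwine then solves a homogeneous Sylvester
    equation with the positive coefficients \<open>?c T\<close> and \<open>T\<close>, hence is
    zero.\<close>
  have inter: "?c B ** T = ?c T ** ?c B"
  proof -
    have "?c B ** (B ** ?c B) = (?c B ** B) ** ?c B" by (simp add: matrix_mul_assoc)
    then have e: "?c B ** (T ** T) = ?c T ** ?c T ** ?c B"
      unfolding BB' cBB by (simp add: matmul_simps)
    have "?c T ** (?c B ** T - ?c T ** ?c B) + (?c B ** T - ?c T ** ?c B) ** T = 0"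
      using e by (simp add: matmul_simps matrix_mul_assoc)
    then have "?c B ** T - ?c T ** ?c B = 0"
      using sylvester_unique posdef_cnj[OF T] T posdef_def by metis
    then show ?thesis by simp
  qed
  have interQ: "?c B ** Q = ?c Q ** ?c B"
  proof -
    have e: "?c B ** (mat 1 + T) = (mat 1 + ?c T) ** ?c B" by (simp add: matmul_simps inter)
    have cQ: "?c Q ** (mat 1 + ?c T) = mat 1"
      using arg_cong[OF Q(2), of ?c] by (simp add: cnj_matrix_mult cnj_matrix_add)
    have "?c Q ** (?c B ** (mat 1 + T)) ** Q = ?c Q ** ?c B"
      by (simp add: ra Q)
    moreover have "?c Q ** ((mat 1 + ?c T) ** ?c B) ** Q = ?c B ** Q"
      by (simp add: matrix_mul_assoc cQ)
    ultimately show ?thesis by (simp add: e)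
  qed
  \<comment> \<open>The factorisation of \<open>1 - T^2\<close> into \<open>1 - T\<close> and
    \<open>1 + T\<close>: cancelling \<open>Q\<close> against the second factor is what leaves a
    plain \<open>T\<close> in the final formula.\<close>
  have one: "(mat 1 - T ** T) ** Q = mat 1 - T"
    by (simp add: matmul_simps ra TQ)
  have one': "Q ** (mat 1 - T ** T) = mat 1 - T"
    by (simp add: matmul_simps matrix_mul_assoc QT)
  have cBQB: "?c B ** Q ** B = ?c (mat 1 - T)"
  proof -
    have "?c B ** Q ** B = ?c Q ** (?c B ** B)" by (simp add: interQ ra)
    also have "\<dots> = ?c (Q ** (mat 1 - T ** T))" by (simp add: cBB cnj_matrix_mult cnj_matrix_diff)
    finally show ?thesis by (simp add: one')
  qed
  \<comment> \<open>Written with the logarithmic derivative of \<open>R\<close>, the variation of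
    \<open>B\<close> contains \<open>B\<close> again, so that \<open>B ** ?c B\<close> and
    \<open>?c B ** Q ** B\<close> can be replaced by expressions in \<open>T\<close> and its
    conjugate.\<close>
  have B'_eq: "B' = R' ** Ri ** B + B ** Ri ** R'"
  proof -
    have "R' ** Ri ** B = R' ** (Ri ** R) ** X ** R" "B ** Ri ** R' = R ** X ** (R ** Ri) ** R'"
      by (simp_all add: B matrix_mul_assoc)
    then show ?thesis by (simp add: B' R)
  qed
  have Ri\<Phi>Ri: "Ri ** \<Phi> ** Ri = R' ** Ri + Ri ** R'"
  proof -
    have "Ri ** \<Phi> ** Ri = (Ri ** R) ** R' ** Ri + Ri ** R' ** (R ** Ri)"
      by (simp add: R'[symmetric] matmul_simps matrix_mul_assoc)
    then show ?thesis by (simp add: R)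
  qed
  let ?M = "Q ** B' ** ?c B"
  \<comment> \<open>Cyclicity of the trace brings \<open>1 - T\<close> into the first summand and
    its conjugate into the second; taking real parts merges the two into
    \<open>Ri ** \<Phi> ** Ri\<close>.\<close>
  have trM: "Re (trace ?M) = Re (trace (Ri ** \<Phi> ** Ri ** (mat 1 - T)))"
  proof -
    have "trace ?M = trace (Q ** (R' ** Ri ** (B ** ?c B))) + trace ((Q ** B) ** (Ri ** R' ** ?c B))"
      by (simp add: B'_eq matmul_simps matrix_mul_assoc trace_add)
    also have "trace (Q ** (R' ** Ri ** (B ** ?c B))) = trace (R' ** Ri ** ((mat 1 - T ** T) ** Q))"
      by (subst trace_mul_sym) (simp add: matrix_mul_assoc BB')
    also have "\<dots> = trace (R' ** Ri ** (mat 1 - T))" by (simp add: one)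
    also have "trace ((Q ** B) ** (Ri ** R' ** ?c B)) = trace (Ri ** R' ** (?c B ** Q ** B))"
      by (subst trace_mul_sym) (simp add: matrix_mul_assoc)
    also have "\<dots> = trace (?c (Ri ** R' ** (mat 1 - T)))"
      by (simp add: cBQB cnj_matrix_mult cRi cR')
    also have "\<dots> = cnj (trace (Ri ** R' ** (mat 1 - T)))" by (rule trace_cnj_matrix)
    finally show ?thesis by (simp add: Ri\<Phi>Ri matmul_simps trace_add trace_sub)
  qed
  \<comment> \<open>\<open>Q\<close> commutes with \<open>T\<close>, so the trace of
    \<open>Q\<close> against the left side of the equation for \<open>T'\<close> is twice a single
    term. On the right side the second summand has the conjugate trace of \<open>?M\<close>, because
    it becomes the adjoint of \<open>?M\<close> after a cyclic shift.\<close>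
  have tr2: "2 * Re (trace (Q ** T ** T')) = - 2 * Re (trace ?M)"
  proof -
    have "trace (Q ** (T ** T' + T' ** T)) = trace (Q ** T ** T') + trace ((Q ** T') ** T)"
      by (simp add: matmul_simps matrix_mul_assoc trace_add)
    also have "trace ((Q ** T') ** T) = trace (Q ** T ** T')"
      by (subst trace_mul_sym) (simp add: matrix_mul_assoc TQ QT)
    finally have 1: "trace (Q ** (T ** T' + T' ** T)) = 2 * trace (Q ** T ** T')" by simp
    have "trace (Q ** (B ** ?c B')) = trace ((B ** ?c B') ** Q)" by (rule trace_mul_sym)
    also have "(B ** ?c B') ** Q = adjoint_matrix ?M"
      using arg_cong[OF adj_B, of adjoint_matrix]
      by (simp add: adjoint_matrix_mult adj_Q adj_B' matrix_mul_assoc)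
    finally have "trace (Q ** (B ** ?c B')) = cnj (trace ?M)" by (simp add: trace_adjoint_matrix)
    moreover have "Q ** (T ** T' + T' ** T) = - (?M + Q ** (B ** ?c B'))"
      unfolding T' by (simp add: matmul_simps matrix_mul_assoc)
    ultimately have "trace (Q ** (T ** T' + T' ** T)) = - (trace ?M + cnj (trace ?M))"
      by (simp add: trace_minus trace_sub)
    then have "Re (trace (Q ** (T ** T' + T' ** T))) = - 2 * Re (trace ?M)" by simp
    then show ?thesis unfolding 1 by simp
  qed
  have "trace (Q ** T') - trace T' = - trace (Q ** T ** T')"
    by (simp add: QT matmul_simps trace_sub)
  then have "- Re (trace T') + Re (trace (Q ** T')) = Re (trace (Ri ** \<Phi> ** Ri ** (mat 1 - T)))"
    using tr2 trM by (simp add: complex_eq_iff)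
  also have "\<dots> = Re (trace (Ri ** \<Phi> ** Ri)) - Re (trace (Ri ** \<Phi> ** Ri ** T))"
    by (simp add: matmul_simps trace_sub)
  also have "trace (Ri ** \<Phi> ** Ri) = trace (R' ** Ri) + trace (Ri ** R')"
    by (simp add: Ri\<Phi>Ri trace_add)
  also have "trace (R' ** Ri) = trace (Ri ** R')" by (rule trace_mul_sym)
  also have "trace (Ri ** \<Phi> ** Ri ** T) = trace ((Ri ** \<Phi>) ** (Ri ** T))"
    by (simp add: matrix_mul_assoc)
  also have "\<dots> = trace (Ri ** T ** Ri ** \<Phi>)"
    by (subst trace_mul_sym) (simp add: matrix_mul_assoc)
  finally show ?thesis by (simp add: Q_def diff_divide_distrib)
qed

section \<open>The energy density\<close>

lemma has_vector_derivative_sqrt: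
  fixes T M :: "real \<Rightarrow> complex^'n^'n"
  assumes M: "(M has_vector_derivative M') (at t)"
    and T: "\<forall>\<^sub>F s in nhds t. posdef (T s) \<and> T s ** T s = M s"
  obtains T' where "(T has_vector_derivative T') (at t)" "T t ** T' + T' ** T t = M'"
proof -
  obtain D where D: "(T has_derivative D) (at t)" "\<And>h. T t ** D h + D h ** T t = h *\<^sub>R M'"
    using has_derivative_sqrt[OF M[unfolded has_vector_derivative_def] T] by blast
  interpret bounded_linear D by (rule has_derivative_bounded_linear[OF D(1)])
  have "D = (\<lambda>h. h *\<^sub>R D 1)" by (simp add: fun_eq_iff scaleR[symmetric])
  then have "(T has_vector_derivative D 1) (at t)" using D(1) by (simp add: has_vector_derivative_def)
  moreover have "T t ** D 1 + D 1 ** T t = M'" using D(2)[of 1] by simp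
  ultimately show ?thesis by (rule that)
qed

lemma eigenvalues_diagonalized:
  fixes P Pi :: "complex^'n^'n"
  assumes P: "P ** Pi = mat 1"
  shows "eigenvalues (P ** diagonal_matrix d ** Pi) = range (\<lambda>i. complex_of_real (d $ i))"
proof (intro equalityI subsetI)
  have Pi: "Pi ** P = mat 1" using P by (simp add: matrix_left_right_inverse)
  fix z assume "z \<in> eigenvalues (P ** diagonal_matrix d ** Pi)"
  then obtain v where v: "v \<noteq> 0" "P ** diagonal_matrix d ** Pi *v v = z *s v"
    by (auto simp: eigenvalues_def)
  define w where "w = Pi *v v"
  have "P *v w = v" by (simp add: w_def matrix_vector_mul_assoc P)
  then have "w \<noteq> 0" using v(1) by auto
  then obtain i where i: "w $ i \<noteq> 0" by (auto simp: vec_eq_iff)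
  have "Pi *v (P ** diagonal_matrix d ** Pi *v v) = z *s w"
    by (simp add: v w_def vector_scalar_commute)
  then have "diagonal_matrix d *v w = z *s w"
    by (simp add: w_def matrix_vector_mul_assoc matrix_mul_assoc Pi)
  then have "complex_of_real (d $ i) * w $ i = z * w $ i"
    by (metis diagonal_matrix_vector vector_smult_component)
  then show "z \<in> range (\<lambda>i. complex_of_real (d $ i))" using i by auto
next
  have Pi: "Pi ** P = mat 1" using P by (simp add: matrix_left_right_inverse)
  fix z assume "z \<in> range (\<lambda>i. complex_of_real (d $ i))"
  then obtain i where z: "z = complex_of_real (d $ i)" by blast
  let ?v = "P *v axis i 1"
  have "Pi *v ?v = axis i 1" by (simp add: matrix_vector_mul_assoc Pi)
  then have "?v \<noteq> 0" by (metis axis_eq_0_iff matrix_vector_mult_0_right zero_neq_one)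
  moreover have "diagonal_matrix d *v axis i 1 = z *s axis i 1"
    by (simp add: vec_eq_iff diagonal_matrix_vector z axis_def)
  then have "P ** diagonal_matrix d ** Pi *v ?v = z *s ?v"
    by (simp add: matrix_vector_mul_assoc[symmetric] \<open>Pi *v ?v = axis i 1\<close> vector_scalar_commute)
  ultimately show "z \<in> eigenvalues (P ** diagonal_matrix d ** Pi)"
    by (auto simp: eigenvalues_def)
qed

lemma matrix_mult_diagonal_matrix:
  "(A ** diagonal_matrix d) $ i $ j = A $ i $ j * complex_of_real (d $ j)"
  by (simp add: matrix_matrix_mult_def diagonal_matrix_def if_distrib[of "\<lambda>x. _ * x"] cong: if_cong)

text \<open>The competitors are all matrices with positive eigenvalues, diagonalizable or not. For a
  rival root \<open>S'\<close> and \<open>X = S' - S\<close> one has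
  \<open>S' ** X = - (X ** S)\<close>, so each column of \<open>X ** P\<close> is zero or an
  eigenvector of \<open>S'\<close> for the negative number \<open>- (s $ j)\<close>.\<close>

lemma matrix_sqrt_diagonalized:
  fixes P Pi :: "complex^'n^'n"
  assumes P: "P ** Pi = mat 1" and s: "\<And>i. 0 < s $ i"
    and S: "S = P ** diagonal_matrix s ** Pi"
  shows "matrix_sqrt (S ** S) = S"
  unfolding matrix_sqrt_def
proof (rule the_equality)
  show "S ** S = S ** S \<and> (\<forall>z\<in>eigenvalues S. \<exists>r>0. z = complex_of_real r)"
    using s by (auto simp: S eigenvalues_diagonalized[OF P])
next
  fix S' assume S': "S' ** S' = S ** S \<and> (\<forall>z\<in>eigenvalues S'. \<exists>s>0. z = complex_of_real s)"
  have Pi: "Pi ** P = mat 1" using P by (simp add: matrix_left_right_inverse)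
  define X where "X = S' - S"
  have SP: "S ** P = P ** diagonal_matrix s"
    by (simp add: S matrix_mul_assoc[symmetric] Pi)
  have "S' ** X = - (X ** S)"
    using S' by (simp add: X_def matmul_simps)
  then have "S' ** X ** P = - (X ** (S ** P))"
    by (simp add: matmul_simps matrix_mul_assoc)
  then have eq: "S' ** (X ** P) = - ((X ** P) ** diagonal_matrix s)"
    by (simp add: SP matrix_mul_assoc)
  have "column j (X ** P) = 0" for j
  proof (rule ccontr)
    assume ne: "column j (X ** P) \<noteq> 0"
    have "S' *v column j (X ** P) = column j (- ((X ** P) ** diagonal_matrix s))"
      by (simp add: column_matrix_mult[symmetric] eq)
    also have "\<dots> = complex_of_real (- (s $ j)) *s column j (X ** P)"
      by (simp add: vec_eq_iff column_def matrix_mult_diagonal_matrix)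
    finally have "complex_of_real (- (s $ j)) \<in> eigenvalues S'"
      using ne by (auto simp: eigenvalues_def)
    then obtain r where "r > 0" "complex_of_real (- (s $ j)) = complex_of_real r" using S' by blast
    then have "- (s $ j) = r" by (simp only: of_real_eq_iff)
    with s[of j] \<open>r > 0\<close> show False by simp
  qed
  then have "X ** P = 0" by (simp add: vec_eq_iff column_def)
  then have "X ** P ** Pi = 0" by simp
  then show "S' = S" by (simp add: matrix_mul_assoc[symmetric] P X_def)
qed

lemma trace_diagonal_matrix: "trace (diagonal_matrix d) = complex_of_real (\<Sum>i\<in>UNIV. d $ i)"
  by (simp add: trace_def diagonal_matrix_def)

lemma det_diagonal_matrix: "det (diagonal_matrix d) = complex_of_real (\<Prod>i\<in>UNIV. d $ i)"
  by (subst det_diagonal) (auto simp: diagonal_matrix_def)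

lemma mat1_eq_diagonal_matrix: "mat 1 = diagonal_matrix (\<chi> i. 1)"
  by (simp add: vec_eq_iff mat_def diagonal_matrix_def)

lemma diagonal_matrix_diff: "diagonal_matrix d - diagonal_matrix e = diagonal_matrix (d - e)"
  by (simp add: vec_eq_iff diagonal_matrix_def)

lemma diagonal_matrix_add: "diagonal_matrix d + diagonal_matrix e = diagonal_matrix (d + e)"
  by (simp add: vec_eq_iff diagonal_matrix_def)

section \<open>Linear algebra of the Higgs data at one point\<close>

definition higgs_factor :: "complex^'n^'n \<Rightarrow> complex^'n^'n \<Rightarrow> complex^'n^'n" where
  "higgs_factor X H = posdef_sqrt H ** X ** posdef_sqrt H"

text \<open>For symmetric \<open>X\<close> and real \<open>H\<close> the conjugate of the factor is
  its adjoint, which makes this matrix Hermitian.\<close>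

definition higgs_defect :: "complex^'n^'n \<Rightarrow> complex^'n^'n \<Rightarrow> complex^'n^'n" where
  "higgs_defect X H = mat 1 - higgs_factor X H ** map_matrix cnj (higgs_factor X H)"

definition higgs_root :: "complex^'n^'n \<Rightarrow> complex^'n^'n \<Rightarrow> complex^'n^'n" where
  "higgs_root X H = posdef_sqrt (higgs_defect X H)"

definition moment_matrix :: "complex^'n^'n \<Rightarrow> complex^'n^'n \<Rightarrow> complex^'n^'n" where
  "moment_matrix X H = matrix_inv (posdef_sqrt H) ** higgs_root X H ** matrix_inv (posdef_sqrt H)"

definition energy_density :: "complex^'n^'n \<Rightarrow> complex^'n^'n \<Rightarrow> real" where
  "energy_density X H = (real CARD('n) - ln (Re (det H)) - Re (trace (higgs_root X H))
     + ln (Re (det (mat 1 + higgs_root X H)))) / 2"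

text \<open>Kept apart from \<open>admissible_higgs_data\<close> for the sake of perturbed
  potentials: there positivity of the defect comes from an openness argument, while its Hermitian
  symmetry comes from these assumptions alone.\<close>

locale higgs_data =
  fixes X H :: "complex^'n^'n"
  assumes X_sym: "transpose X = X" and H_posdef: "posdef H" and H_real: "map_matrix cnj H = H"
begin

abbreviation "R \<equiv> posdef_sqrt H"
abbreviation "Ri \<equiv> matrix_inv R"
abbreviation "B \<equiv> higgs_factor X H"
abbreviation "T \<equiv> higgs_root X H"
abbreviation "E \<equiv> X ** H ** map_matrix cnj X ** H"

lemma R: "posdef R" "R ** R = H" "R ** Ri = mat 1" "Ri ** R = mat 1"
  using posdef_sqrt[OF H_posdef] posdef_inverse by auto

lemma R_real: "map_matrix cnj R = R"
proof (rule posdef_sqrt_unique[OF posdef_cnj[OF R(1)] R(1)])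
  show "map_matrix cnj R ** map_matrix cnj R = R ** R"
    unfolding cnj_matrix_mult[symmetric] R(2) by (rule H_real)
qed

lemma adjoint_R: "adjoint_matrix R = R"
  using R(1) by (simp add: posdef_def hermitian_def)

lemma adjoint_Ri: "adjoint_matrix Ri = Ri"
proof -
  have "adjoint_matrix (Ri ** R) = R ** adjoint_matrix Ri"
    by (simp only: adjoint_matrix_mult adjoint_R)
  then have "R ** adjoint_matrix Ri = mat 1" by (simp add: R)
  from matrix_inv_eqI[OF this] show ?thesis by simp
qed

lemma adjoint_factor: "adjoint_matrix B = map_matrix cnj B"
  by (simp add: higgs_factor_def adjoint_matrix_mult cnj_matrix_mult adjoint_R R_real
      adjoint_matrix_eq_transpose[of X] X_sym matrix_mul_assoc)

lemma hermitian_factor_square: "hermitian (B ** map_matrix cnj B)"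
  by (simp add: hermitian_def adjoint_matrix_mult adjoint_factor[symmetric])

lemma hermitian_defect: "hermitian (higgs_defect X H)"
  using hermitian_factor_square by (simp add: hermitian_def higgs_defect_def adjoint_matrix_diff)

lemma endomorphism_eq: "E = Ri ** (B ** map_matrix cnj B) ** R"
proof -
  have "Ri ** (B ** map_matrix cnj B) ** R = (Ri ** R) ** X ** (R ** R) ** map_matrix cnj X ** (R ** R)"
    by (simp only: higgs_factor_def cnj_matrix_mult R_real matrix_mul_assoc)
  then show ?thesis by (simp only: R matrix_mul_lid)
qed

text \<open>One unitary \<open>U\<close> serves both sides: it diagonalizes the Hermitian matrix
  \<open>B ** map_matrix cnj B\<close>, and \<open>Ri ** U\<close> diagonalizes \<open>E\<close>
  with the same real eigenvalues. Functions of \<open>E\<close> can thus be computed from the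
  defect.\<close>

lemma diagonalization:
  obtains U P Pi :: "complex^'n^'n" and d where "U ** adjoint_matrix U = mat 1" "P ** Pi = mat 1"
    "E = P ** diagonal_matrix d ** Pi" "Ri ** U = P" "adjoint_matrix U ** R = Pi"
    "higgs_defect X H = U ** diagonal_matrix (\<chi> i. 1 - d $ i) ** adjoint_matrix U"
proof -
  obtain U :: "complex^'n^'n" and d where U: "adjoint_matrix U ** U = mat 1" "U ** adjoint_matrix U = mat 1"
    and K: "B ** map_matrix cnj B = U ** diagonal_matrix d ** adjoint_matrix U"
    using hermitian_spectral[OF hermitian_factor_square] by blast
  have P: "(Ri ** U) ** (adjoint_matrix U ** R) = mat 1"
  proof -
    have "(Ri ** U) ** (adjoint_matrix U ** R) = Ri ** (U ** adjoint_matrix U) ** R"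
      by (simp only: matrix_mul_assoc)
    then show ?thesis by (simp add: U R)
  qed
  have E: "E = (Ri ** U) ** diagonal_matrix d ** (adjoint_matrix U ** R)"
    by (simp only: endomorphism_eq K matrix_mul_assoc)
  have "(\<chi> i. 1 - d $ i) = (\<chi> i. 1) - d" by (simp add: vec_eq_iff)
  then have "U ** diagonal_matrix (\<chi> i. 1 - d $ i) ** adjoint_matrix U = U ** (mat 1 - diagonal_matrix d) ** adjoint_matrix U"
    by (simp add: mat1_eq_diagonal_matrix diagonal_matrix_diff)
  also have "\<dots> = higgs_defect X H"
    by (simp add: higgs_defect_def K matmul_simps U)
  finally show ?thesis using that[OF U(2) P E refl refl] by simp
qed

text \<open>The eigenvalues \<open>d $ i\<close> of \<open>E\<close> are real with absolute value
  below one, so the eigenvalues \<open>1 - d $ i\<close> of the defect are positive.\<close>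

lemma defect_posdef_if_spectral_radius:
  assumes "spectral_radius E < 1"
  shows "posdef (higgs_defect X H)"
proof -
  obtain U P Pi :: "complex^'n^'n" and d where U: "U ** adjoint_matrix U = mat 1" and P: "P ** Pi = mat 1"
    and E: "E = P ** diagonal_matrix d ** Pi"
    and N: "higgs_defect X H = U ** diagonal_matrix (\<chi> i. 1 - d $ i) ** adjoint_matrix U"
    using diagonalization by metis
  have "eigenvalues E = range (\<lambda>i. complex_of_real (d $ i))"
    unfolding E by (rule eigenvalues_diagonalized[OF P])
  then have "spectral_radius E = Max (norm ` range (\<lambda>i. complex_of_real (d $ i)))"
    by (simp add: spectral_radius_def)
  moreover have "norm (complex_of_real (d $ i)) \<le> Max (norm ` range (\<lambda>i. complex_of_real (d $ i)))" for i
    by (intro Max_ge imageI rangeI) auto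
  ultimately have "norm (complex_of_real (d $ i)) < 1" for i
    using assms by (metis order.strict_trans1)
  then have "d $ i < 1" for i
    by (metis abs_less_iff norm_of_real)
  then have "posdef (adjoint_matrix (adjoint_matrix U) ** diagonal_matrix (\<chi> i. 1 - d $ i) ** adjoint_matrix U)"
    using U by (intro posdef_conjugate[of _ U]) (auto simp: posdef_diagonal_matrix)
  then show ?thesis by (simp add: N)
qed

end

locale admissible_higgs_data = higgs_data X H for X H :: "complex^'n^'n" +
  assumes defect_posdef: "posdef (higgs_defect X H)"
begin

lemma T: "posdef T" "T ** T = higgs_defect X H"
  using posdef_sqrt[OF defect_posdef] by (auto simp: higgs_root_def)

text \<open>Uniqueness of the positive square root identifies \<open>T\<close> with the matrix
  having the roots of the eigenvalues in the same basis.\<close>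

lemma root_diagonalization:
  obtains U P Pi :: "complex^'n^'n" and d where "U ** adjoint_matrix U = mat 1" "P ** Pi = mat 1"
    "E = P ** diagonal_matrix d ** Pi" "Ri ** U = P" "adjoint_matrix U ** R = Pi"
    "\<And>i. d $ i < 1" "T = U ** diagonal_matrix (\<chi> i. sqrt (1 - d $ i)) ** adjoint_matrix U"
proof -
  obtain U P Pi :: "complex^'n^'n" and d where U: "U ** adjoint_matrix U = mat 1" and P: "P ** Pi = mat 1"
    and E: "E = P ** diagonal_matrix d ** Pi" and RiU: "Ri ** U = P" "adjoint_matrix U ** R = Pi"
    and N: "higgs_defect X H = U ** diagonal_matrix (\<chi> i. 1 - d $ i) ** adjoint_matrix U"
    using diagonalization by metis
  have U': "adjoint_matrix U ** U = mat 1" using U by (simp add: matrix_left_right_inverse)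
  have "posdef (adjoint_matrix U ** higgs_defect X H ** U)"
    using defect_posdef U' by (intro posdef_conjugate)
  also have "adjoint_matrix U ** higgs_defect X H ** U =
      (adjoint_matrix U ** U) ** diagonal_matrix (\<chi> i. 1 - d $ i) ** (adjoint_matrix U ** U)"
    by (simp only: N matrix_mul_assoc)
  finally have d: "d $ i < 1" for i by (simp add: U' posdef_diagonal_matrix)
  let ?D = "diagonal_matrix (\<chi> i. sqrt (1 - d $ i))"
  have "posdef (adjoint_matrix (adjoint_matrix U) ** ?D ** adjoint_matrix U)"
    using U d by (intro posdef_conjugate[of _ U]) (auto simp: posdef_diagonal_matrix)
  then have pd: "posdef (U ** ?D ** adjoint_matrix U)" by simp
  have "(U ** ?D ** adjoint_matrix U) ** (U ** ?D ** adjoint_matrix U) = U ** ?D ** (adjoint_matrix U ** U) ** ?D ** adjoint_matrix U"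
    by (simp only: matrix_mul_assoc)
  also have "\<dots> = U ** (?D ** ?D) ** adjoint_matrix U" by (simp add: U' matrix_mul_assoc)
  also have "\<dots> = T ** T"
    using d by (simp add: diagonal_matrix_mult T N less_imp_le)
  finally have "T = U ** ?D ** adjoint_matrix U"
    using posdef_sqrt_unique[OF pd T(1)] by simp
  with U P E RiU d show ?thesis by (rule that)
qed

text \<open>\<open>E\<close> need not be Hermitian, so \<open>posdef_sqrt\<close> does not apply to
  \<open>mat 1 - E\<close> directly. The conjugate of \<open>T\<close> by \<open>R\<close> has
  positive eigenvalues and the right square, which pins it down.\<close>

lemma matrix_sqrt_endomorphism: "matrix_sqrt (mat 1 - E) = Ri ** T ** R"
proof -
  obtain U P Pi :: "complex^'n^'n" and d where P: "P ** Pi = mat 1"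
    and RiU: "Ri ** U = P" "adjoint_matrix U ** R = Pi" and d: "\<And>i. d $ i < 1"
    and T': "T = U ** diagonal_matrix (\<chi> i. sqrt (1 - d $ i)) ** adjoint_matrix U"
    using root_diagonalization by metis
  have "Ri ** T ** R = P ** diagonal_matrix (\<chi> i. sqrt (1 - d $ i)) ** Pi"
    by (simp only: T' RiU[symmetric] matrix_mul_assoc)
  then have "matrix_sqrt ((Ri ** T ** R) ** (Ri ** T ** R)) = Ri ** T ** R"
    using d by (intro matrix_sqrt_diagonalized[OF P]) auto
  moreover have "(Ri ** T ** R) ** (Ri ** T ** R) = mat 1 - E"
  proof -
    have "(Ri ** T ** R) ** (Ri ** T ** R) = Ri ** T ** (R ** Ri) ** T ** R"
      by (simp only: matrix_mul_assoc)
    also have "\<dots> = Ri ** (T ** T) ** R" by (simp add: R matrix_mul_assoc)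
    also have "\<dots> = mat 1 - E"
      by (simp add: T higgs_defect_def matmul_simps endomorphism_eq R)
    finally show ?thesis .
  qed
  ultimately show ?thesis by simp
qed

text \<open>The inverse of \<open>H\<close> is \<open>Ri ** Ri\<close>, so one \<open>R\<close>
  cancels and a product that is visibly Hermitian remains.\<close>

lemma moment_matrix_eq: "matrix_sqrt (mat 1 - E) ** matrix_inv H = moment_matrix X H"
proof -
  have "R ** R ** (Ri ** Ri) = R ** (R ** Ri) ** Ri"
    by (simp only: matrix_mul_assoc)
  then have "H ** (Ri ** Ri) = mat 1" by (simp add: R)
  then have "matrix_inv H = Ri ** Ri" by (rule matrix_inv_eqI)
  then have "matrix_sqrt (mat 1 - E) ** matrix_inv H = Ri ** T ** (R ** Ri) ** Ri"
    by (simp only: matrix_sqrt_endomorphism matrix_mul_assoc)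
  then show ?thesis by (simp add: R moment_matrix_def)
qed

lemma hermitian_moment_matrix: "hermitian (moment_matrix X H)"
  using T(1) by (simp add: moment_matrix_def hermitian_def posdef_def adjoint_matrix_mult
      adjoint_Ri matrix_mul_assoc)

lemma hk_density_eq:
  "hk_density E = real CARD('n) - Re (trace T) + ln (Re (det (mat 1 + T)))"
proof -
  obtain U P Pi :: "complex^'n^'n" and d where U: "U ** adjoint_matrix U = mat 1" and P: "P ** Pi = mat 1"
    and E: "E = P ** diagonal_matrix d ** Pi" and d: "\<And>i. d $ i < 1"
    and T': "T = U ** diagonal_matrix (\<chi> i. sqrt (1 - d $ i)) ** adjoint_matrix U"
    using root_diagonalization by metis
  have U': "adjoint_matrix U ** U = mat 1" using U by (simp add: matrix_left_right_inverse)
  have Pi: "Pi ** P = mat 1" using P by (simp add: matrix_left_right_inverse)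
  have "invertible P" using P Pi by (auto simp: invertible_def)
  moreover have Pi_eq: "matrix_inv P = Pi" by (rule matrix_inv_eqI[OF P])
  ultimately have "matrix_function hk_function E = P ** diagonal_matrix (\<chi> i. hk_function (d $ i)) ** Pi"
    using matrix_function_diagonalized[of P E d hk_function] E by simp
  then have "trace (matrix_function hk_function E) = trace (Pi ** (P ** diagonal_matrix (\<chi> i. hk_function (d $ i))))"
    using trace_mul_sym by metis
  then have hk: "hk_density E = (\<Sum>i\<in>UNIV. hk_function (d $ i))"
    by (simp add: hk_density_def matrix_mul_assoc Pi trace_diagonal_matrix)
  have "trace T = trace (adjoint_matrix U ** (U ** diagonal_matrix (\<chi> i. sqrt (1 - d $ i))))"
    unfolding T' by (rule trace_mul_sym)
  then have tr: "Re (trace T) = (\<Sum>i\<in>UNIV. sqrt (1 - d $ i))"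
    by (simp add: matrix_mul_assoc U' trace_diagonal_matrix)
  have "(\<chi> i. 1) + (\<chi> i. sqrt (1 - d $ i)) = (\<chi> i. 1 + sqrt (1 - d $ i))" by (simp add: vec_eq_iff)
  then have "U ** diagonal_matrix (\<chi> i. 1 + sqrt (1 - d $ i)) ** adjoint_matrix U =
      U ** (mat 1 + diagonal_matrix (\<chi> i. sqrt (1 - d $ i))) ** adjoint_matrix U"
    by (simp add: mat1_eq_diagonal_matrix diagonal_matrix_add)
  then have "mat 1 + T = U ** diagonal_matrix (\<chi> i. 1 + sqrt (1 - d $ i)) ** adjoint_matrix U"
    by (simp add: matmul_simps U T')
  then have "det (mat 1 + T) = det (diagonal_matrix (\<chi> i. 1 + sqrt (1 - d $ i))) * det (U ** adjoint_matrix U)"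
    by (simp add: det_mul)
  then have "Re (det (mat 1 + T)) = (\<Prod>i\<in>UNIV. 1 + sqrt (1 - d $ i))"
    unfolding U det_diagonal_matrix vec_lambda_beta by (simp only: det_I mult_1_right Re_complex_of_real)
  moreover have "1 + sqrt (1 - d $ i) \<noteq> 0" for i
    using d[of i] by (intro less_imp_neq[THEN not_sym]) (simp add: add_pos_nonneg)
  ultimately have "ln (Re (det (mat 1 + T))) = (\<Sum>i\<in>UNIV. ln (1 + sqrt (1 - d $ i)))"
    using ln_prod[of UNIV "\<lambda>i. 1 + sqrt (1 - d $ i)"] by simp
  then show ?thesis
    by (simp add: hk tr hk_function_def sum.distrib sum_subtractf)
qed

end

text \<open>The dependence on \<open>H\<close> passes through two successive positive square roots,
  first \<open>R\<close> and then \<open>T\<close>. Both are differentiated through their Sylvester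
  equations, and the resulting \<open>R'\<close> and \<open>T'\<close> are eliminated by
  \<open>higgs_variation_identity\<close>.\<close>

lemma energy_density_has_derivative:
  fixes H :: "real \<Rightarrow> complex^'n^'n"
  assumes H: "(H has_vector_derivative \<Phi>) (at t)"
    and adm: "\<forall>\<^sub>F s in nhds t. admissible_higgs_data X (H s)"
    and \<Phi>: "hermitian \<Phi>" "map_matrix cnj \<Phi> = \<Phi>"
  shows "((\<lambda>s. energy_density X (H s)) has_real_derivative
    - Re (trace (moment_matrix X (H t) ** \<Phi>)) / 2) (at t)"
proof -
  let ?c = "map_matrix cnj :: complex^'n^'n \<Rightarrow> complex^'n^'n"
  interpret admissible_higgs_data X "H t" using eventually_nhds_x_imp_x[OF adm] .
  have "\<forall>\<^sub>F s in nhds t. posdef (posdef_sqrt (H s)) \<and> posdef_sqrt (H s) ** posdef_sqrt (H s) = H s"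
    using adm by eventually_elim (auto simp: admissible_higgs_data_def higgs_data_def posdef_sqrt)
  then obtain R' where R': "((\<lambda>s. posdef_sqrt (H s)) has_vector_derivative R') (at t)" "R ** R' + R' ** R = \<Phi>"
    using has_vector_derivative_sqrt[OF H, of "\<lambda>s. posdef_sqrt (H s)"] by blast
  define B' where "B' = R' ** X ** R + R ** X ** R'"
  have RX: "((\<lambda>s. posdef_sqrt (H s) ** X) has_vector_derivative R' ** X) (at t)"
    by (rule bounded_linear.has_vector_derivative[OF matmul.bounded_linear_left R'(1)])
  have dB: "((\<lambda>s. higgs_factor X (H s)) has_vector_derivative B') (at t)"
    unfolding higgs_factor_def B'_def
    using bounded_bilinear.has_vector_derivative[OF bounded_bilinear_matrix_mult RX R'(1)]
    by (simp add: add.commute)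
  have dcB: "((\<lambda>s. ?c (higgs_factor X (H s))) has_vector_derivative ?c B') (at t)"
    by (rule bounded_linear.has_vector_derivative[OF bounded_linear_cnj_matrix dB])
  have "((\<lambda>s. higgs_defect X (H s)) has_vector_derivative 0 - (B ** ?c B' + B' ** ?c B)) (at t)"
    unfolding higgs_defect_def
    by (intro has_vector_derivative_diff has_vector_derivative_const
        bounded_bilinear.has_vector_derivative[OF bounded_bilinear_matrix_mult dB dcB])
  then have dN: "((\<lambda>s. higgs_defect X (H s)) has_vector_derivative - (B' ** ?c B + B ** ?c B')) (at t)"
    by (simp add: add.commute)
  have "\<forall>\<^sub>F s in nhds t. posdef (higgs_root X (H s)) \<and> higgs_root X (H s) ** higgs_root X (H s) = higgs_defect X (H s)"
    using adm by eventually_elim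
      (auto simp: admissible_higgs_data_def admissible_higgs_data_axioms_def higgs_root_def posdef_sqrt)
  then obtain T' where T': "((\<lambda>s. higgs_root X (H s)) has_vector_derivative T') (at t)"
      "T ** T' + T' ** T = - (B' ** ?c B + B ** ?c B')"
    using has_vector_derivative_sqrt[OF dN, of "\<lambda>s. higgs_root X (H s)"] by blast
  have BB: "T ** T = mat 1 - B ** ?c B" by (simp add: T higgs_defect_def)
  have "((\<lambda>s. mat 1 + higgs_root X (H s)) has_vector_derivative 0 + T') (at t)"
    by (intro has_vector_derivative_add has_vector_derivative_const T')
  from ln_det_has_derivative[OF this] have d1:
    "((\<lambda>s. ln (Re (det (mat 1 + higgs_root X (H s))))) has_real_derivative
      Re (trace (matrix_inv (mat 1 + T) ** T'))) (at t)"
    using posdef_plus_mat1[OF T(1)] by simp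
  have d2: "((\<lambda>s. Re (trace (higgs_root X (H s)))) has_real_derivative Re (trace T')) (at t)"
    unfolding has_real_derivative_iff_has_vector_derivative
    by (intro bounded_linear.has_vector_derivative[OF bounded_linear_Re]
        bounded_linear.has_vector_derivative[OF bounded_linear_trace] T')
  \<comment> \<open>The logarithm of \<open>det H\<close> is differentiated as twice that of
    \<open>det R\<close>, so that its variation is expressed by \<open>R'\<close> as in the
    identity.\<close>
  have "((\<lambda>s. 2 * ln (Re (det (posdef_sqrt (H s))))) has_real_derivative 2 * Re (trace (Ri ** R'))) (at t)"
    using ln_det_has_derivative[OF R'(1) R(1)] by (rule DERIV_cmult)
  moreover have ev: "\<forall>\<^sub>F s in nhds t. 2 * ln (Re (det (posdef_sqrt (H s)))) = ln (Re (det (H s)))"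
    using adm
  proof eventually_elim
    case (elim s)
    interpret s: admissible_higgs_data X "H s" by (rule elim)
    define r where "r = Re (det (posdef_sqrt (H s)))"
    have r: "r > 0" "det (posdef_sqrt (H s)) = complex_of_real r"
      using posdef_det[OF s.R(1)] by (auto simp: r_def)
    have "det (H s) = det (posdef_sqrt (H s) ** posdef_sqrt (H s))" by (simp only: s.R)
    then have "Re (det (H s)) = r * r" by (simp add: det_mul r)
    then show ?case using r by (simp add: ln_mult)
  qed
  ultimately have d3: "((\<lambda>s. ln (Re (det (H s)))) has_real_derivative 2 * Re (trace (Ri ** R'))) (at t)"
    using DERIV_cong_ev[OF refl ev refl] by blast
  have "((\<lambda>s. energy_density X (H s)) has_real_derivative
      (0 - 2 * Re (trace (Ri ** R')) - Re (trace T') + Re (trace (matrix_inv (mat 1 + T) ** T'))) / 2) (at t)"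
    unfolding energy_density_def
    by (intro DERIV_cdivide DERIV_add DERIV_diff DERIV_const d1 d2 d3)
  moreover have "(0 - 2 * Re (trace (Ri ** R')) - Re (trace T') + Re (trace (matrix_inv (mat 1 + T) ** T'))) / 2
      = - Re (trace (moment_matrix X (H t) ** \<Phi>)) / 2"
    using higgs_variation_identity[OF R(1) R_real R(3,4) T(1) X_sym higgs_factor_def BB \<Phi> R'(2) B'_def T'(2)]
    by (simp add: moment_matrix_def diff_divide_distrib add_divide_distrib)
  ultimately show ?thesis by simp
qed

section \<open>Integration over the torus\<close>

lemma periodic_axis:
  assumes "periodic f"
  shows "f (y + axis a 1) = f y"
proof -
  have "(\<chi> b. of_int ((axis a 1 :: int^'a) $ b)) = (axis a 1 :: real^'a)"
    by (simp add: vec_eq_iff axis_def)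
  then show ?thesis using assms unfolding periodic_def by metis
qed

lemma periodic_partial_derivative:
  assumes "periodic f"
  shows "periodic (partial_derivative a f)"
  unfolding periodic_def
proof (intro allI)
  fix y and k :: "int^'a"
  have "f (y + (\<chi> a. of_int (k $ a)) + t *\<^sub>R axis a 1) = f (y + t *\<^sub>R axis a 1)" for t
  proof -
    have "y + (\<chi> a. of_int (k $ a)) + t *\<^sub>R axis a 1 = y + t *\<^sub>R axis a 1 + (\<chi> a. of_int (k $ a))"
      by simp
    then show ?thesis using assms unfolding periodic_def by metis
  qed
  then show "partial_derivative a f (y + (\<chi> a. of_int (k $ a))) = partial_derivative a f y"
    by (simp add: partial_derivative_def)
qed

text \<open>The translated cube is cut at the hyperplane where coordinate \<open>a\<close> equals 1.
  The part beyond it moves back by one period and fills the slab of width \<open>t\<close> that the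
  translation vacated.\<close>

lemma integral_periodic_shift:
  fixes f :: "real^'n \<Rightarrow> real"
  assumes cont: "continuous_on UNIV f" and per: "periodic f" and t: "0 \<le> t" "t \<le> 1"
  shows "integral (cbox 0 1) (\<lambda>y. f (y + t *\<^sub>R axis a 1)) = integral (cbox 0 1) f"
proof -
  define e :: "real^'n" where "e = axis a 1"
  have e: "e \<in> Basis" by (simp add: e_def)
  have e_nth: "e $ b = (if b = a then 1 else 0)" for b by (simp add: e_def axis_def)
  have ip: "x \<bullet> e = x $ a" for x by (simp add: e_def inner_axis)
  have le: "cbox c d \<inter> {x. x \<bullet> e \<le> r} = cbox c d'"
    if "d' = (\<chi> b. if b = a then min (d $ a) r else d $ b)" for c d d' r
    using interval_split_cart(1)[where a=c and b=d and k=a and c=r] that by (simp add: ip interval_cbox_cart)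
  have ge: "cbox c d \<inter> {x. x \<bullet> e \<ge> r} = cbox c' d"
    if "c' = (\<chi> b. if b = a then max (c $ a) r else c $ b)" for c c' d r
    using interval_split_cart(2)[where a=c and b=d and k=a and c=r] that by (simp add: ip interval_cbox_cart)
  have int: "f integrable_on cbox c d" for c d
    by (rule integrable_continuous) (rule continuous_on_subset[OF cont], simp)
  have "integral (cbox 0 1) (\<lambda>y. f (y + t *\<^sub>R e)) = integral (cbox (t *\<^sub>R e) (1 + t *\<^sub>R e)) f"
    using integral_shift_cbox_plus[of 0 1 f "t *\<^sub>R e"] by (simp add: o_def add.commute)
  also have "\<dots> = integral (cbox (t *\<^sub>R e) (1 + t *\<^sub>R e) \<inter> {x. x \<bullet> e \<le> 1}) f
      + integral (cbox (t *\<^sub>R e) (1 + t *\<^sub>R e) \<inter> {x. x \<bullet> e \<ge> 1}) f"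
    by (rule integral_split[OF int e])
  also have "cbox (t *\<^sub>R e) (1 + t *\<^sub>R e) \<inter> {x. x \<bullet> e \<le> 1} = cbox (t *\<^sub>R e) 1"
    using t by (intro le) (simp add: vec_eq_iff e_nth)
  also have "cbox (t *\<^sub>R e) (1 + t *\<^sub>R e) \<inter> {x. x \<bullet> e \<ge> 1} = cbox (0 + e) ((1 + (t - 1) *\<^sub>R e) + e)"
  proof -
    have "1 + (t - 1) *\<^sub>R e + e = 1 + t *\<^sub>R e" by (simp add: algebra_simps)
    then show ?thesis using t by (simp only:) (intro ge, simp add: vec_eq_iff e_nth)
  qed
  also have "integral (cbox (0 + e) ((1 + (t - 1) *\<^sub>R e) + e)) f = integral (cbox 0 (1 + (t - 1) *\<^sub>R e)) f"
  proof -
    have "f \<circ> (+) e = f" using periodic_axis[OF per] by (auto simp: fun_eq_iff e_def add.commute)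
    then show ?thesis using integral_shift_cbox_plus[of 0 "1 + (t - 1) *\<^sub>R e" f e] by simp
  qed
  also have "integral (cbox (t *\<^sub>R e) 1) f + integral (cbox 0 (1 + (t - 1) *\<^sub>R e)) f = integral (cbox 0 1) f"
  proof -
    have "integral (cbox 0 1) f = integral (cbox 0 1 \<inter> {x. x \<bullet> e \<le> t}) f
      + integral (cbox 0 1 \<inter> {x. x \<bullet> e \<ge> t}) f"
      by (rule integral_split[OF int e])
    also have "cbox 0 1 \<inter> {x. x \<bullet> e \<le> t} = cbox 0 (1 + (t - 1) *\<^sub>R e)"
      using t by (intro le) (simp add: vec_eq_iff e_nth)
    also have "cbox 0 1 \<inter> {x. x \<bullet> e \<ge> t} = cbox (t *\<^sub>R e) 1"
      using t by (intro ge) (simp add: vec_eq_iff e_nth)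
    finally show ?thesis by simp
  qed
  finally show ?thesis by (simp add: e_def)
qed

text \<open>Integrals over translates in the direction \<open>a\<close> do not depend on
  \<open>t\<close>; differentiation under the integral sign at \<open>t = 0\<close> gives the claim
  with no boundary terms to match.\<close>

lemma integral_partial_derivative_periodic:
  fixes f :: "real^'n \<Rightarrow> real"
  assumes f: "\<And>y. f differentiable at y" "periodic f" and cont: "continuous_on UNIV (partial_derivative a f)"
  shows "integral (cbox 0 1) (partial_derivative a f) = 0"
proof -
  let ?h = "\<lambda>t. integral (cbox 0 1) (\<lambda>y. f (y + t *\<^sub>R axis a 1))"
  have cont_f: "continuous_on X f" for X
    using f(1) by (simp add: differentiable_imp_continuous_within continuous_at_imp_continuous_on)
  \<comment> \<open>One-sided at 0, because translation invariance is available for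
    \<open>0 \<le> t\<close> and \<open>t \<le> 1\<close>; derivatives within a nondegenerate
    interval are still unique.\<close>
  have "(?h has_field_derivative integral (cbox 0 1) (\<lambda>y. partial_derivative a f (y + 0 *\<^sub>R axis a 1))) (at 0 within {0..1})"
  proof (rule leibniz_rule_field_derivative)
    fix t y
    have "((\<lambda>t. f (y + t *\<^sub>R axis a 1)) has_vector_derivative partial_derivative a f (y + t *\<^sub>R axis a 1)) (at t)"
      using f(1) by (rule has_vector_derivative_partial)
    then show "((\<lambda>t. f (y + t *\<^sub>R axis a 1)) has_field_derivative partial_derivative a f (y + t *\<^sub>R axis a 1)) (at t within {0..1})"
      by (simp add: has_real_derivative_iff_has_vector_derivative has_vector_derivative_at_within)
  next
    fix t
    show "(\<lambda>y. f (y + t *\<^sub>R axis a 1)) integrable_on cbox 0 1"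
      by (intro integrable_continuous continuous_on_compose2[OF cont_f[of UNIV]] continuous_intros) auto
    show "continuous_on ({0..1} \<times> cbox 0 1) (\<lambda>(t, y). partial_derivative a f (y + t *\<^sub>R axis a 1))"
      unfolding split_beta
      by (intro continuous_on_compose2[OF cont] continuous_intros) auto
  qed auto
  then have 1: "(?h has_vector_derivative integral (cbox 0 1) (partial_derivative a f)) (at 0 within cbox 0 1)"
    by (simp add: has_real_derivative_iff_has_vector_derivative)
  have 2: "(?h has_vector_derivative 0) (at 0 within cbox 0 1)"
    by (rule has_vector_derivative_transform[where f = "\<lambda>_. integral (cbox 0 1) f"])
      (auto intro!: integral_periodic_shift cont_f f(2))
  show ?thesis
    using vector_derivative_unique_within_closed_interval[OF _ _ 1 2] by simp
qed

lemma integral_by_parts_periodic: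
  fixes f g :: "real^'n \<Rightarrow> real"
  assumes f: "smooth f" "periodic f" and g: "smooth g" "periodic g"
  shows "integral (cbox 0 1) (\<lambda>y. f y * partial_derivative a g y)
    = - integral (cbox 0 1) (\<lambda>y. partial_derivative a f y * g y)"
proof -
  have d: "(\<lambda>y. f y * g y) differentiable at y" for y
    using f g by (intro differentiable_mult smooth_differentiable)
  have pd: "partial_derivative a (\<lambda>y. f y * g y) = (\<lambda>y. f y * partial_derivative a g y + partial_derivative a f y * g y)"
  proof
    fix y
    obtain f' g' where f': "(f has_derivative f') (at y)" and g': "(g has_derivative g') (at y)"
      using smooth_differentiable f(1) g(1) unfolding differentiable_def by metis
    show "partial_derivative a (\<lambda>y. f y * g y) y = f y * partial_derivative a g y + partial_derivative a f y * g y"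
      unfolding partial_derivative_eq[OF f'] partial_derivative_eq[OF g']
      by (rule partial_derivative_eq[OF has_derivative_mult[OF f' g']])
  qed
  have cont: "continuous_on X f" "continuous_on X g" "continuous_on X (partial_derivative a f)"
    "continuous_on X (partial_derivative a g)" for X
    using f g by (auto intro: smooth_continuous_on smooth_partial_derivative)
  have "integral (cbox 0 1) (\<lambda>y. f y * partial_derivative a g y + partial_derivative a f y * g y) = 0"
    unfolding pd[symmetric]
    using f g by (intro integral_partial_derivative_periodic d) (auto simp: periodic_def pd intro!: continuous_intros cont)
  moreover have "integral (cbox 0 1) (\<lambda>y. f y * partial_derivative a g y + partial_derivative a f y * g y)
    = integral (cbox 0 1) (\<lambda>y. f y * partial_derivative a g y) + integral (cbox 0 1) (\<lambda>y. partial_derivative a f y * g y)"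
    by (intro integral_add integrable_continuous continuous_intros cont)
  ultimately show ?thesis by simp
qed

lemma integral_square_eq_0:
  fixes f :: "real^'n \<Rightarrow> real"
  assumes cont: "continuous_on UNIV f" and per: "periodic f" and "integral (cbox 0 1) (\<lambda>y. f y * f y) = 0"
  shows "f y = 0"
proof -
  have zero: "f x * f x = 0" if "x \<in> cbox 0 1" for x
  proof (rule has_integral_0_cbox_imp_0[where f = "\<lambda>x. f x * f x", OF _ _ _ _ that])
    show c: "continuous_on (cbox 0 1) (\<lambda>x. f x * f x)"
      by (intro continuous_intros continuous_on_subset[OF cont]) auto
    show "((\<lambda>x. f x * f x) has_integral 0) (cbox 0 1)"
      using integrable_integral[OF integrable_continuous[OF c]] assms(3) by simp
    show "box 0 (1 :: real^'n) \<noteq> {}"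
      by (simp add: box_ne_empty inner_axis Basis_vec_def)
  qed simp
  \<comment> \<open>The integer translation that reduces each coordinate of \<open>y\<close> to its
    fractional part.\<close>
  define k :: "int^'n" where "k = (\<chi> a. - \<lfloor>y $ a\<rfloor>)"
  have "y + (\<chi> a. of_int (k $ a)) \<in> cbox 0 1"
    by (auto simp: mem_box_cart k_def) linarith+
  then have "f (y + (\<chi> a. of_int (k $ a))) = 0" using zero by simp
  then show ?thesis using per unfolding periodic_def by simp
qed

section \<open>The first variation of the energy\<close>

lemma continuous_on_matmul:
  fixes f g :: "'a::topological_space \<Rightarrow> complex^'n^'n"
  shows "continuous_on S f \<Longrightarrow> continuous_on S g \<Longrightarrow> continuous_on S (\<lambda>p. f p ** g p)"
  by (rule bounded_bilinear.continuous_on[OF bounded_bilinear_matrix_mult])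

lemma continuous_on_cnj_matrix:
  fixes f :: "'a::topological_space \<Rightarrow> complex^'n^'n"
  shows "continuous_on S f \<Longrightarrow> continuous_on S (\<lambda>p. map_matrix cnj (f p))"
  by (rule bounded_linear.continuous_on[OF bounded_linear_cnj_matrix])

lemma continuous_on_trace:
  fixes f :: "'a::topological_space \<Rightarrow> complex^'n^'n"
  shows "continuous_on S f \<Longrightarrow> continuous_on S (\<lambda>p. trace (f p))"
  by (rule bounded_linear.continuous_on[OF bounded_linear_trace])

lemma continuous_on_det:
  fixes f :: "'a::topological_space \<Rightarrow> complex^'n^'n"
  assumes "continuous_on S f"
  shows "continuous_on S (\<lambda>p. det (f p))"
  unfolding det_def
  by (intro continuous_on_sum continuous_on_mult continuous_on_const continuous_on_prod
      bounded_linear.continuous_on[OF bounded_linear_compose[OF bounded_linear_vec_nth bounded_linear_vec_nth]] assms)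

text \<open>The inverse is again treated as a Sylvester solution with right side
  \<open>mat 1 + mat 1\<close>.\<close>

lemma continuous_on_posdef_inverse:
  fixes T :: "'a::topological_space \<Rightarrow> complex^'n^'n"
  assumes "continuous_on S T" "\<And>p. p \<in> S \<Longrightarrow> posdef (T p)"
  shows "continuous_on S (\<lambda>p. matrix_inv (T p))"
  unfolding continuous_on_def
proof
  fix x assume x: "x \<in> S"
  have eq: "T p ** matrix_inv (T p) + matrix_inv (T p) ** T p = mat 1 + mat 1" if "p \<in> S" for p
    using posdef_inverse[OF assms(2)[OF that]] by simp
  show "((\<lambda>p. matrix_inv (T p)) \<longlongrightarrow> matrix_inv (T x)) (at x within S)"
  proof (rule tendsto_sylvester)
    show "(T \<longlongrightarrow> T x) (at x within S)" using assms(1) x by (simp add: continuous_on_def)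
    show "\<forall>\<^sub>F p in at x within S. posdef (T p) \<and> T p ** matrix_inv (T p) + matrix_inv (T p) ** T p = mat 1 + mat 1"
      unfolding eventually_at_filter by (rule always_eventually) (simp add: assms eq)
  qed (use x assms eq in auto)
qed

lemma continuous_on_higgs_defect:
  fixes X H :: "'a::topological_space \<Rightarrow> complex^'n^'n"
  assumes "continuous_on S X" "continuous_on S H" "\<And>p. p \<in> S \<Longrightarrow> posdef (H p)"
  shows "continuous_on S (\<lambda>p. higgs_defect (X p) (H p))"
  unfolding higgs_defect_def higgs_factor_def
  by (intro continuous_on_diff continuous_on_const continuous_on_matmul continuous_on_cnj_matrix
      continuous_on_posdef_sqrt assms)

lemma admissible_higgs_dataD:
  assumes "admissible_higgs_data X H"
  shows "posdef H" "posdef (higgs_defect X H)" "posdef (higgs_root X H)"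
  using admissible_higgs_data.T[OF assms] assms
  by (auto simp: admissible_higgs_data_def admissible_higgs_data_axioms_def higgs_data_def)

lemma continuous_on_higgs_root:
  fixes X H :: "'a::topological_space \<Rightarrow> complex^'n^'n"
  assumes "continuous_on S X" "continuous_on S H" "\<And>p. p \<in> S \<Longrightarrow> admissible_higgs_data (X p) (H p)"
  shows "continuous_on S (\<lambda>p. higgs_root (X p) (H p))"
  unfolding higgs_root_def
  by (intro continuous_on_posdef_sqrt continuous_on_higgs_defect assms admissible_higgs_dataD[OF assms(3)])

lemma continuous_on_moment_matrix:
  fixes X H :: "'a::topological_space \<Rightarrow> complex^'n^'n"
  assumes "continuous_on S X" "continuous_on S H" "\<And>p. p \<in> S \<Longrightarrow> admissible_higgs_data (X p) (H p)"
  shows "continuous_on S (\<lambda>p. moment_matrix (X p) (H p))"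
  unfolding moment_matrix_def
  by (intro continuous_on_matmul continuous_on_posdef_inverse continuous_on_posdef_sqrt
      continuous_on_higgs_root assms posdef_sqrt admissible_higgs_dataD[OF assms(3)])

lemma continuous_on_ln_det:
  fixes A :: "'a::topological_space \<Rightarrow> complex^'n^'n"
  assumes "continuous_on S A" "\<And>p. p \<in> S \<Longrightarrow> posdef (A p)"
  shows "continuous_on S (\<lambda>p. ln (Re (det (A p))))"
proof (rule continuous_on_ln)
  show "continuous_on S (\<lambda>p. Re (det (A p)))"
    by (intro continuous_on_Re continuous_on_det assms)
  show "\<forall>p\<in>S. Re (det (A p)) \<noteq> 0" using posdef_det(2)[OF assms(2)] by force
qed

section \<open>Hessians, symplectic potentials and the energy as a single integral\<close>

lemma partial_derivative_cmult:
  fixes f :: "real^'n \<Rightarrow> real"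
  shows "f differentiable at y \<Longrightarrow> partial_derivative a (\<lambda>y. c * f y) y = c * partial_derivative a f y"
  by (rule partial_derivative_bounded_linear[OF bounded_linear_mult_right])

lemma smooth_cmult: "smooth f \<Longrightarrow> smooth (\<lambda>y. c * f y :: real)"
  by (rule smooth_bounded_linear[OF bounded_linear_mult_right])

lemma complex_hessian_add_cmult:
  fixes u \<phi> :: "real^'n \<Rightarrow> real"
  assumes u: "smooth u" and \<phi>: "smooth \<phi>"
  shows "complex_hessian (\<lambda>y. u y + t * \<phi> y) y = complex_hessian u y + t *\<^sub>R complex_hessian \<phi> y"
proof -
  have step: "partial_derivative a (\<lambda>y. f y + t * g y) = (\<lambda>y. partial_derivative a f y + t * partial_derivative a g y)"
    if "smooth f" "smooth g" for f g :: "real^'n \<Rightarrow> real" and a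
    using that
    by (simp add: fun_eq_iff partial_derivative_add partial_derivative_cmult smooth_differentiable smooth_cmult)
  show ?thesis
    by (simp add: vec_eq_iff complex_hessian_def hessian_def step u \<phi> smooth_partial_derivative)
      (simp add: scaleR_conv_of_real)
qed

text \<open>\<open>smooth\<close> refers to the matrix-valued map as a whole, so the entries are
  reassembled along the matrix units \<open>E a b\<close>.\<close>

lemma smooth_complex_hessian:
  fixes u :: "real^'n \<Rightarrow> real"
  assumes "smooth u"
  shows "smooth (complex_hessian u)"
proof -
  define E :: "'n \<Rightarrow> 'n \<Rightarrow> complex^'n^'n" where "E a b = (\<chi> i j. if i = a \<and> j = b then 1 else 0)" for a b
  have "complex_hessian u y = (\<Sum>a\<in>UNIV. \<Sum>b\<in>UNIV. partial_derivative b (partial_derivative a u) y *\<^sub>R E a b)" for y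
  proof -
    have "(\<Sum>a\<in>UNIV. \<Sum>b\<in>UNIV. partial_derivative b (partial_derivative a u) y *\<^sub>R E a b) $ i $ j =
        complex_of_real (partial_derivative j (partial_derivative i u) y)" for i j
    proof -
      have "(\<Sum>a\<in>UNIV. \<Sum>b\<in>UNIV. partial_derivative b (partial_derivative a u) y *\<^sub>R E a b) $ i $ j =
        (\<Sum>a\<in>UNIV. \<Sum>b\<in>UNIV. if b = j then (if a = i then complex_of_real (partial_derivative b (partial_derivative a u) y) else 0) else 0)"
        unfolding sum_component by (intro sum.cong refl) (auto simp: E_def scaleR_conv_of_real[where 'a = complex])
      then show ?thesis by simp
    qed
    then show ?thesis by (simp add: vec_eq_iff complex_hessian_def hessian_def)
  qed
  then have "complex_hessian u = (\<lambda>y. \<Sum>a\<in>UNIV. \<Sum>b\<in>UNIV. partial_derivative b (partial_derivative a u) y *\<^sub>R E a b)"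
    by blast
  moreover have "smooth \<dots>"
    by (intro smooth_sum smooth_bounded_linear[OF bounded_linear_scaleR_left] smooth_partial_derivative assms)
  ultimately show ?thesis by simp
qed

lemma hermitian_complex_hessian:
  assumes "smooth u"
  shows "hermitian (complex_hessian u y)" "map_matrix cnj (complex_hessian u y) = complex_hessian u y"
  using mixed_partial_derivatives_commute[OF assms]
  by (auto simp: hermitian_def adjoint_matrix_def complex_hessian_def hessian_def vec_eq_iff)

text \<open>For a real matrix the real inner product has no cross terms between the real and
  imaginary parts of \<open>v\<close>.\<close>

lemma positive_complex_hessian:
  fixes u :: "real^'n \<Rightarrow> real"
  assumes "\<And>v. v \<noteq> 0 \<Longrightarrow> 0 < v \<bullet> (hessian u y *v v)"
  shows "positive_matrix (complex_hessian u y)"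
  unfolding positive_matrix_def
proof (intro allI impI)
  fix v :: "complex^'n" assume v: "v \<noteq> 0"
  let ?r = "(\<chi> i. Re (v $ i)) :: real^'n" and ?i = "(\<chi> i. Im (v $ i)) :: real^'n"
  have "v \<bullet> (complex_hessian u y *v v) = ?r \<bullet> (hessian u y *v ?r) + ?i \<bullet> (hessian u y *v ?i)"
    by (simp add: inner_vec_def inner_complex_def matrix_vector_mult_def complex_hessian_def sum.distrib)
  moreover have "?r \<noteq> 0 \<or> ?i \<noteq> 0" using v by (auto simp: vec_eq_iff complex_eq_iff)
  moreover have "0 \<le> w \<bullet> (hessian u y *v w)" for w
    using assms[of w] by (cases "w = 0") auto
  ultimately show "0 < v \<bullet> (complex_hessian u y *v v)"
    using assms by (metis add_pos_nonneg add_nonneg_pos)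
qed

lemma Re_det_complex_hessian: "Re (det (complex_hessian u y)) = det (hessian u y)"
proof -
  have "det (complex_hessian u y) = complex_of_real (det (hessian u y))"
    by (simp add: det_def complex_hessian_def)
  then show ?thesis by simp
qed

text \<open>Only the Hessian of \<open>u\<close> is claimed to be periodic: the quadratic part of
  \<open>u\<close> is not, but it contributes the constant identity matrix.\<close>

lemma symplectic_potential_smooth:
  assumes "symplectic_potential u"
  shows "smooth u" "periodic (complex_hessian u)"
proof -
  obtain \<phi> where \<phi>: "smooth \<phi>" "periodic \<phi>" and u: "u = (\<lambda>y. (norm y)\<^sup>2 / 2 + \<phi> y)"
    using assms by (auto simp: symplectic_potential_def)
  show "smooth u" unfolding u by (intro smooth_add smooth_half_norm_sq \<phi>)
  have pd1: "partial_derivative a u = (\<lambda>y. y $ a + partial_derivative a \<phi> y)" for a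
    unfolding u using \<phi>
    by (simp add: fun_eq_iff partial_derivative_add smooth_differentiable smooth_half_norm_sq partial_derivative_half_norm_sq)
  have pd2: "partial_derivative b (partial_derivative a u) y = (if a = b then 1 else 0) + partial_derivative b (partial_derivative a \<phi>) y" for a b y
    unfolding pd1 using \<phi>
    by (simp add: partial_derivative_add smooth_differentiable smooth_component smooth_partial_derivative partial_derivative_component)
  have "periodic (partial_derivative b (partial_derivative a \<phi>))" for a b
    by (intro periodic_partial_derivative \<phi>)
  then show "periodic (complex_hessian u)"
    by (simp add: periodic_def complex_hessian_def hessian_def pd2 vec_eq_iff)
qed

lemma admissible_potentials_data:
  assumes "higgs_tensor \<xi>" "u \<in> admissible_potentials \<xi>"
  shows "admissible_higgs_data (\<xi> y) (complex_hessian u y)"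
proof -
  have u: "symplectic_potential u" "spectral_radius (higgs_endomorphism \<xi> u y) < 1"
    using assms(2) by (auto simp: admissible_potentials_def)
  have "positive_matrix (complex_hessian u y)"
    using u(1) by (intro positive_complex_hessian) (auto simp: symplectic_potential_def)
  then interpret higgs_data "\<xi> y" "complex_hessian u y"
    using assms(1) hermitian_complex_hessian[OF symplectic_potential_smooth(1)[OF u(1)]]
    by unfold_locales (auto simp: higgs_tensor_def posdef_def)
  show ?thesis
    by unfold_locales (rule defect_posdef_if_spectral_radius, use u(2) in \<open>simp add: higgs_endomorphism_def\<close>)
qed

text \<open>Admissibility is asked on the unit cube, where the integrals live; this is what is
  established for perturbed potentials. Continuity of the integrands allows passing from Lebesgue to
  gauge integrals and merging the two terms.\<close>

lemma periodic_HK_energy_eq: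
  assumes \<xi>: "smooth \<xi>" and v: "smooth v"
    and adm: "\<And>y. y \<in> cbox 0 1 \<Longrightarrow> admissible_higgs_data (\<xi> y) (complex_hessian v y)"
  shows "periodic_HK_energy v \<xi> = integral (cbox 0 1) (\<lambda>y. energy_density (\<xi> y) (complex_hessian v y))"
proof -
  let ?C = "cbox (0 :: real^'a) 1" and ?T = "\<lambda>y. higgs_root (\<xi> y) (complex_hessian v y)"
  let ?ld = "\<lambda>y. ln (det (hessian v y))"
  let ?hk = "\<lambda>y. real CARD('a) - Re (trace (?T y)) + ln (Re (det (mat 1 + ?T y)))"
  have cont: "continuous_on ?C \<xi>" "continuous_on ?C (complex_hessian v)"
    using \<xi> v by (auto intro: smooth_continuous_on smooth_complex_hessian)
  have c1: "continuous_on ?C ?ld"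
    unfolding Re_det_complex_hessian[symmetric]
    by (intro continuous_on_ln_det cont admissible_higgs_dataD(1)[OF adm])
  have c2: "continuous_on ?C ?hk"
    by (intro continuous_on_add continuous_on_diff continuous_on_const continuous_on_Re continuous_on_trace
        continuous_on_ln_det continuous_on_higgs_root cont adm posdef_plus_mat1 admissible_higgs_dataD(3)[OF adm])
  have lint: "(LINT y:?C|lborel. f y) = integral ?C f" if "continuous_on ?C f" for f :: "real^'a \<Rightarrow> real"
    using borel_integrable_compact[OF compact_cbox that]
    by (intro set_borel_integral_eq_integral) (simp add: set_integrable_def)
  have "(LINT y:?C|lborel. hk_density (higgs_endomorphism \<xi> v y)) = (LINT y:?C|lborel. ?hk y)"
    by (rule set_lebesgue_integral_cong)
      (auto simp: higgs_endomorphism_def intro!: admissible_higgs_data.hk_density_eq adm)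
  then have "periodic_HK_energy v \<xi> = (1/2) * (integral ?C ?hk - integral ?C ?ld)"
    by (simp add: periodic_HK_energy_def lint c1 c2)
  also have "integral ?C ?hk - integral ?C ?ld = integral ?C (\<lambda>y. ?hk y - ?ld y)"
    using c1 c2 by (intro integral_diff[symmetric] integrable_continuous)
  also have "(1/2) * \<dots> = integral ?C (\<lambda>y. (1/2) * (?hk y - ?ld y))"
    by simp
  also have "(\<lambda>y. (1/2) * (?hk y - ?ld y)) = (\<lambda>y. energy_density (\<xi> y) (complex_hessian v y))"
    by (simp add: energy_density_def Re_det_complex_hessian fun_eq_iff)
  finally show ?thesis .
qed

text \<open>Positivity is open jointly in \<open>t\<close> and \<open>y\<close> and holds for
  \<open>t = 0\<close> over the whole cube. Compactness of the cube gives, by the tube lemma, an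
  \<open>\<epsilon>\<close> that does not depend on \<open>y\<close>.\<close>

lemma admissible_near_0:
  assumes \<xi>: "higgs_tensor \<xi>" and u: "u \<in> admissible_potentials \<xi>" and \<phi>: "smooth \<phi>"
  obtains \<epsilon> where "0 < \<epsilon>" "\<And>t y. t \<in> ball 0 \<epsilon> \<Longrightarrow> y \<in> cbox 0 1 \<Longrightarrow>
    admissible_higgs_data (\<xi> y) (complex_hessian u y + t *\<^sub>R complex_hessian \<phi> y)"
proof -
  have su: "smooth u" using u symplectic_potential_smooth by (auto simp: admissible_potentials_def)
  have s\<xi>: "smooth \<xi>" "\<And>y. transpose (\<xi> y) = \<xi> y" using \<xi> by (auto simp: higgs_tensor_def)
  define H where "H p = complex_hessian u (snd p) + fst p *\<^sub>R complex_hessian \<phi> (snd p)" for p :: "real \<times> (real^'a)"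
  have contH: "continuous_on S H" for S
    unfolding H_def
    by (intro continuous_intros continuous_on_compose2[OF smooth_continuous_on[OF smooth_complex_hessian[OF su]]]
        continuous_on_compose2[OF smooth_continuous_on[OF smooth_complex_hessian[OF \<phi>]]]) auto
  have cont\<xi>: "continuous_on S (\<lambda>p. \<xi> (snd p))" for S :: "(real \<times> (real^'a)) set"
    by (intro continuous_on_compose2[OF smooth_continuous_on[OF s\<xi>(1)]] continuous_intros) auto
  have hermH: "hermitian (H p)" "map_matrix cnj (H p) = H p" for p
    unfolding H_def complex_hessian_add_cmult[OF su \<phi>, symmetric]
    by (intro hermitian_complex_hessian smooth_add su smooth_cmult \<phi>)+
  define W1 where "W1 = H -` {A. positive_matrix A}"
  have W1: "open W1" unfolding W1_def by (rule open_vimage[OF open_positive contH])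
  have data: "higgs_data (\<xi> (snd p)) (H p)" if "p \<in> W1" for p
    using that hermH s\<xi> by unfold_locales (auto simp: W1_def posdef_def)
  \<comment> \<open>The preimage is taken inside \<open>W1\<close> because continuity of the defect
    is available only where the Hessian is positive definite and \<open>posdef_sqrt\<close> is a
    genuine root.\<close>
  define W where "W = W1 \<inter> (\<lambda>p. higgs_defect (\<xi> (snd p)) (H p)) -` {A. positive_matrix A}"
  have "open W"
    unfolding W_def
    by (rule continuous_open_preimage[OF _ W1 open_positive])
      (intro continuous_on_higgs_defect cont\<xi> contH, use data in \<open>auto simp: higgs_data_def\<close>)
  moreover have "{0} \<times> cbox 0 1 \<subseteq> W"
    using admissible_higgs_dataD[OF admissible_potentials_data[OF \<xi> u]]
    by (auto simp: W_def W1_def H_def posdef_def)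
  ultimately obtain X0 where X0: "(0::real) \<in> X0" "open X0" "X0 \<times> cbox 0 1 \<subseteq> W"
    using Elementary_Topology.tube_lemma[OF compact_cbox] by metis
  obtain \<epsilon> where \<epsilon>: "0 < \<epsilon>" "ball 0 \<epsilon> \<subseteq> X0" using X0 open_contains_ball by metis
  have "admissible_higgs_data (\<xi> y) (complex_hessian u y + t *\<^sub>R complex_hessian \<phi> y)"
    if "t \<in> ball 0 \<epsilon>" "y \<in> cbox 0 1" for t y
  proof -
    have p: "(t, y) \<in> W" using that \<epsilon> X0 by auto
    then interpret higgs_data "\<xi> y" "H (t, y)" using data[of "(t, y)"] by (simp add: W_def)
    have "admissible_higgs_data (\<xi> y) (H (t, y))"
      using p hermitian_defect by unfold_locales (simp add: W_def posdef_def)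
    then show ?thesis by (simp add: H_def)
  qed
  with \<epsilon>(1) show ?thesis by (rule that)
qed

text \<open>Differentiation under the integral sign, justified by joint continuity of the pointwise
  derivative on \<open>ball 0 \<epsilon> \<times> cbox 0 1\<close>.\<close>

lemma first_variation:
  assumes \<xi>: "higgs_tensor \<xi>" and u: "u \<in> admissible_potentials \<xi>" and \<phi>: "smooth \<phi>"
  shows "((\<lambda>t. periodic_HK_energy (\<lambda>y. u y + t * \<phi> y) \<xi>) has_real_derivative
    integral (cbox 0 1) (\<lambda>y. - Re (trace (moment_matrix (\<xi> y) (complex_hessian u y) ** complex_hessian \<phi> y)) / 2)) (at 0)"
proof -
  let ?H = "\<lambda>t y. complex_hessian u y + t *\<^sub>R complex_hessian \<phi> y"
  let ?D = "\<lambda>t y. - Re (trace (moment_matrix (\<xi> y) (?H t y) ** complex_hessian \<phi> y)) / 2"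
  have su: "smooth u" using u symplectic_potential_smooth by (auto simp: admissible_potentials_def)
  have s\<xi>: "smooth \<xi>" using \<xi> by (auto simp: higgs_tensor_def)
  obtain \<epsilon> where \<epsilon>: "0 < \<epsilon>" and adm: "\<And>t y. t \<in> ball 0 \<epsilon> \<Longrightarrow> y \<in> cbox 0 1 \<Longrightarrow> admissible_higgs_data (\<xi> y) (?H t y)"
    using admissible_near_0[OF assms] by blast
  note contE = smooth_continuous_on[OF smooth_complex_hessian[OF su]] smooth_continuous_on[OF smooth_complex_hessian[OF \<phi>]]
    smooth_continuous_on[OF s\<xi>]
  have "((\<lambda>t. integral (cbox 0 1) (\<lambda>y. energy_density (\<xi> y) (?H t y))) has_field_derivative
      integral (cbox 0 1) (?D 0)) (at 0 within ball 0 \<epsilon>)"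
  proof (rule leibniz_rule_field_derivative)
    fix t :: real and y :: "real^'a" assume t: "t \<in> ball 0 \<epsilon>" and y: "y \<in> cbox 0 1"
    have "\<forall>\<^sub>F s in nhds t. s \<in> ball 0 \<epsilon>" using t by (intro eventually_nhds_in_open) auto
    then have ev: "\<forall>\<^sub>F s in nhds t. admissible_higgs_data (\<xi> y) (?H s y)"
      by eventually_elim (rule adm[OF _ y])
    have "((\<lambda>s. ?H s y) has_vector_derivative complex_hessian \<phi> y) (at t)"
      by (auto intro!: derivative_eq_intros)
    from energy_density_has_derivative[OF this ev hermitian_complex_hessian[OF \<phi>]]
    show "((\<lambda>s. energy_density (\<xi> y) (?H s y)) has_field_derivative ?D t y) (at t within ball 0 \<epsilon>)"
      by (rule has_field_derivative_at_within)
  next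
    fix t :: real assume t: "t \<in> ball 0 \<epsilon>"
    have cH: "continuous_on (cbox 0 1) (\<lambda>y. ?H t y)" by (intro continuous_intros contE)
    have "continuous_on (cbox 0 1) (\<lambda>y. energy_density (\<xi> y) (?H t y))"
      unfolding energy_density_def
      by (intro continuous_on_divide continuous_on_add continuous_on_diff continuous_on_const continuous_on_Re continuous_on_trace
        continuous_on_ln_det continuous_on_higgs_root cH contE adm[OF t] posdef_plus_mat1 admissible_higgs_dataD[OF adm[OF t]]) auto
    then show "(\<lambda>y. energy_density (\<xi> y) (?H t y)) integrable_on cbox 0 1"
      by (rule integrable_continuous)
  next
    have cont2: "continuous_on (ball 0 \<epsilon> \<times> cbox 0 1) (\<lambda>p. f (snd p))" if "continuous_on UNIV f" for f :: "real^'a \<Rightarrow> complex^'a^'a"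
      by (intro continuous_on_compose2[OF that] continuous_intros) auto
    show "continuous_on (ball 0 \<epsilon> \<times> cbox 0 1) (\<lambda>(t, y). ?D t y)"
      unfolding split_beta
      by (intro continuous_on_divide continuous_on_minus continuous_on_Re continuous_on_trace continuous_on_const continuous_on_matmul
          continuous_on_moment_matrix continuous_on_add continuous_on_scaleR continuous_on_fst continuous_on_id cont2 contE) (auto intro: adm)
  qed (use \<epsilon> in auto)
  then have "((\<lambda>t. integral (cbox 0 1) (\<lambda>y. energy_density (\<xi> y) (?H t y))) has_field_derivative
      integral (cbox 0 1) (?D 0)) (at 0)"
    using \<epsilon> by (simp add: at_within_open[of 0 "ball 0 \<epsilon>"])
  \<comment> \<open>For \<open>t\<close> in the ball the energy is the integral of
    \<open>energy_density\<close>; agreement near 0 suffices for the derivative there.\<close>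
  then have "((\<lambda>t. periodic_HK_energy (\<lambda>y. u y + t * \<phi> y) \<xi>) has_field_derivative integral (cbox 0 1) (?D 0)) (at 0)"
  proof (rule has_field_derivative_transform_within_open)
    fix t :: real assume t: "t \<in> ball 0 \<epsilon>"
    have "periodic_HK_energy (\<lambda>y. u y + t * \<phi> y) \<xi> =
        integral (cbox 0 1) (\<lambda>y. energy_density (\<xi> y) (complex_hessian (\<lambda>y. u y + t * \<phi> y) y))"
      by (rule periodic_HK_energy_eq[OF s\<xi>])
        (auto intro!: smooth_add su smooth_cmult \<phi> simp: complex_hessian_add_cmult[OF su \<phi>] adm[OF t])
    then show "integral (cbox 0 1) (\<lambda>y. energy_density (\<xi> y) (?H t y)) = periodic_HK_energy (\<lambda>y. u y + t * \<phi> y) \<xi>"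
      by (simp add: complex_hessian_add_cmult[OF su \<phi>])
  qed (use \<epsilon> in auto)
  then show ?thesis by simp
qed

section \<open>The moment map tensor and its double divergence\<close>

lemma moment_map_tensor_eq:
  assumes "higgs_tensor \<xi>" "u \<in> admissible_potentials \<xi>"
  shows "moment_map_tensor \<xi> u y = moment_matrix (\<xi> y) (complex_hessian u y)"
proof -
  interpret admissible_higgs_data "\<xi> y" "complex_hessian u y"
    by (rule admissible_potentials_data[OF assms])
  show ?thesis using moment_matrix_eq by (simp add: moment_map_tensor_def higgs_endomorphism_def)
qed

text \<open>Smoothness needs the form with \<open>R\<close> and \<open>T\<close>, where every
  operation preserves it. Periodicity is read off the original formula, which is a pointwise
  expression in \<open>\<xi>\<close> and the Hessian.\<close>

lemma smooth_moment_map_tensor: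
  assumes \<xi>: "higgs_tensor \<xi>" and u: "u \<in> admissible_potentials \<xi>"
  shows "smooth (moment_map_tensor \<xi> u)" "periodic (moment_map_tensor \<xi> u)"
proof -
  have symp: "symplectic_potential u" using u by (simp add: admissible_potentials_def)
  note adm = admissible_higgs_dataD[OF admissible_potentials_data[OF \<xi> u]]
  have sH: "smooth (complex_hessian u)" using symp by (intro smooth_complex_hessian symplectic_potential_smooth)
  have sR: "smooth (\<lambda>y. posdef_sqrt (complex_hessian u y))" by (intro smooth_posdef_sqrt sH adm)
  have s\<xi>: "smooth \<xi>" using \<xi> by (simp add: higgs_tensor_def)
  have "smooth (\<lambda>y. higgs_factor (\<xi> y) (complex_hessian u y))"
    unfolding higgs_factor_def by (intro smooth_matrix_mult sR s\<xi>)
  then have "smooth (\<lambda>y. higgs_defect (\<xi> y) (complex_hessian u y))"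
    unfolding higgs_defect_def
    by (intro smooth_matrix_diff smooth_const smooth_matrix_mult smooth_bounded_linear[OF bounded_linear_cnj_matrix])
  then have sT: "smooth (\<lambda>y. higgs_root (\<xi> y) (complex_hessian u y))"
    unfolding higgs_root_def by (intro smooth_posdef_sqrt adm)
  have sRi: "smooth (\<lambda>y. matrix_inv (posdef_sqrt (complex_hessian u y)))"
    by (rule smooth_posdef_inverse[OF sR]) (auto simp: posdef_sqrt adm posdef_inverse)
  have "smooth (\<lambda>y. moment_matrix (\<xi> y) (complex_hessian u y))"
    unfolding moment_matrix_def by (intro smooth_matrix_mult sRi sT)
  then show "smooth (moment_map_tensor \<xi> u)" by (simp add: moment_map_tensor_eq[OF assms, abs_def])
  show "periodic (moment_map_tensor \<xi> u)"
    using symplectic_potential_smooth(2)[OF symp] \<xi>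
    by (simp add: periodic_def moment_map_tensor_def higgs_endomorphism_def higgs_tensor_def)
qed

text \<open>Taken of the real part so that it is real-valued and can be inserted as a variation of
  \<open>u\<close>.\<close>

definition moment_map_divergence :: "(real^'n \<Rightarrow> complex^'n^'n) \<Rightarrow> (real^'n \<Rightarrow> real) \<Rightarrow> real^'n \<Rightarrow> real" where
  "moment_map_divergence \<xi> u y = (\<Sum>a\<in>UNIV. \<Sum>b\<in>UNIV.
     partial_derivative b (partial_derivative a (\<lambda>z. Re (moment_map_tensor \<xi> u z $ a $ b))) y)"

lemma bounded_linear_Re_entry: "bounded_linear (\<lambda>A :: complex^'n^'m. Re (A $ i $ j))"
  by (intro bounded_linear_compose[OF bounded_linear_Re]
      bounded_linear_compose[OF bounded_linear_vec_nth bounded_linear_vec_nth])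

lemma bounded_linear_Im_entry: "bounded_linear (\<lambda>A :: complex^'n^'m. Im (A $ i $ j))"
  by (intro bounded_linear_compose[OF bounded_linear_Im]
      bounded_linear_compose[OF bounded_linear_vec_nth bounded_linear_vec_nth])

text \<open>The imaginary part of a Hermitian matrix is antisymmetric while mixed partial
  derivatives are symmetric. Exchanging the summation indices shows that its double divergence
  equals its own negative.\<close>

lemma real_moment_map_equation_iff:
  assumes \<xi>: "higgs_tensor \<xi>" and u: "u \<in> admissible_potentials \<xi>"
  shows "real_moment_map_equation \<xi> u \<longleftrightarrow> (\<forall>y. moment_map_divergence \<xi> u y = 0)"
proof -
  let ?G = "moment_map_tensor \<xi> u"
  let ?pd = "\<lambda>a b f y. partial_derivative b (partial_derivative a f) y"
  have sG: "smooth ?G" by (rule smooth_moment_map_tensor[OF assms])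
  have sG': "smooth (\<lambda>z. ?G z $ a $ b)" for a b
    by (rule smooth_bounded_linear[OF bounded_linear_compose[OF bounded_linear_vec_nth bounded_linear_vec_nth] sG])
  have lin: "?pd a b (\<lambda>z. L (f z)) y = L (?pd a b f y)"
    if "bounded_linear L" "smooth f" for L :: "complex \<Rightarrow> real" and f :: "real^'a \<Rightarrow> complex" and a b y
  proof -
    have step: "partial_derivative c (\<lambda>z. L (g z)) = (\<lambda>z. L (partial_derivative c g z))"
      if "smooth g" for c and g :: "real^'a \<Rightarrow> complex"
      using that \<open>bounded_linear L\<close> by (simp add: fun_eq_iff partial_derivative_bounded_linear smooth_differentiable)
    show ?thesis by (simp add: step that(2) smooth_partial_derivative)
  qed
  let ?Im = "\<lambda>a b z. Im (?G z $ a $ b)"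
  have herm: "?G z $ b $ a = cnj (?G z $ a $ b)" for z a b
  proof -
    have "hermitian (?G z)"
      unfolding moment_map_tensor_eq[OF assms]
      by (rule admissible_higgs_data.hermitian_moment_matrix[OF admissible_potentials_data[OF assms]])
    then show ?thesis by (auto simp: hermitian_def adjoint_matrix_def vec_eq_iff)
  qed
  have "(\<Sum>a\<in>UNIV. \<Sum>b\<in>UNIV. ?pd a b (?Im a b) y) = 0" for y
  proof -
    have "(\<Sum>a\<in>UNIV. \<Sum>b\<in>UNIV. ?pd a b (?Im a b) y) = (\<Sum>b\<in>UNIV. \<Sum>a\<in>UNIV. ?pd a b (?Im a b) y)"
      by (rule sum.swap)
    also have "\<dots> = (\<Sum>b\<in>UNIV. \<Sum>a\<in>UNIV. - ?pd b a (?Im b a) y)"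
    proof (intro sum.cong refl)
      fix a b
      have sIm: "smooth (?Im a b)" for a b by (rule smooth_bounded_linear[OF bounded_linear_Im_entry sG])
      have "?Im a b = (\<lambda>z. - 1 * ?Im b a z)" using herm[of _ a b] by (auto simp: fun_eq_iff)
      moreover have "partial_derivative c (\<lambda>z. - 1 * g z) = (\<lambda>z. - 1 * partial_derivative c g z)"
        if "smooth g" for c and g :: "real^'a \<Rightarrow> real"
        using that by (simp only: fun_eq_iff partial_derivative_cmult smooth_differentiable simp_thms)
      ultimately have "?pd a b (?Im a b) y = - 1 * ?pd a b (?Im b a) y"
        using sIm[of b a] by (simp only: smooth_partial_derivative)
      also have "?pd a b (?Im b a) y = ?pd b a (?Im b a) y"
        by (rule mixed_partial_derivatives_commute[OF sIm])
      finally show "?pd a b (?Im a b) y = - ?pd b a (?Im b a) y" by simp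
    qed
    finally show ?thesis by (simp add: sum_negf)
  qed
  then have "(\<Sum>a\<in>UNIV. \<Sum>b\<in>UNIV. ?pd a b (\<lambda>z. ?G z $ a $ b) y) = complex_of_real (moment_map_divergence \<xi> u y)" for y
    by (simp add: complex_eq_iff moment_map_divergence_def lin[OF bounded_linear_Re sG'] lin[OF bounded_linear_Im sG'])
  then show ?thesis by (simp add: real_moment_map_equation_def)
qed

lemma integral_moment_map_divergence:
  assumes \<xi>: "higgs_tensor \<xi>" and u: "u \<in> admissible_potentials \<xi>" and \<phi>: "smooth \<phi>" "periodic \<phi>"
  shows "integral (cbox 0 1) (\<lambda>y. - Re (trace (moment_matrix (\<xi> y) (complex_hessian u y) ** complex_hessian \<phi> y)) / 2)
    = - integral (cbox 0 1) (\<lambda>y. moment_map_divergence \<xi> u y * \<phi> y) / 2"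
proof -
  let ?g = "\<lambda>a b z. Re (moment_map_tensor \<xi> u z $ a $ b)"
  have sg: "smooth (?g a b)" for a b
    by (rule smooth_bounded_linear[OF bounded_linear_Re_entry smooth_moment_map_tensor(1)[OF \<xi> u]])
  have pg: "periodic (?g a b)" for a b
    using smooth_moment_map_tensor(2)[OF \<xi> u] by (simp add: periodic_def)
  \<comment> \<open>The trace pairs entry \<open>a\<close>, \<open>b\<close> of the tensor with
    entry \<open>b\<close>, \<open>a\<close> of the Hessian, hence the order of derivatives on
    \<open>\<phi>\<close>. Moving \<open>a\<close> first and \<open>b\<close> second reproduces the
    order in \<open>moment_map_divergence\<close>, and the two signs cancel.\<close>
  have parts: "integral (cbox 0 1) (\<lambda>y. ?g a b y * partial_derivative a (partial_derivative b \<phi>) y)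
    = integral (cbox 0 1) (\<lambda>y. partial_derivative b (partial_derivative a (?g a b)) y * \<phi> y)" for a b
    using integral_by_parts_periodic[OF sg pg smooth_partial_derivative[OF \<phi>(1)] periodic_partial_derivative[OF \<phi>(2)]]
      integral_by_parts_periodic[OF smooth_partial_derivative[OF sg] periodic_partial_derivative[OF pg] \<phi>]
    by simp
  have cont: "continuous_on (cbox 0 1) (\<lambda>y. ?g a b y * partial_derivative a (partial_derivative b \<phi>) y)"
    "continuous_on (cbox 0 1) (\<lambda>y. partial_derivative b (partial_derivative a (?g a b)) y * \<phi> y)" for a b
    by (intro continuous_on_mult smooth_continuous_on smooth_partial_derivative sg \<phi>)+
  have "Re (trace (moment_matrix (\<xi> y) (complex_hessian u y) ** complex_hessian \<phi> y))
    = (\<Sum>a\<in>UNIV. \<Sum>b\<in>UNIV. ?g a b y * partial_derivative a (partial_derivative b \<phi>) y)" for y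
    unfolding moment_map_tensor_eq[OF \<xi> u, symmetric]
    by (simp add: trace_def matrix_matrix_mult_def complex_hessian_def hessian_def)
  then have "integral (cbox 0 1) (\<lambda>y. Re (trace (moment_matrix (\<xi> y) (complex_hessian u y) ** complex_hessian \<phi> y)))
    = (\<Sum>a\<in>UNIV. \<Sum>b\<in>UNIV. integral (cbox 0 1) (\<lambda>y. ?g a b y * partial_derivative a (partial_derivative b \<phi>) y))"
    by (simp add: integral_sum integrable_continuous cont integrable_sum)
  also have "\<dots> = integral (cbox 0 1) (\<lambda>y. moment_map_divergence \<xi> u y * \<phi> y)"
    unfolding parts
    by (simp add: moment_map_divergence_def sum_distrib_right integral_sum integrable_continuous cont integrable_sum)
  finally show ?thesis by simp
qed

theorem proposition1p4:
  fixes \<xi> :: "real^'n \<Rightarrow> complex^'n^'n" and u :: "real^'n \<Rightarrow> real"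
  assumes "higgs_tensor \<xi>" and "u \<in> admissible_potentials \<xi>"
  shows "real_moment_map_equation \<xi> u \<longleftrightarrow>
    (\<forall>\<phi> :: real^'n \<Rightarrow> real. smooth \<phi> \<and> periodic \<phi> \<longrightarrow>
      ((\<lambda>t. periodic_HK_energy (\<lambda>y. u y + t * \<phi> y) \<xi>) has_real_derivative 0) (at 0))"
proof -
  let ?L = "moment_map_divergence \<xi> u"
  have deriv: "((\<lambda>t. periodic_HK_energy (\<lambda>y. u y + t * \<phi> y) \<xi>) has_real_derivative
      - integral (cbox 0 1) (\<lambda>y. ?L y * \<phi> y) / 2) (at 0)" if "smooth \<phi>" "periodic \<phi>" for \<phi>
    using first_variation[OF assms that(1)] integral_moment_map_divergence[OF assms that] by simp
  have sg: "smooth (\<lambda>z. Re (moment_map_tensor \<xi> u z $ a $ b))" for a b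
    by (rule smooth_bounded_linear[OF bounded_linear_Re_entry smooth_moment_map_tensor(1)[OF assms]])
  have pg: "periodic (\<lambda>z. Re (moment_map_tensor \<xi> u z $ a $ b))" for a b
    using smooth_moment_map_tensor(2)[OF assms] by (simp add: periodic_def)
  have sL: "smooth ?L"
    unfolding moment_map_divergence_def[abs_def] by (intro smooth_sum smooth_partial_derivative sg)
  have "periodic (partial_derivative b (partial_derivative a (\<lambda>z. Re (moment_map_tensor \<xi> u z $ a $ b))))" for a b
    by (intro periodic_partial_derivative pg)
  then have pL: "periodic ?L" by (simp add: periodic_def moment_map_divergence_def)
  show ?thesis
  proof
    assume "real_moment_map_equation \<xi> u"
    then have "\<And>y. ?L y = 0" using real_moment_map_equation_iff[OF assms] by blast
    then show "\<forall>\<phi>. smooth \<phi> \<and> periodic \<phi> \<longrightarrow>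
      ((\<lambda>t. periodic_HK_energy (\<lambda>y. u y + t * \<phi> y) \<xi>) has_real_derivative 0) (at 0)"
      using deriv by simp
  next
    assume "\<forall>\<phi>. smooth \<phi> \<and> periodic \<phi> \<longrightarrow>
      ((\<lambda>t. periodic_HK_energy (\<lambda>y. u y + t * \<phi> y) \<xi>) has_real_derivative 0) (at 0)"
    then have "((\<lambda>t. periodic_HK_energy (\<lambda>y. u y + t * ?L y) \<xi>) has_real_derivative 0) (at 0)"
      using sL pL by blast
    from DERIV_unique[OF deriv[OF sL pL] this]
    have "integral (cbox 0 1) (\<lambda>y. ?L y * ?L y) = 0" by simp
    then have "?L y = 0" for y
      by (rule integral_square_eq_0[OF smooth_continuous_on[OF sL] pL])
    then show "real_moment_map_equation \<xi> u" using real_moment_map_equation_iff[OF assms] by blast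
  qed
qed

end
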